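(* Let $d\ge3$. There exist finitely many rotations $g_1,\dots,g_k\in SO(d)$ and $\varepsilon>0$ such that for every $x\in\mathbb{R}^d$ with $\|x\|=1$, every $n\in\mathbb{N}$ and every $\delta>0$, \[ N_\delta(G^n(x))\ge\min\{(1+\varepsilon)^n,\ \varepsilon\,\delta^{-(d-1)}\}, \] where $G^n(x)=\{g_{i_1}\circ g_{i_2}\circ\cdots\circ g_{i_n}(x): i_1,\dots,i_n\in\{1,\dots,k\}\}$.
   Context: For bounded $E\subseteq\mathbb{R}^d$ and $\delta>0$, $N_\delta(E)$ is the number of half-open cubes of the $\delta$-mesh aligned with the coordinate axes that intersect $E$. *)

theory Defs
  imports "HOL-Analysis.Analysis"
begin

definition rotation_matrix :: "real^'n^'n \<Rightarrow> bool" where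
  "rotation_matrix A \<longleftrightarrow> orthogonal_matrix A \<and> det A = 1"

definition mesh_count :: "real \<Rightarrow> (real^'n) set \<Rightarrow> nat" where
  "mesh_count \<delta> E = card {m :: 'n \<Rightarrow> int. \<exists>x\<in>E. \<forall>i.
      \<delta> * of_int (m i) \<le> x $ i \<and> x $ i < \<delta> * (of_int (m i) + 1)}"

definition orbit_words :: "(nat \<Rightarrow> real^'n^'n) \<Rightarrow> nat \<Rightarrow> nat \<Rightarrow> real^'n \<Rightarrow> (real^'n) set" where
  "orbit_words g k n x = {foldr (\<lambda>i v. g i *v v) is x | is. length is = n \<and> set is \<subseteq> {1..k}}"

end

theory Submission
  imports Defs "HOL-Computational_Algebra.Polynomial" "HOL-Computational_Algebra.Primes"
    "HOL-Real_Asymp.Real_Asymp"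
begin

text \<open>Integral quaternions of norm \<open>p\<close> act on three-space by rotations. For a set \<open>A\<close> of such quaternions
  that generates a free semigroup, the number of pairs of words of length \<open>m\<close> whose quotient is close
  to the identity is bounded by counting lattice points near the poles of a three-sphere of
  radius \<open>p ^ m\<close>, with the divisor bound for representations as sums of two squares. Expanding a
  power of the cosine into characters of \<open>SU(2)\<close>, this count bounds the Hilbert-Schmidt norm of the word
  average in the representation of degree \<open>n\<close>. The high multiplicity of each representation makes the
  bound smaller than 1 for large \<open>n\<close>, and since Hilbert-Schmidt norms are submultiplicative, longer words
  give exponential decay. Hence words of length \<open>O(log (1 / \<delta>))\<close> are equidistributed at scale \<open>\<delta>\<close> up to
  constants, and the orbit of a point of the two-sphere meets at least \<open>c \<delta> powr (-2)\<close> cells.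

  In dimension \<open>d\<close> these rotations act on triples of coordinates. If moving the coordinates in \<open>I\<close>
  produces \<open>c / \<delta> ^ (card I - 1)\<close> cells, then a further triple that consists of two coordinates from \<open>I\<close>
  and one new coordinate gains another factor \<open>1 / \<delta>\<close>: forgetting the two old coordinates
  costs \<open>O(1 / \<delta>)\<close>, and each remaining class is spread over a two-sphere.\<close>

section \<open>Quaternions over a commutative ring, with norm form and conjugation\<close>

section \<open>Quaternions\<close>

text \<open>The spectral input is elementary: for each large even degree \<open>n\<close>, one word
  length of order \<open>ln n\<close> must give a word average of Hilbert-Schmidt norm below one; no
  sharp eigenvalue bound is behind it. By volume a near pair has probability about
  \<open>n ^ (-3)\<close>, and isolating degree \<open>n\<close> costs \<open>n ^ 2\<close>, so a
  margin of almost \<open>n\<close> remains for the losses: divisor counts cost a small power, and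
  taking one letter of each conjugate pair costs \<open>(p / card A) ^ (2 * m)\<close>. This is the
  price for words that need no reduction, and the prime must be large enough for it to fit the
  margin.

  Even powers of the cosine serve twice, as their Chebyshev coefficients are explicit and
  nonnegative: with exponent \<open>2 * n ^ 2\<close> they isolate degree \<open>n\<close>, with
  exponent of order \<open>1 / \<delta> ^ 2\<close> they are bumps of width \<open>\<delta>\<close>
  on the group. Odd degrees do not occur, since opposite quaternions give the same rotation.

  The claimed bound has no constant in front of \<open>(1 + \<epsilon>) ^ n\<close> and covers words
  far too short for \<open>\<delta>\<close>. Those are compared with a coarser mesh that they do
  fill.\<close>

datatype 'a quat = Quat (q0: 'a) (q1: 'a) (q2: 'a) (q3: 'a)

instantiation quat :: (comm_ring_1) ring_1
begin

definition zero_quat :: "'a quat" where "0 = Quat 0 0 0 0"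
definition one_quat :: "'a quat" where "1 = Quat 1 0 0 0"
definition plus_quat :: "'a quat \<Rightarrow> 'a quat \<Rightarrow> 'a quat" where
  "x + y = Quat (q0 x + q0 y) (q1 x + q1 y) (q2 x + q2 y) (q3 x + q3 y)"
definition minus_quat :: "'a quat \<Rightarrow> 'a quat \<Rightarrow> 'a quat" where
  "x - y = Quat (q0 x - q0 y) (q1 x - q1 y) (q2 x - q2 y) (q3 x - q3 y)"
definition uminus_quat :: "'a quat \<Rightarrow> 'a quat" where
  "- x = Quat (- q0 x) (- q1 x) (- q2 x) (- q3 x)"
definition times_quat :: "'a quat \<Rightarrow> 'a quat \<Rightarrow> 'a quat" where
  "x * y = Quat
    (q0 x * q0 y - q1 x * q1 y - q2 x * q2 y - q3 x * q3 y)
    (q0 x * q1 y + q1 x * q0 y + q2 x * q3 y - q3 x * q2 y)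
    (q0 x * q2 y - q1 x * q3 y + q2 x * q0 y + q3 x * q1 y)
    (q0 x * q3 y + q1 x * q2 y - q2 x * q1 y + q3 x * q0 y)"

instance
  by standard
    (simp_all add: zero_quat_def one_quat_def plus_quat_def minus_quat_def uminus_quat_def
      times_quat_def algebra_simps)

end

lemmas quat_defs = zero_quat_def one_quat_def plus_quat_def minus_quat_def uminus_quat_def
  times_quat_def

definition qcnj :: "'a::comm_ring_1 quat \<Rightarrow> 'a quat" where
  "qcnj x = Quat (q0 x) (- q1 x) (- q2 x) (- q3 x)"

definition qdot :: "'a::comm_ring_1 quat \<Rightarrow> 'a quat \<Rightarrow> 'a" where
  "qdot x y = q0 x * q0 y + q1 x * q1 y + q2 x * q2 y + q3 x * q3 y"

definition qscale :: "'a::comm_ring_1 \<Rightarrow> 'a quat \<Rightarrow> 'a quat" where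
  "qscale c x = Quat (c * q0 x) (c * q1 x) (c * q2 x) (c * q3 x)"

abbreviation qnorm :: "'a::comm_ring_1 quat \<Rightarrow> 'a" where
  "qnorm x \<equiv> qdot x x"

lemmas quat_simps = quat_defs qcnj_def qdot_def qscale_def

lemma qnorm_mult: "qnorm (x * y) = qnorm x * qnorm y"
  by (simp add: quat_simps algebra_simps)

lemma qcnj_mult: "qcnj (x * y) = qcnj y * qcnj x"
  by (simp add: quat_simps algebra_simps)

lemma qcnj_qcnj [simp]: "qcnj (qcnj x) = x"
  by (simp add: quat_simps)

lemma qnorm_qcnj [simp]: "qnorm (qcnj x) = qnorm x"
  by (simp add: quat_simps)

lemma qdot_mult_right: "qdot (x * z) (y * z) = qdot x y * qnorm z"
  by (simp add: quat_simps algebra_simps)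

lemma qdot_mult_left: "qdot (z * x) (z * y) = qnorm z * qdot x y"
  by (simp add: quat_simps algebra_simps)

lemma q0_mult_qcnj: "q0 (x * qcnj y) = qdot x y"
  by (simp add: quat_simps algebra_simps)

lemma qcnj_mult_self: "qcnj x * x = qscale (qnorm x) 1"
  by (simp add: quat_simps algebra_simps)

text \<open>Multiply \<open>x * qcnj y + y * qcnj x = 2 (qdot x y)\<close> by \<open>x\<close> on
  the right. Modulo \<open>qnorm x\<close> the sandwich is a scalar multiple of \<open>x\<close>,
  and the freeness of words rests on this.\<close>

lemma qmult_swap: "x * qcnj y * x = qscale (2 * qdot x y) x - qscale (qnorm x) y"
  by (cases x; cases y) (simp add: quat_simps algebra_simps)

section \<open>Representations of SU(2) on binary forms of degree n\<close>

section \<open>Symmetric powers of the standard representation\<close>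

text \<open>The image of \<open>X ^ j * Y ^ (n - j)\<close> under \<open>X \<mapsto> a X + b Y\<close>, \<open>Y \<mapsto> c X + d Y\<close>, dehomogenized by
  \<open>Y = 1\<close>.\<close>

definition linsub :: "nat \<Rightarrow> complex \<Rightarrow> complex \<Rightarrow> complex \<Rightarrow> complex \<Rightarrow> nat \<Rightarrow> complex poly" where
  "linsub n a b c d j = [:b, a:] ^ j * [:d, c:] ^ (n - j)"

definition homog :: "nat \<Rightarrow> complex poly \<Rightarrow> complex \<Rightarrow> complex \<Rightarrow> complex" where
  "homog n p X Y = (\<Sum>k\<le>n. coeff p k * X ^ k * Y ^ (n - k))"

lemma homog_linear_mult:
  assumes "degree p \<le> n"
  shows "homog (Suc n) ([:b, a:] * p) X Y = (a * X + b * Y) * homog n p X Y"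
proof -
  have c: "coeff ([:b, a:] * p) k = b * coeff p k + (if k = 0 then 0 else a * coeff p (k - 1))" for k
    by (cases k) (auto simp: coeff_pCons)
  have "homog (Suc n) ([:b, a:] * p) X Y =
      (\<Sum>k\<le>Suc n. b * coeff p k * X ^ k * Y ^ (Suc n - k)) +
      (\<Sum>k\<le>Suc n. (if k = 0 then 0 else a * coeff p (k - 1)) * X ^ k * Y ^ (Suc n - k))"
    unfolding homog_def c by (simp only: sum.distrib[symmetric] distrib_right)
  also have "(\<Sum>k\<le>Suc n. b * coeff p k * X ^ k * Y ^ (Suc n - k)) = b * Y * homog n p X Y"
  proof -
    have "coeff p (Suc n) = 0"
      using assms by (intro coeff_eq_0) auto
    then have "(\<Sum>k\<le>Suc n. b * coeff p k * X ^ k * Y ^ (Suc n - k)) =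
        (\<Sum>k\<le>n. b * coeff p k * X ^ k * Y ^ (Suc n - k))" by simp
    also have "\<dots> = (\<Sum>k\<le>n. b * Y * (coeff p k * X ^ k * Y ^ (n - k)))"
      by (intro sum.cong) (auto simp: Suc_diff_le)
    finally show ?thesis by (simp only: homog_def sum_distrib_left)
  qed
  also have "(\<Sum>k\<le>Suc n. (if k = 0 then 0 else a * coeff p (k - 1)) * X ^ k * Y ^ (Suc n - k))
      = a * X * homog n p X Y"
    unfolding sum.atMost_Suc_shift homog_def sum_distrib_left
    by (simp add: mult_ac)
  finally show ?thesis by (simp add: algebra_simps)
qed

lemma degree_linsub: "j \<le> n \<Longrightarrow> degree (linsub n a b c d j) \<le> n"
proof -
  assume "j \<le> n"
  have "degree ([:b, a:] ^ j) \<le> 1 * j" "degree ([:d, c:] ^ (n - j)) \<le> 1 * (n - j)"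
    by (rule order_trans[OF degree_power_le], simp)+
  with \<open>j \<le> n\<close> show ?thesis
    unfolding linsub_def by (intro order_trans[OF degree_mult_le]) linarith
qed

lemma homog_linsub_aux:
  "homog (i + j) ([:b, a:] ^ i * [:d, c:] ^ j) X Y = (a * X + b * Y) ^ i * (c * X + d * Y) ^ j"
proof (induction i)
  case 0
  show ?case
  proof (induction j)
    case 0
    show ?case by (simp add: homog_def)
  next
    case (Suc j)
    have "degree ([:d, c:] ^ j) \<le> 1 * j"
      by (rule order_trans[OF degree_power_le]) simp
    then have "homog (Suc j) ([:d, c:] * [:d, c:] ^ j) X Y = (c * X + d * Y) * homog j ([:d, c:] ^ j) X Y"
      by (intro homog_linear_mult) simp
    with Suc show ?case by simp
  qed
next
  case (Suc i)
  have "degree ([:b, a:] ^ i) \<le> 1 * i" "degree ([:d, c:] ^ j) \<le> 1 * j"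
    by (rule order_trans[OF degree_power_le], simp)+
  then have "degree ([:b, a:] ^ i * [:d, c:] ^ j) \<le> i + j"
    by (intro order_trans[OF degree_mult_le]) linarith
  from homog_linear_mult[OF this, of b a X Y] Suc show ?case
    by (simp only: power_Suc mult.assoc add_Suc)
qed

lemma homog_linsub:
  "j \<le> n \<Longrightarrow> homog n (linsub n a b c d j) X Y = (a * X + b * Y) ^ j * (c * X + d * Y) ^ (n - j)"
  using homog_linsub_aux[of j "n - j"] by (simp add: linsub_def)

definition symc :: "nat \<Rightarrow> complex \<Rightarrow> complex \<Rightarrow> complex \<Rightarrow> complex \<Rightarrow> nat \<Rightarrow> nat \<Rightarrow> complex" where
  "symc n a b c d j k = coeff (linsub n a b c d j) k"

text \<open>Substituting the second linear map into the image of \<open>X ^ j * Y ^ (n - j)\<close>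
  under the first gives the image under the composite. \<open>homog_linsub\<close> evaluates the
  nested substitution, and polynomials that agree at every \<open>z\<close> have equal
  coefficients.\<close>

lemma symc_mult:
  assumes "j \<le> n" "l \<le> n"
  shows "(\<Sum>k\<le>n. symc n a b c d j k * symc n a' b' c' d' k l) =
    symc n (a * a' + b * c') (a * b' + b * d') (c * a' + d * c') (c * b' + d * d') j l"
proof -
  have "(\<Sum>k\<le>n. smult (symc n a b c d j k) (linsub n a' b' c' d' k)) =
      linsub n (a * a' + b * c') (a * b' + b * d') (c * a' + d * c') (c * b' + d * d') j"
  proof (rule poly_eq_poly_eq_iff[THEN iffD1], rule ext)
    show "poly (\<Sum>k\<le>n. smult (symc n a b c d j k) (linsub n a' b' c' d' k)) z =
      poly (linsub n (a * a' + b * c') (a * b' + b * d') (c * a' + d * c') (c * b' + d * d') j) z" for z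
    proof -
      have "poly (\<Sum>k\<le>n. smult (symc n a b c d j k) (linsub n a' b' c' d' k)) z =
          homog n (linsub n a b c d j) (b' + z * a') (d' + z * c')"
        by (simp add: poly_sum homog_def symc_def linsub_def mult_ac)
      also have "\<dots> = (a * (b' + z * a') + b * (d' + z * c')) ^ j *
          (c * (b' + z * a') + d * (d' + z * c')) ^ (n - j)"
        by (rule homog_linsub[OF assms(1)])
      also have "\<dots> = poly (linsub n (a * a' + b * c') (a * b' + b * d') (c * a' + d * c') (c * b' + d * d') j) z"
        unfolding linsub_def poly_mult poly_power
        by (intro arg_cong2[where f = "(*)"] arg_cong2[where f = "(^)"]) (simp_all add: algebra_simps)
      finally show ?thesis .
    qed
  qed
  from arg_cong[OF this, of "\<lambda>p. coeff p l"] show ?thesis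
    by (simp add: coeff_sum symc_def)
qed

text \<open>Both sides are coefficients of \<open>(y * (a * z + b) + (c * z + d)) ^ n\<close>, which
  is unchanged when \<open>y\<close>, \<open>z\<close> and \<open>b\<close>, \<open>c\<close> are
  exchanged together.\<close>

lemma symc_transpose:
  assumes "j \<le> n" "k \<le> n"
  shows "of_nat (n choose j) * symc n a b c d j k = of_nat (n choose k) * symc n a c b d k j"
proof -
  have gen: "(\<Sum>j\<le>n. \<Sum>k\<le>n. of_nat (n choose j) * symc n a b c d j k * y ^ j * z ^ k) =
      (y * (a * z + b) + (c * z + d)) ^ n" for a b c d y z
  proof -
    have "(\<Sum>j\<le>n. \<Sum>k\<le>n. of_nat (n choose j) * symc n a b c d j k * y ^ j * z ^ k) =
        (\<Sum>j\<le>n. of_nat (n choose j) * y ^ j * homog n (linsub n a b c d j) z 1)"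
      by (intro sum.cong) (auto simp: homog_def symc_def sum_distrib_left mult_ac)
    also have "\<dots> = (\<Sum>j\<le>n. of_nat (n choose j) * (y * (a * z + b)) ^ j * (c * z + d) ^ (n - j))"
      by (intro sum.cong) (auto simp: homog_linsub power_mult_distrib mult_ac)
    also have "\<dots> = (y * (a * z + b) + (c * z + d)) ^ n"
      by (simp add: binomial_ring)
    finally show ?thesis .
  qed
  have "(\<Sum>j\<le>n. (\<Sum>k\<le>n. of_nat (n choose j) * symc n a b c d j k * z ^ k) * y ^ j) =
      (\<Sum>j\<le>n. (\<Sum>k\<le>n. of_nat (n choose k) * symc n a c b d k j * z ^ k) * y ^ j)" for y z
  proof -
    have "(\<Sum>j\<le>n. (\<Sum>k\<le>n. of_nat (n choose j) * symc n a b c d j k * z ^ k) * y ^ j) =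
       (y * (a * z + b) + (c * z + d)) ^ n"
      unfolding gen[symmetric] by (simp add: sum_distrib_left sum_distrib_right mult_ac)
    also have "\<dots> = (z * (a * y + c) + (b * y + d)) ^ n" by (simp add: algebra_simps)
    also have "\<dots> = (\<Sum>j\<le>n. (\<Sum>k\<le>n. of_nat (n choose k) * symc n a c b d k j * z ^ k) * y ^ j)"
      unfolding gen[symmetric] by (subst sum.swap) (simp add: sum_distrib_left sum_distrib_right mult_ac)
    finally show ?thesis .
  qed
  then have "(\<Sum>k\<le>n. of_nat (n choose j) * symc n a b c d j k * z ^ k) =
      (\<Sum>k\<le>n. of_nat (n choose k) * symc n a c b d k j * z ^ k)" for z
    using polyfun_eq_coeffs[of "\<lambda>j. \<Sum>k\<le>n. of_nat (n choose j) * symc n a b c d j k * z ^ k" n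
      "\<lambda>j. \<Sum>k\<le>n. of_nat (n choose k) * symc n a c b d k j * z ^ k"] assms(1) by auto
  then show ?thesis
    using polyfun_eq_coeffs[of "\<lambda>k. of_nat (n choose j) * symc n a b c d j k" n
      "\<lambda>k. of_nat (n choose k) * symc n a c b d k j"] assms(2) by auto
qed

lemma symc_Suc_Suc:
  "symc (Suc n) a b c d (Suc j) (Suc k) = a * symc n a b c d j k + b * symc n a b c d j (Suc k)"
  "symc (Suc n) a b c d (Suc j) 0 = b * symc n a b c d j 0"
proof -
  have "linsub (Suc n) a b c d (Suc j) = [:b, a:] * linsub n a b c d j"
    by (simp only: linsub_def power_Suc diff_Suc_Suc mult.assoc)
  then show "symc (Suc n) a b c d (Suc j) (Suc k) = a * symc n a b c d j k + b * symc n a b c d j (Suc k)"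
    "symc (Suc n) a b c d (Suc j) 0 = b * symc n a b c d j 0"
    by (simp_all add: symc_def)
qed

lemma symc_Suc:
  assumes "j \<le> n"
  shows "symc (Suc n) a b c d j (Suc k) = c * symc n a b c d j k + d * symc n a b c d j (Suc k)"
    and "symc (Suc n) a b c d j 0 = d * symc n a b c d j 0"
proof -
  have "linsub (Suc n) a b c d j = [:d, c:] * linsub n a b c d j"
    by (simp only: linsub_def power_Suc Suc_diff_le[OF assms] mult.left_commute)
  then show "symc (Suc n) a b c d j (Suc k) = c * symc n a b c d j k + d * symc n a b c d j (Suc k)"
    "symc (Suc n) a b c d j 0 = d * symc n a b c d j 0"
    by (simp_all add: symc_def)
qed

lemma symc_above: "j \<le> n \<Longrightarrow> k > n \<Longrightarrow> symc n a b c d j k = 0"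
  unfolding symc_def using degree_linsub[of j n a b c d] by (intro coeff_eq_0) auto

text \<open>Chebyshev polynomials of the second kind: \<open>cheb n (cos t) = sin ((n + 1) t) / sin t\<close> are the
  characters of \<open>SU(2)\<close>.\<close>

fun cheb :: "nat \<Rightarrow> real \<Rightarrow> real" where
  "cheb 0 x = 1"
| "cheb (Suc 0) x = 2 * x"
| "cheb (Suc (Suc n)) x = 2 * x * cheb (Suc n) x - cheb n x"

lemma symc_corner: "symc n a b c d 0 0 = d ^ n"
  by (simp add: symc_def linsub_def coeff_0_power)

text \<open>Splitting off one linear factor couples the trace to the sum \<open>S\<close> over the
  superdiagonal. Eliminating \<open>S\<close> leaves a recurrence whose coefficients are the trace
  and determinant of the two by two matrix.\<close>

lemma symc_trace_recurrence:
  fixes a b c d :: complex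
  defines "T \<equiv> \<lambda>n. \<Sum>j\<le>n. symc n a b c d j j"
  shows "T (Suc (Suc n)) = (a + d) * T (Suc n) - (a * d - b * c) * T n"
proof -
  define S where "S = (\<lambda>n. \<Sum>j\<le>n. symc n a b c d j (Suc j))"
  have T: "T (Suc n) = d ^ Suc n + a * T n + b * S n" for n
  proof -
    have "T (Suc n) = symc (Suc n) a b c d 0 0 + (\<Sum>j\<le>n. symc (Suc n) a b c d (Suc j) (Suc j))"
      unfolding T_def by (rule sum.atMost_Suc_shift)
    also have "(\<Sum>j\<le>n. symc (Suc n) a b c d (Suc j) (Suc j)) = a * T n + b * S n"
      by (simp add: symc_Suc_Suc T_def S_def sum.distrib sum_distrib_left)
    finally show ?thesis by (simp only: symc_corner add.assoc)
  qed
  have S: "S (Suc n) = c * T n + d * S n" for n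
  proof -
    have "S (Suc n) = (\<Sum>j\<le>n. symc (Suc n) a b c d j (Suc j))"
      unfolding S_def by (simp add: symc_above)
    then show ?thesis
      by (simp add: symc_Suc T_def S_def sum.distrib sum_distrib_left)
  qed
  have "T (Suc (Suc n)) = d ^ Suc (Suc n) + a * T (Suc n) + b * (c * T n + d * S n)"
    by (simp only: T[of "Suc n"] S)
  also have "\<dots> = d * (d ^ Suc n + a * T n + b * S n) + a * T (Suc n) - (a * d - b * c) * T n"
    by (simp add: algebra_simps)
  finally show ?thesis
    by (simp only: T[of n, symmetric] distrib_right)  (simp add: algebra_simps)
qed

text \<open>Square roots of binomial coefficients rescale the monomials to an orthonormal basis, which makes
  the representation unitary.\<close>

definition repm :: "nat \<Rightarrow> real quat \<Rightarrow> nat \<Rightarrow> nat \<Rightarrow> complex" where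
  "repm n q j k = of_real (sqrt (n choose j) / sqrt (n choose k)) *
     symc n (Complex (q0 q) (q1 q)) (Complex (q2 q) (q3 q))
            (Complex (- q2 q) (q3 q)) (Complex (q0 q) (- q1 q)) j k"

text \<open>The four complex entries in \<open>repm\<close> form the usual embedding of quaternions
  into two by two matrices, so multiplicativity is \<open>symc_mult\<close>; the square roots at the
  inner index cancel.\<close>

lemma repm_mult:
  assumes "j \<le> n" "l \<le> n"
  shows "(\<Sum>k\<le>n. repm n q j k * repm n r k l) = repm n (q * r) j l"
proof -
  have nz: "n choose k \<noteq> 0" if "k \<le> n" for k
    using that by simp
  let ?A = "symc n (Complex (q0 q) (q1 q)) (Complex (q2 q) (q3 q))
            (Complex (- q2 q) (q3 q)) (Complex (q0 q) (- q1 q))"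
  let ?B = "symc n (Complex (q0 r) (q1 r)) (Complex (q2 r) (q3 r))
            (Complex (- q2 r) (q3 r)) (Complex (q0 r) (- q1 r))"
  have "(\<Sum>k\<le>n. repm n q j k * repm n r k l) =
      (\<Sum>k\<le>n. of_real (sqrt (n choose j) / sqrt (n choose l)) * (?A j k * ?B k l))"
    using nz by (intro sum.cong) (auto simp: repm_def)
  also have "\<dots> = of_real (sqrt (n choose j) / sqrt (n choose l)) * (\<Sum>k\<le>n. ?A j k * ?B k l)"
    by (simp add: sum_distrib_left)
  also have "(\<Sum>k\<le>n. ?A j k * ?B k l) = symc n (Complex (q0 (q*r)) (q1 (q*r))) (Complex (q2 (q*r)) (q3 (q*r)))
            (Complex (- q2 (q*r)) (q3 (q*r))) (Complex (q0 (q*r)) (- q1 (q*r))) j l"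
  proof -
    have "Complex (q0 q) (q1 q) * Complex (q0 r) (q1 r) + Complex (q2 q) (q3 q) * Complex (- q2 r) (q3 r)
        = Complex (q0 (q*r)) (q1 (q*r))"
      "Complex (q0 q) (q1 q) * Complex (q2 r) (q3 r) + Complex (q2 q) (q3 q) * Complex (q0 r) (- q1 r)
        = Complex (q2 (q*r)) (q3 (q*r))"
      "Complex (- q2 q) (q3 q) * Complex (q0 r) (q1 r) + Complex (q0 q) (- q1 q) * Complex (- q2 r) (q3 r)
        = Complex (- q2 (q*r)) (q3 (q*r))"
      "Complex (- q2 q) (q3 q) * Complex (q2 r) (q3 r) + Complex (q0 q) (- q1 q) * Complex (q0 r) (- q1 r)
        = Complex (q0 (q*r)) (- q1 (q*r))"
      by (simp_all add: complex_eq_iff times_quat_def algebra_simps)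
    then show ?thesis
      unfolding symc_mult[OF assms] by (simp only:)
  qed
  finally show ?thesis by (simp add: repm_def)
qed

lemma symc_cnj: "j \<le> n \<Longrightarrow> cnj (symc n a b c d j k) = symc n (cnj a) (cnj b) (cnj c) (cnj d) j k"
proof (induction n arbitrary: j k)
  case 0
  then show ?case by (simp add: symc_def linsub_def coeff_pCons split: nat.split)
next
  case (Suc n)
  then show ?case
    by (cases j; cases k) (auto simp: symc_Suc symc_Suc_Suc)
qed

lemma cnj_Complex: "cnj (Complex a b) = Complex a (- b)"
  by (simp add: complex_eq_iff)

text \<open>Conjugating a quaternion takes the adjoint of its two by two matrix, and
  \<open>symc_transpose\<close> matches the transposition with the binomial rescaling. For
  \<open>qnorm q = 1\<close> this is unitarity.\<close>

lemma repm_qcnj: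
  assumes "j \<le> n" "k \<le> n"
  shows "repm n (qcnj q) j k = cnj (repm n q k j)"
proof -
  let ?A = "symc n (Complex (q0 q) (q1 q)) (Complex (q2 q) (q3 q))
            (Complex (- q2 q) (q3 q)) (Complex (q0 q) (- q1 q))"
  let ?B = "symc n (Complex (q0 q) (- q1 q)) (Complex (- q2 q) (- q3 q))
            (Complex (q2 q) (- q3 q)) (Complex (q0 q) (q1 q))"
  let ?J = "complex_of_real (real (n choose j))" and ?K = "complex_of_real (real (n choose k))"
  have pos: "real (n choose j) > 0" "real (n choose k) > 0"
    using assms by auto
  have "of_nat (n choose j) * ?B j k = of_nat (n choose k) * cnj (?A k j)"
    unfolding symc_transpose[OF assms] symc_cnj[OF assms(2)] cnj_Complex by simp
  then have eq: "?J * ?B j k = ?K * cnj (?A k j)" by simp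
  have "repm n (qcnj q) j k = of_real (sqrt (n choose j) / sqrt (n choose k)) * ?B j k"
    by (simp add: repm_def qcnj_def)
  also have "\<dots> = of_real (sqrt (n choose j) / sqrt (n choose k) / (n choose j)) * (?J * ?B j k)"
    using pos by simp
  also have "\<dots> = of_real (sqrt (n choose j) / sqrt (n choose k) / (n choose j) * (n choose k)) * cnj (?A k j)"
    unfolding eq by (simp only: of_real_mult mult.assoc)
  also have "sqrt (n choose j) / sqrt (n choose k) / (n choose j) * (n choose k) =
      sqrt (n choose k) / sqrt (n choose j)"
    using pos by (simp add: field_simps)
  finally show ?thesis by (simp add: repm_def)
qed

text \<open>The two by two matrix has trace \<open>2 * q0 q\<close> and determinant 1, so the trace
  recurrence is that of \<open>cheb\<close>; on the diagonal the rescaling factor is 1.\<close>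

lemma repm_trace:
  assumes "qnorm q = 1"
  shows "(\<Sum>j\<le>n. repm n q j j) = of_real (cheb n (q0 q))"
proof -
  let ?a = "Complex (q0 q) (q1 q)" and ?b = "Complex (q2 q) (q3 q)"
    and ?c = "Complex (- q2 q) (q3 q)" and ?d = "Complex (q0 q) (- q1 q)"
  have "(\<Sum>j\<le>n. symc n ?a ?b ?c ?d j j) = of_real (cheb n (q0 q))"
  proof (induction n rule: induct_nat_012)
    case 0
    show ?case by (simp add: symc_corner)
  next
    case 1
    have "symc (Suc 0) ?a ?b ?c ?d (Suc 0) (Suc 0) = ?a"
      by (simp add: symc_Suc_Suc symc_above symc_corner)
    then show ?case
      by (simp add: symc_corner) (simp add: complex_eq_iff)
  next
    case (ge2 n)
    have "?a * ?d - ?b * ?c = 1" "?a + ?d = of_real (2 * q0 q)"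
      using assms by (auto simp: complex_eq_iff qdot_def)
    then show ?case
      by (simp add: symc_trace_recurrence ge2 del: sum.atMost_Suc)
  qed
  moreover have "(\<Sum>j\<le>n. repm n q j j) = (\<Sum>j\<le>n. symc n ?a ?b ?c ?d j j)"
    by (intro sum.cong) (auto simp: repm_def)
  ultimately show ?thesis by simp
qed

section \<open>Clebsch-Gordan multiplicities and their size\<close>

section \<open>Powers as combinations of Chebyshev polynomials\<close>

text \<open>The number of walks with \<open>N\<close> unit steps on the nonnegative integers from 0
  to \<open>n\<close>. It is the multiplicity of the character \<open>cheb n\<close> in
  \<open>(2 * x) ^ N\<close>, since multiplication by \<open>2 * x\<close> sends a character to the
  sum of its neighbours.\<close>

fun ballot :: "nat \<Rightarrow> nat \<Rightarrow> nat" where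
  "ballot 0 n = (if n = 0 then 1 else 0)"
| "ballot (Suc N) 0 = ballot N (Suc 0)"
| "ballot (Suc N) (Suc n) = ballot N n + ballot N (Suc (Suc n))"

lemma ballot_above: "n > N \<Longrightarrow> ballot N n = 0"
  by (induction N n rule: ballot.induct) auto

lemma two_x_power_cheb: "(2 * x) ^ N = (\<Sum>n\<le>N. real (ballot N n) * cheb n x)"
proof (induction N)
  case (Suc N)
  have e: "2 * x * cheb n x = (if n = 0 then 0 else cheb (n - 1) x) + cheb (Suc n) x" for n
    by (cases n) auto
  have "(2 * x) ^ Suc N = (\<Sum>n\<le>N. real (ballot N n) * (2 * x * cheb n x))"
    unfolding power_Suc Suc sum_distrib_left by (simp only: mult_ac)
  also have "\<dots> = (\<Sum>n\<le>N. real (ballot N n) * (if n = 0 then 0 else cheb (n - 1) x))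
      + (\<Sum>n\<le>N. real (ballot N n) * cheb (Suc n) x)"
    unfolding e by (simp only: distrib_left sum.distrib)
  also have "(\<Sum>n\<le>N. real (ballot N n) * (if n = 0 then 0 else cheb (n - 1) x)) =
      (\<Sum>n\<le>Suc (Suc N). real (ballot N n) * (if n = 0 then 0 else cheb (n - 1) x))"
    by (simp add: ballot_above)
  also have "\<dots> = (\<Sum>n\<le>Suc N. real (ballot N (Suc n)) * cheb n x)"
    by (subst sum.atMost_Suc_shift) simp
  also have "\<dots> = real (ballot N (Suc 0)) * cheb 0 x + (\<Sum>n\<le>N. real (ballot N (Suc (Suc n))) * cheb (Suc n) x)"
    by (rule sum.atMost_Suc_shift)
  also have "\<dots> + (\<Sum>n\<le>N. real (ballot N n) * cheb (Suc n) x) =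
      (\<Sum>n\<le>Suc N. real (ballot (Suc N) n) * cheb n x)"
    unfolding sum.atMost_Suc_shift by (simp add: sum.distrib[symmetric] algebra_simps)
  finally show ?case .
qed simp

lemma ballot_odd: "odd (N + n) \<Longrightarrow> ballot N n = 0"
  by (induction N n rule: ballot.induct) (auto intro: odd_pos)

text \<open>The reflection principle, with \<open>k\<close> the number of downward steps; written
  additively because subtraction on \<open>nat\<close> truncates.\<close>

lemma ballot_diff:
  "n + 2 * k = N \<Longrightarrow> ballot N n + (if k = 0 then 0 else N choose (k - 1)) = N choose k"
proof (induction N n arbitrary: k rule: ballot.induct)
  case (2 N)
  then obtain l where l: "k = Suc l" by (cases k) auto
  with 2 have N: "N = Suc (2 * l)" by simp
  have "ballot N (Suc 0) + (if l = 0 then 0 else N choose (l - 1)) = N choose l"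
    using 2 l by simp
  moreover have "N choose Suc l = N choose l"
    using N by (subst binomial_symmetric) auto
  ultimately show ?case
    by (cases l) (auto simp: l)
next
  case (3 N n)
  show ?case
  proof (cases k)
    case 0
    with 3 show ?thesis by (auto simp: ballot_above)
  next
    case (Suc l)
    have "ballot N n + (N choose l) = N choose k"
      using 3(1)[of k] 3(3) Suc by simp
    moreover have "ballot N (Suc (Suc n)) + (if l = 0 then 0 else N choose (l - 1)) = N choose l"
      using 3(2)[of l] 3(3) Suc by simp
    ultimately show ?thesis
      by (cases l) (auto simp: Suc)
  qed
qed auto

lemma ballot_closed:
  assumes "n + 2 * k = N"
  shows "real (N + 1) * real (ballot N n) = (real n + 1) * real (Suc N choose k)"
proof (cases k)
  case 0
  with assms ballot_diff[OF assms] show ?thesis by simp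
next
  case (Suc l)
  define M where "M = real N"
  define b where "b = real (ballot N n)"
  define x where "x = real (N choose k)"
  define y where "y = real (N choose l)"
  define z where "z = real (Suc N choose k)"
  have "Suc l * (Suc N choose Suc l) = Suc N * (N choose l)"
    by (rule Suc_times_binomial)
  then have "(M + 1) * y = real k * z"
    unfolding M_def y_def z_def Suc by (metis of_nat_Suc of_nat_mult add.commute)
  moreover have "x + y = z"
    unfolding x_def y_def z_def Suc by simp
  moreover have "b + y = x"
    using ballot_diff[OF assms] Suc unfolding b_def y_def x_def by (simp flip: of_nat_add)
  moreover have "M = real n + 2 * real k"
    unfolding M_def by (simp flip: assms)
  ultimately have "(M + 1) * b = (real n + 1) * z"
    by algebra
  then show ?thesis by (simp add: M_def b_def z_def add.commute)
qed

lemma central_binomial_Suc: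
  "real (2 * Suc L choose Suc L) * (real L + 1) = real (2 * L choose L) * (2 * (2 * real L + 1))"
proof -
  have e: "A * Suc L = C * (2 * Suc (2 * L))"
    if "Suc L * A = Suc L * (2 * B)" "Suc L * B' = Suc (2 * L) * C" "B' = B" for A B B' C :: nat
  proof -
    have "A * Suc L = 2 * (Suc L * B')" using that(1,3) by (simp only: mult_ac)
    also have "\<dots> = C * (2 * Suc (2 * L))" unfolding that(2) by (simp only: mult_ac)
    finally show ?thesis .
  qed
  have n: "2 * Suc L = Suc (Suc (2 * L))" by simp
  have "(2 * Suc L choose Suc L) * Suc L = (2 * L choose L) * (2 * Suc (2 * L))"
  proof (rule e)
    have "Suc L * (2 * Suc L choose Suc L) = Suc (Suc (2 * L)) * (Suc (2 * L) choose L)"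
      unfolding n by (rule Suc_times_binomial)
    also have "\<dots> = Suc L * (2 * (Suc (2 * L) choose L))"
      unfolding n[symmetric] by (simp only: mult_ac)
    finally show "Suc L * (2 * Suc L choose Suc L) = Suc L * (2 * (Suc (2 * L) choose L))" .
    show "Suc L * (Suc (2 * L) choose Suc L) = Suc (2 * L) * (2 * L choose L)"
      by (rule Suc_times_binomial)
    show "Suc (2 * L) choose Suc L = Suc (2 * L) choose L"
      by (subst binomial_symmetric) auto
  qed
  then have "real ((2 * Suc L choose Suc L) * Suc L) = real ((2 * L choose L) * (2 * Suc (2 * L)))"
    by (rule arg_cong)
  then show ?thesis by (simp only: of_nat_mult) (simp add: algebra_simps del: binomial_Suc_Suc)
qed

text \<open>Squaring keeps roots out of the induction. Consecutive terms grow by a factor of at most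
  16 because \<open>(2 * l + 1) * (2 * l + 3) = 4 * (l + 1)\<^sup>2 - 1\<close>.\<close>

lemma central_binomial_upper: "(real (2 * L choose L))\<^sup>2 * (2 * real L + 1) \<le> 16 ^ L"
proof (induction L)
  case (Suc L)
  define a where "a = real (2 * L choose L)"
  define l where "l = real L"
  have l: "l \<ge> 0" by (simp add: l_def)
  have b: "real (2 * Suc L choose Suc L) = a * (2 * (2 * l + 1)) / (l + 1)"
    using central_binomial_Suc[of L] l by (simp add: a_def l_def field_simps)
  have "(real (2 * Suc L choose Suc L))\<^sup>2 * (2 * real (Suc L) + 1) =
      (a\<^sup>2 * (2 * l + 1)) * (4 * ((2 * l + 1) * (2 * l + 3)) / (l + 1)\<^sup>2)"
    unfolding b by (simp add: l_def power2_eq_square field_simps)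
  also have "4 * ((2 * l + 1) * (2 * l + 3)) / (l + 1)\<^sup>2 \<le> 16"
    using l by (simp add: divide_le_eq power2_eq_square algebra_simps add_pos_nonneg)
  also have "a\<^sup>2 * (2 * l + 1) \<le> 16 ^ L"
    using Suc by (simp add: a_def l_def)
  finally show ?case using l by (simp add: mult_right_mono mult_left_mono)
qed simp

lemma central_binomial_lower: "L \<ge> 1 \<Longrightarrow> 16 ^ L \<le> (real (2 * L choose L))\<^sup>2 * (4 * real L)"
proof (induction L rule: nat_induct_at_least)
  case base
  show ?case by simp
next
  case (Suc L)
  define a where "a = real (2 * L choose L)"
  define l where "l = real L"
  have l: "l \<ge> 1" using Suc by (simp add: l_def)
  have b: "real (2 * Suc L choose Suc L) = a * (2 * (2 * l + 1)) / (l + 1)"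
    using central_binomial_Suc[of L] l by (simp add: a_def l_def field_simps)
  have "16 ^ Suc L \<le> (a\<^sup>2 * (4 * l)) * 16"
    using Suc by (simp add: a_def l_def mult_ac)
  also have "16 \<le> 4 * (2 * l + 1)\<^sup>2 / (l * (l + 1))"
    using l by (subst pos_le_divide_eq) (auto simp: power2_eq_square algebra_simps add_pos_pos)
  then have "(a\<^sup>2 * (4 * l)) * 16 \<le> (a\<^sup>2 * (4 * l)) * (4 * (2 * l + 1)\<^sup>2 / (l * (l + 1)))"
    using l by (intro mult_left_mono) auto
  also have "\<dots> = (real (2 * Suc L choose Suc L))\<^sup>2 * (4 * real (Suc L))"
  proof -
    have "real (Suc L) = l + 1" by (simp add: l_def)
    moreover have "(l + 1) * (l + 1) \<noteq> 0" "l \<noteq> 0" "l + 1 \<noteq> 0" using l by auto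
    ultimately show ?thesis
      unfolding b by (simp add: power2_eq_square divide_simps) (simp add: algebra_simps)
  qed
  finally show ?case .
qed

text \<open>Serves the finitely many low degrees, for which no decay of energy is available: their
  weight alone has to supply \<open>L powr (-3 / 2)\<close>. One factor \<open>2 * L + 1\<close>
  comes from \<open>ballot_closed\<close>, its root from the central binomial coefficient.\<close>

lemma ballot_upper:
  "real (ballot (2 * L) n) / 4 ^ L \<le> 2 * (real n + 1) / ((2 * real L + 1) * sqrt (2 * real L + 1))"
proof (cases "even n \<and> n \<le> 2 * L")
  case False
  then have "ballot (2 * L) n = 0"
    using ballot_odd[of "2 * L" n] ballot_above[of "2 * L" n] by auto
  then show ?thesis by simp
next
  case True
  then obtain k where k: "n + 2 * k = 2 * L"
    by (metis dvd_diff_nat dvd_triv_left evenE le_add_diff_inverse)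
  have "Suc (2 * L) choose k \<le> 2 * (2 * L choose L)"
    using binomial_maximum'[of L k] binomial_maximum'[of L "k - 1"] by (cases k) auto
  then have "real (Suc (2 * L) choose k) \<le> 2 * real (2 * L choose L)"
    by linarith
  moreover have "real (2 * L choose L) * sqrt (2 * real L + 1) \<le> 4 ^ L"
  proof (rule power2_le_imp_le)
    have "((4::real) ^ L)\<^sup>2 = 16 ^ L"
      by (simp add: power2_eq_square flip: power_mult_distrib)
    then show "(real (2 * L choose L) * sqrt (2 * real L + 1))\<^sup>2 \<le> (4 ^ L)\<^sup>2"
      using central_binomial_upper[of L] by (simp add: power_mult_distrib)
  qed simp
  moreover have "real (Suc (2 * L) choose k) * sqrt (2 * real L + 1) \<le>
      2 * real (2 * L choose L) * sqrt (2 * real L + 1)"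
    using calculation(1) by (intro mult_right_mono) auto
  ultimately have "real (Suc (2 * L) choose k) * sqrt (2 * real L + 1) \<le> 2 * 4 ^ L"
    by linarith
  then have "(real n + 1) * (real (Suc (2 * L) choose k) * sqrt (2 * real L + 1)) \<le> (real n + 1) * (2 * 4 ^ L)"
    by (intro mult_left_mono) auto
  then have "real (ballot (2 * L) n) * ((2 * real L + 1) * sqrt (2 * real L + 1)) \<le> 2 * (real n + 1) * 4 ^ L"
  proof -
    have "real (ballot (2 * L) n) * ((2 * real L + 1) * sqrt (2 * real L + 1)) =
        (real (2 * L + 1) * real (ballot (2 * L) n)) * sqrt (2 * real L + 1)"
      by simp
    with \<open>(real n + 1) * (_ * _) \<le> _\<close> show ?thesis
      unfolding ballot_closed[OF k] by (simp only: mult_ac)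
  qed
  then show ?thesis by (simp add: field_simps add_pos_nonneg)
qed

text \<open>Passing from \<open>j\<close> to \<open>j + 1\<close> multiplies by
  \<open>(L - j) / (L + j + 2)\<close>, a relative loss of at most \<open>2 * (j + 1) / L\<close>;
  the losses add up to \<open>j * (j + 1) / L\<close>.\<close>

lemma binomial_near_center:
  assumes "L \<ge> 1"
  shows "j \<le> L \<Longrightarrow> real (Suc (2 * L) choose (L - j)) \<ge>
    (1 - real j * (real j + 1) / real L) * real (Suc (2 * L) choose L)"
proof (induction j)
  case (Suc j)
  define f where "f = (\<lambda>i. real (Suc (2 * L) choose (L - i)))"
  define x where "x = real j"
  define l where "l = real L"
  have x: "0 \<le> x" "x + 1 \<le> l" using Suc.prems by (auto simp: x_def l_def)
  obtain i where i: "L - j = Suc i" using Suc.prems by (cases "L - j") auto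
  have "Suc i * (Suc (2 * L) choose Suc i) = (Suc (2 * L) - i) * (Suc (2 * L) choose i)"
    by (simp only: binomial_absorption binomial_absorb_comp)
  moreover have "L - Suc j = i" "Suc (2 * L) - i = L + j + 2" using i by auto
  ultimately have "real (Suc i) * f j = real (L + j + 2) * f (Suc j)"
    unfolding f_def using i by (metis of_nat_mult)
  moreover have "real (Suc i) = l - x" using i Suc.prems by (simp add: l_def x_def flip: i)
  ultimately have "(l - x) * f j = (l + x + 2) * f (Suc j)"
    by (simp add: l_def x_def)
  then have fS: "f (Suc j) = f j * ((l - x) / (l + x + 2))"
    using x by (simp add: field_simps)
  have f0: "f j \<le> f 0"
  proof -
    have "Suc (2 * L) choose (L - j) \<le> Suc (2 * L) choose L"
      using binomial_maximum[of "Suc (2 * L)" "L - j"] by simp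
    then show ?thesis by (simp add: f_def)
  qed
  have "1 - 2 * (x + 1) / l \<le> (l - x) / (l + x + 2)"
  proof -
    have "(l - x) / (l + x + 2) = 1 - 2 * (x + 1) / (l + x + 2)"
      using x by (simp add: field_simps)
    moreover have "2 * (x + 1) / (l + x + 2) \<le> 2 * (x + 1) / l"
      using x by (intro divide_left_mono) auto
    ultimately show ?thesis by linarith
  qed
  then have "f j * (1 - 2 * (x + 1) / l) \<le> f (Suc j)"
    unfolding fS by (intro mult_left_mono) (auto simp: f_def)
  moreover have "f j * (2 * (x + 1) / l) \<le> f 0 * (2 * (x + 1) / l)"
    using f0 x by (intro mult_right_mono) auto
  moreover have "(1 - x * (x + 1) / l) * f 0 \<le> f j"
    using Suc by (simp add: f_def x_def l_def)
  moreover have "(1 - (x + 1) * (x + 2) / l) * f 0 = (1 - x * (x + 1) / l) * f 0 - f 0 * (2 * (x + 1) / l)"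
    using x by (simp add: field_simps)
  ultimately have "(1 - (x + 1) * (x + 2) / l) * f 0 \<le> f (Suc j)"
    by (simp add: algebra_simps)
  moreover have "real (Suc j) * (real (Suc j) + 1) = (x + 1) * (x + 2)"
    by (simp add: x_def algebra_simps)
  ultimately show ?case by (simp only: f_def l_def diff_zero)
qed simp

text \<open>A free walk of \<open>2 * n\<^sup>2\<close> steps has standard deviation
  \<open>sqrt 2 * n\<close>, so the endpoint \<open>n\<close> lies in the bulk and keeps a share of
  order \<open>1 / n\<^sup>2\<close>. This allows a single energy to be read off from a power
  sum.\<close>

lemma ballot_lower:
  assumes "even n" "n \<ge> 2"
  shows "4 ^ n\<^sup>2 / (12 * (real n)\<^sup>2) \<le> real (ballot (2 * n\<^sup>2) n)"
proof -
  define L where "L = n\<^sup>2"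
  define j where "j = n div 2"
  have j: "n = 2 * j" using assms by (simp add: j_def)
  have L: "L = 4 * j\<^sup>2" "j \<ge> 1" "L \<ge> 1" "j \<le> L"
    using assms by (auto simp: L_def j power2_eq_square)
  have k: "n + 2 * (L - j) = 2 * L" using j L by simp
  have r: "real (2 * L choose L) \<ge> 4 ^ L / (2 * real n)"
  proof (rule power2_le_imp_le)
    have "((4::real) ^ L)\<^sup>2 = 16 ^ L"
      by (simp add: power2_eq_square flip: power_mult_distrib)
    then show "(4 ^ L / (2 * real n))\<^sup>2 \<le> (real (2 * L choose L))\<^sup>2"
      using central_binomial_lower[OF L(3)] assms
      by (simp add: power_divide divide_le_eq L_def power_mult_distrib mult_ac)
  qed simp
  \<comment> \<open>\<open>L = 4 * j\<^sup>2\<close> turns the left side into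
    \<open>(j + 1) / (4 * j)\<close>.\<close>
  have "real j * (real j + 1) / real L \<le> 1 / 2"
    using L by (simp add: divide_le_eq power2_eq_square algebra_simps)
  then have "1 / 2 * real (Suc (2 * L) choose L) \<le> (1 - real j * (real j + 1) / real L) * real (Suc (2 * L) choose L)"
    by (intro mult_right_mono) auto
  also have "\<dots> \<le> real (Suc (2 * L) choose (L - j))"
    by (rule binomial_near_center[OF L(3,4)])
  finally have "1 / 2 * real (Suc (2 * L) choose L) \<le> real (Suc (2 * L) choose (L - j))" .
  moreover have "real (2 * L choose L) \<le> real (Suc (2 * L) choose L)"
    using binomial_right_mono[of "2 * L" "Suc (2 * L)" L] by simp
  ultimately have "4 ^ L / (4 * real n) \<le> real (Suc (2 * L) choose (L - j))"
    using r by (simp add: field_simps)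
  then have "(real n + 1) * (4 ^ L / (4 * real n)) \<le> real (2 * L + 1) * real (ballot (2 * L) n)"
    unfolding ballot_closed[OF k] by (intro mult_left_mono) auto
  moreover have "real n * (4 ^ L / (4 * real n)) \<le> (real n + 1) * (4 ^ L / (4 * real n))"
    by (intro mult_right_mono) auto
  moreover have "real (2 * L + 1) * real (ballot (2 * L) n) \<le> 3 * (real n)\<^sup>2 * real (ballot (2 * L) n)"
  proof (intro mult_right_mono)
    have "L \<ge> 1" by (rule L)
    then have "2 * L + 1 \<le> 3 * n\<^sup>2" unfolding L_def by linarith
    then have "real (2 * L + 1) \<le> real (3 * n\<^sup>2)" by (rule of_nat_mono)
    then show "real (2 * L + 1) \<le> 3 * (real n)\<^sup>2" by simp
  qed simp
  moreover have "real n * (4 ^ L / (4 * real n)) = 4 ^ L / 4" using assms by simp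
  ultimately have "4 ^ L / 4 \<le> 3 * (real n)\<^sup>2 * real (ballot (2 * L) n)"
    by linarith
  then show ?thesis
    using assms by (simp add: L_def divide_le_eq mult_ac)
qed

lemma cheb_one: "cheb n 1 = real n + 1"
  by (induction n rule: induct_nat_012) auto

lemma sum_ballot: "(\<Sum>n\<le>N. real (ballot N n) * (real n + 1)) = 2 ^ N"
  using two_x_power_cheb[of 1 N] by (simp add: cheb_one)

section \<open>The divisor function grows more slowly than every power\<close>

section \<open>The divisor bound\<close>

lemma divisor_count_prime_power:
  assumes "prime (p::nat)" "m > 0"
  shows "card {d. d dvd p ^ e * m} \<le> (e + 1) * card {d. d dvd m}"
proof -
  have "{d. d dvd p ^ e * m} \<subseteq> (\<lambda>(i, d). p ^ i * d) ` ({..e} \<times> {d. d dvd m})"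
  proof
    fix x assume "x \<in> {d. d dvd p ^ e * m}"
    then obtain a b where "x = a * b" "a dvd p ^ e" "b dvd m"
      using division_decomp by blast
    then show "x \<in> (\<lambda>(i, d). p ^ i * d) ` ({..e} \<times> {d. d dvd m})"
      using divides_primepow_nat[OF assms(1)] by force
  qed
  moreover have "finite ({..e} \<times> {d. d dvd m})"
    using assms by simp
  ultimately have "card {d. d dvd p ^ e * m} \<le> card ({..e} \<times> {d. d dvd m})"
    by (metis (no_types, lifting) surj_card_le)
  then show ?thesis by (simp add: card_cartesian_product)
qed

text \<open>A prime power \<open>p ^ e\<close> contributes \<open>e + 1\<close>. For
  \<open>p \<ge> 2 powr (1 / \<epsilon>)\<close> this is at most
  \<open>p powr (e * \<epsilon>)\<close>; each of the finitely many smaller primes costs at most one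
  factor \<open>K\<close>.\<close>

lemma divisor_bound:
  assumes "\<epsilon> > 0"
  obtains C where "C > 0" "\<And>n. n > 0 \<Longrightarrow> real (card {d. d dvd n}) \<le> C * real n powr \<epsilon>"
proof -
  define K where "K = max 1 (1 / (\<epsilon> * ln 2))"
  have K: "real e + 1 \<le> K * 2 powr (real e * \<epsilon>)" for e
  proof -
    have "real e = 1 / (\<epsilon> * ln 2) * (real e * \<epsilon> * ln 2)" using assms by simp
    also have "\<dots> \<le> K * (real e * \<epsilon> * ln 2)"
      using assms by (intro mult_right_mono) (auto simp: K_def)
    finally have "real e + 1 \<le> K * (1 + real e * \<epsilon> * ln 2)"
      by (simp add: distrib_left K_def)
    also have "\<dots> \<le> K * exp (real e * \<epsilon> * ln 2)"
      by (intro mult_left_mono exp_ge_add_one_self) (auto simp: K_def)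
    finally show ?thesis by (simp add: powr_def)
  qed
  have K1: "K \<ge> 1" by (simp add: K_def)
  define P where "P = nat \<lceil>2 powr (1 / \<epsilon>)\<rceil>"
  have big: "real e + 1 \<le> real p powr (real e * \<epsilon>)" if "p \<ge> P" for p e :: nat
  proof -
    have "2 powr (1 / \<epsilon>) \<le> real p"
      using that unfolding P_def by linarith
    then have "(2 powr (1 / \<epsilon>)) powr (real e * \<epsilon>) \<le> real p powr (real e * \<epsilon>)"
      using assms by (intro powr_mono2) auto
    also have "(2 powr (1 / \<epsilon>)) powr (real e * \<epsilon>) = 2 ^ e"
      using assms by (simp add: powr_powr powr_realpow)
    also have "real e + 1 \<le> 2 ^ e"
      by (induction e) auto
    finally show ?thesis by simp
  qed
  define s where "s = (\<lambda>n. card {p. prime p \<and> p < P \<and> p dvd n})"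
  have main: "n > 0 \<Longrightarrow> real (card {d. d dvd n}) \<le> K ^ s n * real n powr \<epsilon>" for n
  proof (induction n rule: less_induct)
    case (less n)
    show ?case
    proof (cases "n = 1")
      case True
      then have "{d. d dvd n} = {1}" by auto
      with True K1 show ?thesis by simp
    next
      case False
      with less.prems obtain p where p: "prime p" "p dvd n"
        using prime_factor_nat by blast
      obtain m where m: "n = p ^ multiplicity p n * m" "\<not> p dvd m"
      proof (rule multiplicity_decompose'[of n p])
        show "n \<noteq> 0" "\<not> is_unit p" using p less.prems by auto
      qed
      define e where "e = multiplicity p n"
      have n: "n = p ^ e * m" using m e_def by simp
      have e: "e \<ge> 1" using m(2) p(2) n by (cases e) auto
      have m0: "m > 0" using m(2) by (auto intro!: Nat.gr0I)
      have p2: "p \<ge> 2" using p prime_ge_2_nat by blast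
      have "p ^ e > 1" using p2 e by (intro one_less_power) auto
      then have "m < n" using m0 unfolding n by auto
      then have IH: "real (card {d. d dvd m}) \<le> K ^ s m * real m powr \<epsilon>"
        using less.IH m0 by blast
      have "{q. prime q \<and> q < P \<and> q dvd n} = {q. prime q \<and> q < P \<and> q dvd m} \<union> (if p < P then {p} else {})"
      proof -
        have pq: "q = p" if "prime q" "q dvd p ^ e" for q
          using that p by (meson prime_dvd_power primes_dvd_imp_eq)
        then show ?thesis
          unfolding n using p e by (auto simp: prime_dvd_mult_iff dest: pq)
      qed
      then have s: "s n = s m + (if p < P then 1 else 0)"
        unfolding s_def using m(2) by (simp add: card_insert_if)
      have "real e + 1 \<le> (if p < P then K else 1) * real p powr (real e * \<epsilon>)"
      proof (cases "p < P")
        case True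
        have "K * 2 powr (real e * \<epsilon>) \<le> K * real p powr (real e * \<epsilon>)"
          using K1 p2 assms by (intro mult_left_mono powr_mono2) auto
        with K[of e] True show ?thesis by simp
      qed (use big in auto)
      then have "(real e + 1) * real (card {d. d dvd m}) \<le>
         ((if p < P then K else 1) * real p powr (real e * \<epsilon>)) * (K ^ s m * real m powr \<epsilon>)"
        using IH K1 by (intro mult_mono) auto
      also have "\<dots> = K ^ s n * (real p powr (real e * \<epsilon>) * real m powr \<epsilon>)"
        unfolding s by simp
      also have "real p powr (real e * \<epsilon>) * real m powr \<epsilon> = real n powr \<epsilon>"
        unfolding n using p2 by (simp add: powr_mult powr_powr[symmetric] powr_realpow)
      finally show ?thesis
        using divisor_count_prime_power[OF p(1) m0, of e] unfolding n[symmetric]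
        by (smt (verit) of_nat_1 of_nat_add of_nat_le_iff of_nat_mult)
    qed
  qed
  show ?thesis
  proof
    show "K ^ P > 0" using K1 by simp
    fix n :: nat assume n: "n > 0"
    have "s n \<le> card {..<P}"
      unfolding s_def by (intro card_mono) auto
    then have "K ^ s n \<le> K ^ P"
      using K1 by (intro power_increasing) auto
    then show "real (card {d. d dvd n}) \<le> K ^ P * real n powr \<epsilon>"
      using main[OF n] by (meson mult_right_mono order_trans powr_ge_zero)
  qed
qed

section \<open>Sums of two squares\<close>

section \<open>Lattice points on circles\<close>

definition circle_points :: "nat \<Rightarrow> (int \<times> int) set" where
  "circle_points K = {(c, d). c\<^sup>2 + d\<^sup>2 = int K}"

lemma finite_circle_points: "finite (circle_points K)"
proof -
  have sq: "\<bar>c\<bar> \<le> c\<^sup>2" for c :: int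
  proof (cases "c = 0")
    case False
    then have "\<bar>c\<bar> * 1 \<le> \<bar>c\<bar> * \<bar>c\<bar>" by (intro mult_left_mono) auto
    then show ?thesis by (simp add: power2_eq_square)
  qed simp
  have "circle_points K \<subseteq> {- int K..int K} \<times> {- int K..int K}"
  proof
    fix x assume "x \<in> circle_points K"
    then obtain c d where "x = (c, d)" "c\<^sup>2 + d\<^sup>2 = int K"
      by (auto simp: circle_points_def)
    with sq[of c] sq[of d] show "x \<in> {- int K..int K} \<times> {- int K..int K}"
      by (smt (verit) SigmaI atLeastAtMost_iff zero_le_power2)
  qed
  then show ?thesis by (rule finite_subset) auto
qed

lemma coprime_sum_squares:
  fixes a b :: int
  assumes "coprime a b"
  shows "coprime a (a\<^sup>2 + b\<^sup>2)"
proof (rule coprimeI)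
  fix d assume d: "d dvd a" "d dvd a\<^sup>2 + b\<^sup>2"
  then have "d dvd a\<^sup>2 + b\<^sup>2 - a * a" by (intro dvd_diff) auto
  then have "d dvd b\<^sup>2" by (simp add: power2_eq_square)
  moreover have "coprime a (b\<^sup>2)" using assms by simp
  ultimately show "is_unit d" using d(1) coprime_common_divisor by blast
qed

text \<open>\<open>K\<close> divides \<open>(c0 d - c d0) (c0 d + c d0) = (d\<^sup>2 - d0\<^sup>2) K\<close>. How \<open>K\<close> splits between the two factors,
  that is the gcd with the first one, determines \<open>d / c\<close> modulo \<open>K\<close> up to a factor 2.\<close>

lemma primitive_circle_points_cross:
  fixes c d c' d' c0 d0 :: int and K :: nat
  assumes K: "K > 0"
    and 0: "c0\<^sup>2 + d0\<^sup>2 = int K" "coprime c0 d0"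
    and 1: "c\<^sup>2 + d\<^sup>2 = int K" "coprime c d"
    and 2: "c'\<^sup>2 + d'\<^sup>2 = int K" "coprime c' d'"
    and g: "gcd (c0 * d - c * d0) (int K) = gcd (c0 * d' - c' * d0) (int K)"
  shows "int K dvd 2 * (c' * d - c * d')"
proof -
  define k where "k = int K"
  have cop: "coprime a k" "coprime b k" if "a\<^sup>2 + b\<^sup>2 = k" "coprime a b" for a b :: int
    using coprime_sum_squares[of a b] coprime_sum_squares[of b a] that
    by (simp_all add: coprime_commute add.commute)
  define u where "u = c0 * d - c * d0"
  define v where "v = c0 * d + c * d0"
  define u' where "u' = c0 * d' - c' * d0"
  define v' where "v' = c0 * d' + c' * d0"
  define X where "X = c' * d - c * d'"
  define gg where "gg = gcd u k"
  have gg': "gg = gcd u' k" using g by (simp add: gg_def u_def u'_def k_def)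
  have k0: "k > 0" using K by (simp add: k_def)
  have gd: "gg dvd k" "gg dvd u" "gg dvd u'"
    by (simp_all add: gg_def) (simp add: gg' flip: gg_def)
  define h where "h = k div gg"
  have kgh: "k = gg * h" using gd by (simp add: h_def)
  have gpos: "gg > 0" using k0 by (simp add: gg_def)
  have dv: "h dvd w" if "k dvd t * w" "gg = gcd t k" for t w
  proof -
    have "coprime (t div gg) (k div gg)"
      using that(2) k0 by (simp add: div_gcd_coprime)
    moreover have "gg * (k div gg) dvd gg * (t div gg * w)"
      using that gd by (simp add: mult.assoc[symmetric] dvd_mult_div_cancel)
    then have "k div gg dvd t div gg * w"
      using gpos by (simp add: dvd_times_left_cancel_iff)
    ultimately show ?thesis
      unfolding h_def using coprime_dvd_mult_right_iff[of "k div gg" "t div gg" w]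
      by (simp add: coprime_commute)
  qed
  have "u * v = (d - d0) * (d + d0) * k"
  proof -
    have "u * v = c0\<^sup>2 * d\<^sup>2 - c\<^sup>2 * d0\<^sup>2"
      unfolding u_def v_def by (simp add: power2_eq_square algebra_simps)
    also have "c0\<^sup>2 = k - d0\<^sup>2" using 0(1) by (simp add: k_def)
    also have "c\<^sup>2 = k - d\<^sup>2" using 0(1) 1(1) by (auto simp: k_def)
    finally show ?thesis by (simp add: power2_eq_square algebra_simps)
  qed
  then have hv: "h dvd v" using dv[of u v] gg_def by auto
  have "u' * v' = (d' - d0) * (d' + d0) * k"
  proof -
    have "u' * v' = c0\<^sup>2 * d'\<^sup>2 - c'\<^sup>2 * d0\<^sup>2"
      unfolding u'_def v'_def by (simp add: power2_eq_square algebra_simps)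
    also have "c0\<^sup>2 = k - d0\<^sup>2" using 0(1) by (simp add: k_def)
    also have "c'\<^sup>2 = k - d'\<^sup>2" using 0(1) 2(1) by (auto simp: k_def)
    finally show ?thesis by (simp add: power2_eq_square algebra_simps)
  qed
  then have hv': "h dvd v'" using dv[of u' v'] gg' by auto
  have c0k: "coprime c0 k" and dk: "coprime d k"
    using cop 0 1 unfolding k_def by blast+
  have "c0 * X = c' * u - c * u'" unfolding X_def u_def u'_def by (simp add: algebra_simps)
  then have "gg dvd c0 * X" using gd by simp
  moreover have "coprime gg c0" using c0k gd(1) by (meson coprime_commute coprime_divisors dvd_refl)
  ultimately have gX: "gg dvd X" by (simp add: coprime_dvd_mult_right_iff)
  have "c0 * X = c' * v - c * v'" unfolding X_def v_def v'_def by (simp add: algebra_simps)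
  then have "h dvd c0 * X" using hv hv' by simp
  moreover have "coprime h c0" using c0k kgh by (metis coprime_commute coprime_mult_right_iff)
  ultimately have hX: "h dvd X" by (simp add: coprime_dvd_mult_right_iff)
  \<comment> \<open>A common divisor of \<open>gg\<close> and \<open>h\<close> divides
    \<open>u + v = 2 * c0 * d\<close>, and \<open>c0\<close> and \<open>d\<close> are units modulo
    \<open>k\<close>. The factor 2 of the conclusion arises here.\<close>
  define r where "r = gcd gg h"
  have "r dvd u + v" using gd hv unfolding r_def by (meson dvd_add dvd_trans gcd_dvd1 gcd_dvd2)
  then have "r dvd c0 * (d * 2)" by (simp add: u_def v_def algebra_simps)
  moreover have "r dvd k" using gd r_def by (meson dvd_trans gcd_dvd1)
  then have "coprime r c0" "coprime r d"
    using c0k dk by (meson coprime_commute coprime_divisors dvd_refl)+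
  ultimately have r2: "r dvd 2" by (simp add: coprime_dvd_mult_right_iff)
  have "lcm gg h dvd X" using gX hX by simp
  then have "r * lcm gg h dvd 2 * X" using r2 by (intro mult_dvd_mono)
  moreover have "r * lcm gg h = k"
  proof -
    have "h > 0" using k0 gpos unfolding kgh by (simp add: zero_less_mult_iff)
    then show ?thesis
      unfolding r_def kgh using gcd_mult_lcm[of gg h] gpos by (simp add: abs_mult)
  qed
  ultimately show ?thesis by (simp add: k_def X_def)
qed

text \<open>The gcd in \<open>primitive_circle_points_cross\<close> sorts the points by divisors of
  \<open>K\<close>. Within a class, twice the cross product with a fixed member is one of five
  multiples of \<open>K\<close>, and then the inner product is known up to sign because the two
  squares add up to \<open>K\<^sup>2\<close>: hence the factor 10.\<close>

lemma primitive_circle_points_count: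
  assumes K: "K > 0"
  shows "card {(c, d) \<in> circle_points K. coprime c d} \<le> 10 * card {d. d dvd K}"
proof (cases "{(c, d) \<in> circle_points K. coprime c d} = {}")
  case False
  let ?S = "{(c, d) \<in> circle_points K. coprime c d}"
  from False obtain c0 d0 where 0: "c0\<^sup>2 + d0\<^sup>2 = int K" "coprime c0 d0"
    by (auto simp: circle_points_def)
  define \<phi> where "\<phi> = (\<lambda>(c, d). nat (gcd (c0 * d - c * d0) (int K)))"
  have im: "\<phi> ` ?S \<subseteq> {d. d dvd K}"
    using K by (auto simp: \<phi>_def nat_dvd_iff)
  have fib: "card {x \<in> ?S. \<phi> x = g} \<le> 10" for g
  proof (cases "{x \<in> ?S. \<phi> x = g} = {}")
    case False
    then obtain c d where cd: "c\<^sup>2 + d\<^sup>2 = int K" "coprime c d" "\<phi> (c, d) = g"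
      by (auto simp: circle_points_def)
    define \<psi> where "\<psi> = (\<lambda>(c', d'). (2 * (c' * d - c * d') div int K, c * c' + d * d' \<ge> 0))"
    have X: "int K dvd 2 * (c' * d - c * d')" "\<bar>c' * d - c * d'\<bar> \<le> int K"
      "(c' * d - c * d')\<^sup>2 + (c * c' + d * d')\<^sup>2 = (int K)\<^sup>2"
      if "(c', d') \<in> {x \<in> ?S. \<phi> x = g}" for c' d'
    proof -
      have 2: "c'\<^sup>2 + d'\<^sup>2 = int K" "coprime c' d'" "\<phi> (c', d') = g"
        using that by (auto simp: circle_points_def)
      have "gcd (c0 * d - c * d0) (int K) = gcd (c0 * d' - c' * d0) (int K)"
        using cd(3) 2(3) unfolding \<phi>_def by (auto simp: nat_eq_iff)
      then show "int K dvd 2 * (c' * d - c * d')"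
        by (rule primitive_circle_points_cross[OF K 0 cd(1,2) 2(1,2)])
      have "(c' * d - c * d')\<^sup>2 + (c * c' + d * d')\<^sup>2 = (c\<^sup>2 + d\<^sup>2) * (c'\<^sup>2 + d'\<^sup>2)"
        by (simp add: power2_eq_square algebra_simps)
      then show "(c' * d - c * d')\<^sup>2 + (c * c' + d * d')\<^sup>2 = (int K)\<^sup>2"
        unfolding cd(1) 2(1) by (simp add: power2_eq_square)
      then have "(c' * d - c * d')\<^sup>2 \<le> (int K)\<^sup>2" by (smt (verit) zero_le_power2)
      then show "\<bar>c' * d - c * d'\<bar> \<le> int K" by (simp add: abs_le_square_iff[symmetric])
    qed
    have "inj_on \<psi> {x \<in> ?S. \<phi> x = g}"
    proof (rule inj_onI)
      fix x y assume x: "x \<in> {x \<in> ?S. \<phi> x = g}" and y: "y \<in> {x \<in> ?S. \<phi> x = g}"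
        and xy: "\<psi> x = \<psi> y"
      obtain c1 d1 c2 d2 where xy': "x = (c1, d1)" "y = (c2, d2)" by (metis surj_pair)
      note m1 = x[unfolded xy'] and m2 = y[unfolded xy'] and e = xy[unfolded xy']
      define X1 where "X1 = c1 * d - c * d1"
      define X2 where "X2 = c2 * d - c * d2"
      define Y1 where "Y1 = c * c1 + d * d1"
      define Y2 where "Y2 = c * c2 + d * d2"
      have "2 * X1 div int K = 2 * X2 div int K" and sg: "(Y1 \<ge> 0) = (Y2 \<ge> 0)"
        using e by (auto simp: \<psi>_def X1_def X2_def Y1_def Y2_def)
      then have XX: "X1 = X2"
        using X(1)[OF m1] X(1)[OF m2] unfolding X1_def[symmetric] X2_def[symmetric]
        by (metis dvd_div_mult_self mult_cancel_left zero_neq_numeral)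
      have "Y1\<^sup>2 = Y2\<^sup>2"
        using X(3)[OF m1] X(3)[OF m2] XX unfolding X1_def X2_def Y1_def Y2_def by simp
      then have YY: "Y1 = Y2" using sg by (auto simp: power2_eq_iff)
      have "int K * c1 = c * Y1 + d * X1" "int K * c2 = c * Y2 + d * X2"
        "int K * d1 = d * Y1 - c * X1" "int K * d2 = d * Y2 - c * X2"
        unfolding X1_def X2_def Y1_def Y2_def cd(1)[symmetric] by (simp_all add: power2_eq_square algebra_simps)
      then have "int K * c1 = int K * c2" "int K * d1 = int K * d2"
        using XX YY by simp_all
      then show "x = y" using K by (simp add: xy')
    qed
    moreover have "\<psi> ` {x \<in> ?S. \<phi> x = g} \<subseteq> {-2..2} \<times> UNIV"
    proof (rule image_subsetI)
      fix x assume x: "x \<in> {x \<in> ?S. \<phi> x = g}"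
      obtain c' d' where xy': "x = (c', d')" by (metis surj_pair)
      note m = x[unfolded xy']
      define a where "a = fst (\<psi> x)"
      from X(1)[OF m] obtain t where t: "2 * (c' * d - c * d') = int K * t" by auto
      have "a = t" using t K by (simp add: a_def xy' \<psi>_def)
      have "int K * \<bar>t\<bar> \<le> int K * 2"
      proof -
        have "int K * \<bar>t\<bar> = 2 * \<bar>c' * d - c * d'\<bar>"
          using arg_cong[OF t, of abs] by (simp only: abs_mult abs_numeral abs_of_nat)
        then show ?thesis using X(2)[OF m] by simp
      qed
      then have "\<bar>t\<bar> \<le> 2" using K by simp
      then show "\<psi> x \<in> {-2..2} \<times> UNIV"
        using \<open>a = t\<close> unfolding a_def by (auto simp add: mem_Times_iff abs_le_iff)
    qed
    ultimately have "card {x \<in> ?S. \<phi> x = g} \<le> card ({-2..2::int} \<times> (UNIV::bool set))"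
      by (intro card_inj_on_le) auto
    then show ?thesis by (simp add: card_cartesian_product)
  next
    case True
    then show ?thesis by (simp only: card.empty)
  qed
  have "card ?S = card (\<Union>g\<in>{d. d dvd K}. {x \<in> ?S. \<phi> x = g})"
    using im by (intro arg_cong[where f = card]) blast
  also have "\<dots> \<le> (\<Sum>g\<in>{d. d dvd K}. card {x \<in> ?S. \<phi> x = g})"
    using K by (intro card_UN_le) auto
  also have "\<dots> \<le> (\<Sum>g\<in>{d. d dvd K}. 10)"
    by (intro sum_mono fib)
  finally show ?thesis by simp
qed (simp only: card.empty)

text \<open>Dividing a point by the gcd \<open>e\<close> of its coordinates gives a primitive point
  for \<open>K div e\<^sup>2\<close>. Both the number of possible \<open>e\<close> and each
  primitive count are controlled by the divisors of \<open>K\<close>.\<close>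

lemma circle_points_count:
  assumes K: "K > 0"
  shows "card (circle_points K) \<le> 10 * (card {d. d dvd K})\<^sup>2"
proof -
  let ?S = "\<lambda>K. {(c, d) \<in> circle_points K. coprime c d}"
  let ?I = "{e. e dvd K \<and> e\<^sup>2 dvd K}"
  have "circle_points K \<subseteq> (\<Union>e\<in>?I. (\<lambda>(c, d). (int e * c, int e * d)) ` ?S (K div e\<^sup>2))"
  proof clarify
    fix c d assume "(c, d) \<in> circle_points K"
    then have cd: "c\<^sup>2 + d\<^sup>2 = int K" by (simp add: circle_points_def)
    define e where "e = gcd c d"
    have "e \<noteq> 0" using cd K unfolding e_def by auto
    define a b where "a = c div e" and "b = d div e"
    have ab: "c = e * a" "d = e * b" by (auto simp: a_def b_def e_def)
    have cop: "coprime a b" unfolding a_def b_def e_def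
      using \<open>e \<noteq> 0\<close> by (intro div_gcd_coprime) (auto simp: e_def)
    have e0: "e > 0" using \<open>e \<noteq> 0\<close> unfolding e_def by (simp add: gcd_pos_int)
    have K': "int K = e\<^sup>2 * (a\<^sup>2 + b\<^sup>2)" unfolding cd[symmetric] ab by (simp add: power_mult_distrib algebra_simps)
    define n where "n = nat e"
    have n: "e = int n" using e0 by (simp add: n_def)
    define m where "m = nat (a\<^sup>2 + b\<^sup>2)"
    have m: "a\<^sup>2 + b\<^sup>2 = int m" by (simp add: m_def)
    have Km: "K = n\<^sup>2 * m" using K' unfolding n m by (metis of_nat_eq_iff of_nat_mult of_nat_power)
    have "K div n\<^sup>2 = m" unfolding Km using e0 n by simp
    then have "(a, b) \<in> ?S (K div n\<^sup>2)" using cop m by (simp add: circle_points_def)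
    moreover have "n dvd K" "n\<^sup>2 dvd K" unfolding Km by (simp_all add: power2_eq_square dvd_mult2)
    ultimately show "(c, d) \<in> (\<Union>e\<in>?I. (\<lambda>(c, d). (int e * c, int e * d)) ` ?S (K div e\<^sup>2))"
      using ab n by force
  qed
  then have "card (circle_points K) \<le> card (\<Union>e\<in>?I. (\<lambda>(c, d). (int e * c, int e * d)) ` ?S (K div e\<^sup>2))"
    using K by (intro card_mono finite_UN_I finite_imageI finite_subset[OF _ finite_circle_points]) auto
  also have "\<dots> \<le> (\<Sum>e\<in>?I. card ((\<lambda>(c, d). (int e * c, int e * d)) ` ?S (K div e\<^sup>2)))"
    using K by (intro card_UN_le) auto
  also have "\<dots> \<le> (\<Sum>e\<in>?I. 10 * card {d. d dvd K})"
  proof (intro sum_mono)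
    fix e assume e: "e \<in> ?I"
    have "card ((\<lambda>(c, d). (int e * c, int e * d)) ` ?S (K div e\<^sup>2)) \<le> card (?S (K div e\<^sup>2))"
      by (intro card_image_le finite_subset[OF _ finite_circle_points]) auto
    also have "\<dots> \<le> 10 * card {d. d dvd K}"
    proof -
      from e obtain m where m: "K = e\<^sup>2 * m" by auto
      with K have "e > 0" "m > 0" by (auto intro!: Nat.gr0I)
      with m have d: "K div e\<^sup>2 = m" "m dvd K" by auto
      have "card (?S m) \<le> 10 * card {d. d dvd m}"
        by (rule primitive_circle_points_count[OF \<open>m > 0\<close>])
      also have "card {d. d dvd m} \<le> card {d. d dvd K}"
        using K d by (intro card_mono) (auto intro: dvd_trans)
      finally show ?thesis using d by simp
    qed
    finally show "card ((\<lambda>(c, d). (int e * c, int e * d)) ` ?S (K div e\<^sup>2)) \<le> 10 * card {d. d dvd K}" .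
  qed
  also have "\<dots> \<le> (\<Sum>e | e dvd K. 10 * card {d. d dvd K})"
    using K by (intro sum_mono2) auto
  also have "\<dots> = 10 * (card {d. d dvd K})\<^sup>2"
    by (simp add: power2_eq_square)
  finally show ?thesis .
qed

lemma circle_points_bound:
  assumes "\<epsilon> > 0"
  obtains C where "C > 0" "\<And>K. K > 0 \<Longrightarrow> real (card (circle_points K)) \<le> C * real K powr \<epsilon>"
proof -
  obtain C where C: "C > 0" "\<And>n. n > 0 \<Longrightarrow> real (card {d. d dvd n}) \<le> C * real n powr (\<epsilon> / 2)"
    using divisor_bound[of "\<epsilon> / 2"] assms by auto
  show ?thesis
  proof
    show "10 * C\<^sup>2 > 0" using C by simp
    fix K :: nat assume K: "K > 0"
    have "real (card (circle_points K)) \<le> real (10 * (card {d. d dvd K})\<^sup>2)"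
      by (rule of_nat_mono[OF circle_points_count[OF K]])
    also have "\<dots> \<le> 10 * (C * real K powr (\<epsilon> / 2))\<^sup>2"
      using C(2)[OF K] by (simp add: power_mono)
    also have "\<dots> = 10 * C\<^sup>2 * real K powr \<epsilon>"
      by (simp add: power_mult_distrib power2_eq_square powr_add[symmetric])
    finally show "real (card (circle_points K)) \<le> 10 * C\<^sup>2 * real K powr \<epsilon>" .
  qed
qed

section \<open>Free semigroups of integral quaternions and near pairs of words\<close>

section \<open>Words in integral quaternions of norm p\<close>

definition qdvd :: "int \<Rightarrow> int quat \<Rightarrow> bool" where
  "qdvd p x \<longleftrightarrow> p dvd q0 x \<and> p dvd q1 x \<and> p dvd q2 x \<and> p dvd q3 x"

lemma qdvd_mult_left: "qdvd p x \<Longrightarrow> qdvd p (y * x)"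
  by (auto simp: qdvd_def times_quat_def intro!: dvd_add dvd_diff)

lemma qdvd_qscale: "qdvd p (qscale p x)"
  by (simp add: qdvd_def qscale_def)

lemma qdvd_add: "qdvd p x \<Longrightarrow> qdvd p y \<Longrightarrow> qdvd p (x + y)"
  by (simp add: qdvd_def plus_quat_def)

lemma qdvd_qscale_cancel:
  assumes "prime p" "\<not> p dvd c" "qdvd p (qscale c x)"
  shows "qdvd p x"
  using assms by (auto simp: qdvd_def qscale_def prime_dvd_mult_iff)

lemma qscale_mult_right: "x * qscale c y = qscale c (x * y)"
  by (simp add: quat_simps algebra_simps)

lemma qscale_mult_left: "qscale c x * y = qscale c (x * y)"
  by (simp add: quat_simps algebra_simps)

definition words :: "'a set \<Rightarrow> nat \<Rightarrow> 'a list set" where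
  "words A m = {ws. set ws \<subseteq> A \<and> length ws = m}"

lemma words_0 [simp]: "words A 0 = {[]}"
  by (auto simp: words_def)

lemma words_Suc: "words A (Suc m) = (\<lambda>(a, ws). a # ws) ` (A \<times> words A m)"
  by (auto simp: words_def length_Suc_conv image_iff)

lemma finite_words: "finite A \<Longrightarrow> finite (words A m)"
  by (induction m) (auto simp: words_Suc)

lemma card_words: "finite A \<Longrightarrow> card (words A m) = card A ^ m"
  by (induction m) (auto simp: words_Suc card_image inj_on_def card_cartesian_product finite_words)

text \<open>Takes the place of unique factorization: \<open>qdot_A\<close> makes the scalar in
  \<open>qmult_swap\<close> invertible modulo \<open>p\<close>. By \<open>disjoint_A\<close> no
  letter of a word over \<open>A\<close> stands next to its conjugate, so such words are
  automatically reduced.\<close>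

locale prime_quats =
  fixes p :: int and A :: "int quat set"
  assumes prime_p: "prime p"
    and finite_A: "finite A"
    and qnorm_A: "s \<in> A \<Longrightarrow> qnorm s = p"
    and qdot_A: "\<lbrakk>s \<in> A \<union> qcnj ` A; t \<in> A \<union> qcnj ` A; s \<noteq> t\<rbrakk> \<Longrightarrow> \<not> p dvd 2 * qdot s t"
    and disjoint_A: "A \<inter> qcnj ` A = {}"
begin

abbreviation B :: "int quat set" where "B \<equiv> A \<union> qcnj ` A"

lemma qnorm_B: "s \<in> B \<Longrightarrow> qnorm s = p"
  using qnorm_A by auto

lemma qcnj_B: "s \<in> B \<Longrightarrow> qcnj s \<in> B"
  by auto

lemma p_gt_1: "p > 1"
  using prime_p prime_gt_1_int by blast

text \<open>Modulo \<open>p\<close> we have \<open>t * qcnj u * t = 2 (qdot t u) t\<close>, so left multiplication by \<open>qcnj u\<close> does not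
  create divisibility by \<open>p\<close> after a letter \<open>t \<noteq> u\<close>.\<close>

lemma qdvd_swap:
  assumes "u \<in> B" "t \<in> B" "t \<noteq> u" "qdvd p (qcnj u * (t * x))"
  shows "qdvd p (t * x)"
proof -
  have "t * qcnj u * t * x = (qscale (2 * qdot t u) t - qscale p u) * x"
    using qmult_swap[of t u] qnorm_B[OF assms(2)] by simp
  then have "t * (qcnj u * (t * x)) = qscale (2 * qdot t u) (t * x) - qscale p (u * x)"
    by (simp add: mult.assoc left_diff_distrib qscale_mult_left)
  then have "qscale (2 * qdot t u) (t * x) = t * (qcnj u * (t * x)) + qscale p (u * x)"
    by simp
  then have "qdvd p (qscale (2 * qdot t u) (t * x))"
    using qdvd_mult_left[OF assms(4)] qdvd_qscale qdvd_add by metis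
  then show ?thesis
    using qdvd_qscale_cancel[OF prime_p] qdot_A[OF assms(2,1,3)] by blast
qed

text \<open>A second factorization starting with \<open>t\<close> would make
  \<open>qcnj t * (s * x)\<close> divisible by \<open>p\<close>, and \<open>qdvd_swap\<close> strips
  off \<open>qcnj t\<close>.\<close>

lemma first_letter_unique:
  assumes "s \<in> B" "t \<in> B" "s * x = t * y" "\<not> qdvd p (s * x)"
  shows "s = t"
proof (rule ccontr)
  assume "s \<noteq> t"
  have "qcnj t * (s * x) = qscale p y"
    unfolding assms(3) mult.assoc[symmetric] qcnj_mult_self qnorm_B[OF assms(2)]
    by (simp add: qscale_mult_left)
  then have "qdvd p (qcnj t * (s * x))" by (simp add: qdvd_qscale)
  from qdvd_swap[OF assms(2,1) \<open>s \<noteq> t\<close> this] assms(4) show False by blast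
qed

lemma letter_cancel:
  assumes "s \<in> B" "s * x = s * y"
  shows "x = y"
proof -
  have "qcnj s * s * x = qcnj s * s * y" by (simp add: mult.assoc assms(2))
  then have "qscale p x = qscale p y"
    by (simp add: qcnj_mult_self qnorm_B[OF assms(1)] qscale_mult_left)
  then show ?thesis using p_gt_1
    by (cases x; cases y) (simp add: qscale_def)
qed

definition reduced :: "int quat list \<Rightarrow> bool" where
  "reduced ws \<longleftrightarrow> set ws \<subseteq> B \<and> successively (\<lambda>s t. t \<noteq> qcnj s) ws"

text \<open>For adjacent letters \<open>s\<close>, \<open>t\<close>, \<open>qdvd_swap\<close> with
  \<open>u = qcnj s\<close> passes divisibility by \<open>p\<close> on to the shorter word. A single
  letter divisible by \<open>p\<close> would have norm divisible by \<open>p * p\<close>.\<close>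

lemma reduced_not_qdvd: "reduced ws \<Longrightarrow> \<not> qdvd p (prod_list ws)"
proof (induction ws rule: induct_list012)
  case 1
  then show ?case using p_gt_1 by (simp add: qdvd_def one_quat_def)
next
  case (2 s)
  then have n: "qnorm s = p" by (auto simp: reduced_def intro: qnorm_B)
  show ?case
  proof
    assume "qdvd p (prod_list [s])"
    then have "p * p dvd qnorm s"
      by (auto simp: qdvd_def qdot_def intro!: dvd_add mult_dvd_mono)
    then show False using n p_gt_1 by (auto simp: zdvd_not_zless)
  qed
next
  case (3 s t ws)
  then have st: "s \<in> B" "t \<in> B" "t \<noteq> qcnj s" "reduced (t # ws)"
    by (auto simp: reduced_def)
  show ?case
    using qdvd_swap[of "qcnj s" t "prod_list ws"] st 3(2) qcnj_B[OF st(1)]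
    by (auto simp: mult.assoc)
qed

lemma reduced_prod_inj:
  assumes "reduced ws" "reduced vs" "length ws = length vs" "prod_list ws = prod_list vs"
  shows "ws = vs"
  using assms(3,1,2,4)
proof (induction ws vs rule: list_induct2)
  case (Cons s ws t vs)
  have st: "s \<in> B" "t \<in> B" using Cons.prems(1,2) by (simp_all add: reduced_def)
  have eq: "s * prod_list ws = t * prod_list vs" using Cons.prems(3) by simp
  have "\<not> qdvd p (s * prod_list ws)"
    using reduced_not_qdvd[OF Cons.prems(1)] by simp
  then have "s = t"
    by (rule first_letter_unique[OF st eq])
  moreover have "prod_list ws = prod_list vs"
    using letter_cancel[OF st(1)] eq \<open>s = t\<close> by blast
  moreover have "reduced ws" "reduced vs"
    using Cons.prems(1,2) by (auto simp add: reduced_def successively_Cons)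
  ultimately show ?case using Cons.IH by simp
qed simp

lemma qcnj_prod_list: "qcnj (prod_list ws) = prod_list (rev (map qcnj ws))"
  by (induction ws) (auto simp: qcnj_mult, simp add: quat_simps)

lemma qnorm_word: "ws \<in> words A m \<Longrightarrow> qnorm (prod_list ws) = p ^ m"
  by (induction m arbitrary: ws) (auto simp: words_Suc qnorm_mult qnorm_A, simp add: quat_simps)

lemma reduced_word: "ws \<in> words A m \<Longrightarrow> reduced ws"
proof (induction m arbitrary: ws)
  case (Suc m)
  then obtain s vs where ws: "ws = s # vs" "s \<in> A" "vs \<in> words A m"
    by (auto simp: words_Suc)
  with Suc.IH have "reduced vs" by blast
  moreover have "hd vs \<noteq> qcnj s" if "vs \<noteq> []"
  proof -
    have "hd vs \<in> A" using that ws(3) by (cases vs) (auto simp: words_def)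
    then show ?thesis using disjoint_A ws(2) by auto
  qed
  ultimately show ?case using ws(1,2) by (auto simp: reduced_def successively_Cons)
qed (simp add: reduced_def)

lemma reduced_conj_append:
  assumes "vs \<in> words A k" "ws \<in> words A k" "k > 0 \<Longrightarrow> hd vs \<noteq> hd ws"
  shows "reduced (rev (map qcnj vs) @ ws)"
proof -
  have r: "reduced vs" "reduced ws" using assms reduced_word by blast+
  have "successively (\<lambda>s t. t \<noteq> qcnj s) (rev (map qcnj vs))"
  proof -
    have "successively (\<lambda>s t. s \<noteq> qcnj t) (map qcnj vs)"
      using r(1) unfolding reduced_def successively_map
      by (auto elim!: successively_mono)
    then show ?thesis by (simp add: successively_rev)
  qed
  moreover have "hd ws \<noteq> qcnj (last (rev (map qcnj vs)))" if "vs \<noteq> []" "ws \<noteq> []"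
  proof -
    have "k > 0" using assms(1) that by (auto simp: words_def)
    with assms(3) that show ?thesis by (simp add: last_rev hd_map)
  qed
  ultimately show ?thesis
    using r by (auto simp: reduced_def successively_append_iff)
qed

text \<open>\<open>p ^ m\<close> is the product of the lengths of the two quaternions, so the
  condition concerns the cosine of their angle. The absolute value fits the even powers of that
  cosine that are summed later.\<close>

definition near :: "real \<Rightarrow> nat \<Rightarrow> int quat list \<times> int quat list \<Rightarrow> bool" where
  "near t m = (\<lambda>(v, w). \<bar>real_of_int (qdot (prod_list v) (prod_list w))\<bar> \<ge> (1 - t) * real_of_int p ^ m)"

abbreviation near_pairs :: "real \<Rightarrow> nat \<Rightarrow> (int quat list \<times> int quat list) set" where
  "near_pairs t m \<equiv> {x \<in> words A m \<times> words A m. near t m x}"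

text \<open>The integer points in two caps around the real axis on the three-sphere of radius
  \<open>p ^ k\<close>; they receive the quotients \<open>qcnj v * w\<close> of near pairs of
  words.\<close>

definition polar :: "real \<Rightarrow> nat \<Rightarrow> int quat set" where
  "polar t k = {r. qnorm r = p ^ (2 * k) \<and> \<bar>real_of_int (q0 r)\<bar> \<ge> (1 - t) * real_of_int p ^ k}"

text \<open>\<open>qcnj v * w\<close> is the product of a reduced word of length
  \<open>2 * k\<close>, as nothing cancels where different first letters meet. So it determines the
  pair, and its real part is \<open>qdot v w\<close>.\<close>

lemma card_near_distinct_heads:
  assumes "finite (polar t k)"
  shows "card {x \<in> words A k \<times> words A k. near t k x \<and> (k > 0 \<longrightarrow> hd (fst x) \<noteq> hd (snd x))} \<le> card (polar t k)"
proof (rule card_inj_on_le)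
  let ?X = "{x \<in> words A k \<times> words A k. near t k x \<and> (k > 0 \<longrightarrow> hd (fst x) \<noteq> hd (snd x))}"
  let ?f = "\<lambda>(v, w). prod_list (rev (map qcnj v) @ w)"
  show "inj_on ?f ?X"
  proof (rule inj_onI)
    fix x y
    assume x: "x \<in> ?X"
      and y: "y \<in> ?X"
      and xy: "?f x = ?f y"
    obtain v w v' w' where e: "x = (v, w)" "y = (v', w')" by (metis surj_pair)
    have l: "length v = k" "length v' = k" "length w = k" "length w' = k"
      using x y e by (auto simp: words_def)
    have "reduced (rev (map qcnj v) @ w)" "reduced (rev (map qcnj v') @ w')"
    proof -
      have "v \<in> words A k" "w \<in> words A k" "k > 0 \<Longrightarrow> hd v \<noteq> hd w"
        "v' \<in> words A k" "w' \<in> words A k" "k > 0 \<Longrightarrow> hd v' \<noteq> hd w'"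
        using x y unfolding e by simp_all
      note h = this
      show "reduced (rev (map qcnj v) @ w)" by (rule reduced_conj_append[OF h(1-3)])
      show "reduced (rev (map qcnj v') @ w')" by (rule reduced_conj_append[OF h(4-6)])
    qed
    moreover have "prod_list (rev (map qcnj v) @ w) = prod_list (rev (map qcnj v') @ w')"
      using xy unfolding e by (simp only: prod.case)
    ultimately have "rev (map qcnj v) @ w = rev (map qcnj v') @ w'"
      using l by (intro reduced_prod_inj) simp_all
    then have *: "map qcnj v = map qcnj v'" "w = w'" using l by simp_all
    have "map qcnj (map qcnj u) = u" for u :: "int quat list" by (simp add: o_def)
    then have "v = v'" by (metis *(1))
    then show "x = y" using e *(2) by simp
  qed
  show "?f ` ?X \<subseteq> polar t k"
  proof (rule image_subsetI)
    fix x
    assume x: "x \<in> ?X"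
    obtain v w where e: "x = (v, w)" by (metis surj_pair)
    have v: "v \<in> words A k" "w \<in> words A k" "near t k (v, w)"
      using x unfolding e by simp_all
    have "prod_list (rev (map qcnj v)) * prod_list w = qcnj (prod_list v) * prod_list w"
      by (simp add: qcnj_prod_list)
    moreover have "qnorm (qcnj (prod_list v) * prod_list w) = p ^ (2 * k)"
      using v by (simp add: qnorm_mult qnorm_word mult_2 power_add)
    moreover have "q0 (qcnj (prod_list v) * prod_list w) = qdot (prod_list v) (prod_list w)"
      by (simp add: quat_simps algebra_simps)
    ultimately show "?f x \<in> polar t k"
      using v(3) by (simp add: e polar_def near_def)
  qed
qed (rule assms)

lemma near_Cons:
  assumes "s \<in> A"
  shows "near t (Suc m) (s # v, s # w) \<longleftrightarrow> near t m (v, w)"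
  using assms p_gt_1 by (simp add: near_def qdot_mult_left qnorm_A abs_mult mult.left_commute)

text \<open>Sort the pairs by the length \<open>c\<close> of their common prefix.
  \<open>near_Cons\<close> strips the prefix, and the remainders have different first
  letters.\<close>

lemma card_near_pairs:
  assumes "\<And>k. k \<le> m \<Longrightarrow> finite (polar t k)"
  shows "card (near_pairs t m) \<le> (\<Sum>c\<le>m. card A ^ c * card (polar t (m - c)))"
  using assms
proof (induction m)
  case 0
  have "{x \<in> words A 0 \<times> words A 0. near t 0 x} =
     {x \<in> words A 0 \<times> words A 0. near t 0 x \<and> (0 > (0::nat) \<longrightarrow> hd (fst x) \<noteq> hd (snd x))}" by auto
  with card_near_distinct_heads[of t 0] 0 show ?case by simp
next
  case (Suc m)
  let ?W = "words A (Suc m) \<times> words A (Suc m)"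
  let ?N = "near_pairs t m"
  let ?D = "{x \<in> ?W. near t (Suc m) x \<and> (Suc m > 0 \<longrightarrow> hd (fst x) \<noteq> hd (snd x))}"
  have finN: "finite (A \<times> ?N)"
    using finite_words[OF finite_A] finite_A by auto
  have finD: "finite ?D"
    using finite_words[OF finite_A] by auto
  have "{x \<in> ?W. near t (Suc m) x} \<subseteq> (\<lambda>(s, v, w). (s # v, s # w)) ` (A \<times> ?N) \<union> ?D"
  proof
    fix x assume x: "x \<in> {x \<in> ?W. near t (Suc m) x}"
    then obtain s v s' w where e: "x = (s # v, s' # w)" "s \<in> A" "s' \<in> A" "v \<in> words A m" "w \<in> words A m"
      by (auto simp: words_Suc)
    show "x \<in> (\<lambda>(s, v, w). (s # v, s # w)) ` (A \<times> ?N) \<union> ?D"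
    proof (cases "s = s'")
      case True
      with x e near_Cons[OF e(2)] have "(s, v, w) \<in> A \<times> ?N" by auto
      with e True show ?thesis by force
    next
      case False
      with x e show ?thesis by auto
    qed
  qed
  then have "card {x \<in> ?W. near t (Suc m) x} \<le> card ((\<lambda>(s, v, w). (s # v, s # w)) ` (A \<times> ?N) \<union> ?D)"
    using finN finD by (intro card_mono) auto
  also have "\<dots> \<le> card ((\<lambda>(s, v, w). (s # v, s # w)) ` (A \<times> ?N)) + card ?D"
    by (rule card_Un_le)
  also have "card ((\<lambda>(s, v, w). (s # v, s # w)) ` (A \<times> ?N)) \<le> card (A \<times> ?N)"
    by (rule card_image_le[OF finN])
  also have "card (A \<times> ?N) \<le> card A * (\<Sum>c\<le>m. card A ^ c * card (polar t (m - c)))"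
    using Suc by (simp add: card_cartesian_product)
  also have "card ?D \<le> card (polar t (Suc m))"
    by (rule card_near_distinct_heads) (simp add: Suc.prems)
  finally show ?case
    by (subst sum.atMost_Suc_shift) (simp add: sum_distrib_left mult_ac)
qed

end

section \<open>Integer points in polar caps\<close>

lemma card_int_interval:
  assumes "x \<le> y"
  shows "finite {a::int. x \<le> real_of_int a \<and> real_of_int a \<le> y}"
    and "real (card {a::int. x \<le> real_of_int a \<and> real_of_int a \<le> y}) \<le> y - x + 1"
proof -
  have e: "{a::int. x \<le> real_of_int a \<and> real_of_int a \<le> y} = {\<lceil>x\<rceil>..\<lfloor>y\<rfloor>}"
    by (auto simp: ceiling_le_iff le_floor_iff)
  show "finite {a::int. x \<le> real_of_int a \<and> real_of_int a \<le> y}" by (simp add: e)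
  show "real (card {a::int. x \<le> real_of_int a \<and> real_of_int a \<le> y}) \<le> y - x + 1"
    unfolding e using assms by simp linarith
qed

context prime_quats
begin

text \<open>The caps leave \<open>O(s\<^sup>2 * R + 1)\<close> values for the first coordinate and
  \<open>O(s * R + 1)\<close> for the second; the last two lie on a circle with at most
  \<open>D\<close> points. Up to \<open>D\<close>, the leading term \<open>s ^ 3 * R\<^sup>2\<close>
  is what the volume of the caps predicts.\<close>

lemma card_polar:
  fixes D s :: real and k :: nat
  assumes s: "0 < s" "s \<le> 1" and D: "D \<ge> 1"
    and circ: "\<And>K. K > 0 \<Longrightarrow> int K \<le> p ^ (2 * k) \<Longrightarrow> real (card (circle_points K)) \<le> D"
  defines "R \<equiv> real_of_int p ^ k"
  shows "finite (polar (s\<^sup>2) k)"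
    and "real (card (polar (s\<^sup>2) k)) \<le> D * (6 * s ^ 3 * R\<^sup>2 + 8 * s * R + 2)"
proof -
  let ?I = "\<lambda>x y. {a::int. x \<le> real_of_int a \<and> real_of_int a \<le> y}"
  define aa where "aa = ?I (- R) (- ((1 - s\<^sup>2) * R)) \<union> ?I ((1 - s\<^sup>2) * R) R"
  define bb where "bb = ?I (- (sqrt 2 * s * R)) (sqrt 2 * s * R)"
  define cc where "cc = (\<lambda>(a, b). circle_points (nat (p ^ (2 * k) - a\<^sup>2 - b\<^sup>2)))"
  have R: "R > 0" unfolding R_def using p_gt_1 by simp
  have R2: "real_of_int (p ^ (2 * k)) = R\<^sup>2"
    by (simp add: R_def power_even_eq)
  have s2: "s\<^sup>2 \<le> 1" "s\<^sup>2 > 0" using s by (auto simp: power_le_one)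
  have ia: "- R \<le> - ((1 - s\<^sup>2) * R)" "(1 - s\<^sup>2) * R \<le> R"
    using R s2 by (auto simp: algebra_simps)
  have ib: "- (sqrt 2 * s * R) \<le> sqrt 2 * s * R" using R s by simp
  have fin: "finite aa" "finite bb"
    unfolding aa_def bb_def using card_int_interval(1) ia ib by auto
  have "polar (s\<^sup>2) k \<subseteq> (\<lambda>((a, b), (c, d)). Quat a b c d) ` (SIGMA ab:aa \<times> bb. cc ab)"
  proof
    fix r assume "r \<in> polar (s\<^sup>2) k"
    then obtain a b c d where r: "r = Quat a b c d" "a * a + b * b + c * c + d * d = p ^ (2 * k)"
      "\<bar>real_of_int a\<bar> \<ge> (1 - s\<^sup>2) * R"
      by (cases r) (auto simp: polar_def qdot_def R_def)
    have eq: "(real_of_int a)\<^sup>2 + (real_of_int b)\<^sup>2 + (real_of_int c)\<^sup>2 + (real_of_int d)\<^sup>2 = R\<^sup>2"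
      unfolding R2[symmetric] r(2)[symmetric] by (simp add: power2_eq_square)
    have "\<bar>real_of_int a\<bar> \<le> \<bar>R\<bar>"
      unfolding abs_le_square_iff eq[symmetric] by simp
    then have "a \<in> aa" using r(3) R unfolding aa_def by auto
    moreover have "b \<in> bb"
    proof -
      have "((1 - s\<^sup>2) * R)\<^sup>2 \<le> (real_of_int a)\<^sup>2"
        using power_mono[OF r(3), of 2] s2 R by simp
      then have "(real_of_int b)\<^sup>2 \<le> R\<^sup>2 - ((1 - s\<^sup>2) * R)\<^sup>2"
        using eq zero_le_power2[of "real_of_int c"] zero_le_power2[of "real_of_int d"] by linarith
      also have "\<dots> = R\<^sup>2 * (2 * s\<^sup>2 - s ^ 4)"
        by (simp add: power2_eq_square algebra_simps power4_eq_xxxx)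
      also have "\<dots> \<le> R\<^sup>2 * (2 * s\<^sup>2)"
        by (intro mult_left_mono) auto
      also have "\<dots> = (sqrt 2 * s * R)\<^sup>2"
        by (simp add: power_mult_distrib)
      finally have "\<bar>real_of_int b\<bar> \<le> \<bar>sqrt 2 * s * R\<bar>"
        by (simp only: abs_le_square_iff)
      then show ?thesis using s R unfolding bb_def by (auto simp: abs_le_iff)
    qed
    moreover have "(c, d) \<in> cc (a, b)"
    proof -
      have "p ^ (2 * k) - a\<^sup>2 - b\<^sup>2 = c\<^sup>2 + d\<^sup>2"
        unfolding r(2)[symmetric] by (simp add: power2_eq_square)
      then show ?thesis unfolding cc_def prod.case circle_points_def by simp
    qed
    ultimately show "r \<in> (\<lambda>((a, b), (c, d)). Quat a b c d) ` (SIGMA ab:aa \<times> bb. cc ab)"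
      unfolding r(1) by (intro image_eqI[of _ _ "((a, b), (c, d))"]) simp_all
  qed
  moreover have finS: "finite (SIGMA ab:aa \<times> bb. cc ab)"
    using fin finite_circle_points by (auto simp: cc_def)
  ultimately show "finite (polar (s\<^sup>2) k)"
    by (intro finite_surj[OF finS])
  have "card (polar (s\<^sup>2) k) \<le> card (SIGMA ab:aa \<times> bb. cc ab)"
    using finS \<open>polar (s\<^sup>2) k \<subseteq> _\<close> by (rule surj_card_le)
  also have "\<dots> = (\<Sum>ab\<in>aa \<times> bb. card (cc ab))"
    using fin finite_circle_points by (intro card_SigmaI) (auto simp: cc_def)
  finally have "real (card (polar (s\<^sup>2) k)) \<le> (\<Sum>ab\<in>aa \<times> bb. real (card (cc ab)))"
    by (simp flip: of_nat_sum)
  also have "\<dots> \<le> (\<Sum>ab\<in>aa \<times> bb. D)"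
  proof (intro sum_mono)
    fix ab assume "ab \<in> aa \<times> bb"
    obtain a b where ab: "ab = (a, b)" by (metis surj_pair)
    define K where "K = nat (p ^ (2 * k) - a\<^sup>2 - b\<^sup>2)"
    show "real (card (cc ab)) \<le> D"
    proof (cases "K = 0")
      \<comment> \<open>The circle of radius 0 has one point, which \<open>D \<ge> 1\<close>
        accounts for.\<close>
      case True
      have "circle_points 0 = {(0, 0)}"
        by (auto simp: circle_points_def sum_power2_eq_zero_iff)
      then show ?thesis using True D by (simp add: ab cc_def K_def)
    next
      case False
      have "int K \<le> p ^ (2 * k)" using False unfolding K_def
        using zero_le_power2[of a] zero_le_power2[of b] by linarith
      then show ?thesis using circ[of K] False by (simp add: ab cc_def K_def)
    qed
  qed
  also have "\<dots> = D * (real (card aa) * real (card bb))"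
    by (simp add: card_cartesian_product)
  also have "\<dots> \<le> D * ((2 * s\<^sup>2 * R + 2) * (2 * sqrt 2 * s * R + 1))"
  proof (intro mult_left_mono mult_mono)
    have "real (card aa) \<le> real (card (?I (- R) (- ((1 - s\<^sup>2) * R))) + card (?I ((1 - s\<^sup>2) * R) R))"
      unfolding aa_def by (intro of_nat_mono card_Un_le)
    also have "\<dots> \<le> 2 * s\<^sup>2 * R + 2"
      using card_int_interval(2)[OF ia(1)] card_int_interval(2)[OF ia(2)] by (simp add: algebra_simps)
    finally show "real (card aa) \<le> 2 * s\<^sup>2 * R + 2" .
    show "real (card bb) \<le> 2 * sqrt 2 * s * R + 1"
      unfolding bb_def using card_int_interval(2)[OF ib] by (simp add: mult_ac)
  qed (use R D in auto)
  also have "(2 * s\<^sup>2 * R + 2) * (2 * sqrt 2 * s * R + 1) =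
      4 * sqrt 2 * s ^ 3 * R\<^sup>2 + (2 * s\<^sup>2 + 4 * sqrt 2 * s) * R + 2"
    by (simp add: algebra_simps power2_eq_square power3_eq_cube)
  also have "D * \<dots> \<le> D * (6 * s ^ 3 * R\<^sup>2 + 8 * s * R + 2)"
  proof (intro mult_left_mono add_mono mult_right_mono)
    have "sqrt 2 \<le> 3 / 2" by (rule real_le_lsqrt) (auto simp: power2_eq_square)
    then show "4 * sqrt 2 \<le> 6" by simp
    have "2 * s\<^sup>2 \<le> 2 * s" using s by (simp add: power2_eq_square mult_left_le)
    moreover have "4 * sqrt 2 * s \<le> 6 * s" using \<open>4 * sqrt 2 \<le> 6\<close> s by (intro mult_right_mono) auto
    ultimately show "2 * s\<^sup>2 + 4 * sqrt 2 * s \<le> 8 * s" by linarith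
  qed (use R D s in auto)
  finally show "real (card (polar (s\<^sup>2) k)) \<le> D * (6 * s ^ 3 * R\<^sup>2 + 8 * s * R + 2)" .
qed

text \<open>A common prefix of length \<open>c\<close> costs \<open>card A ^ c\<close> but shrinks
  the radius by \<open>p ^ c\<close>; as \<open>card A \<le> p\<close>, one bound serves all
  \<open>m + 1\<close> prefix lengths. The term \<open>card A ^ m\<close> has the order of the
  number of coinciding pairs.\<close>

lemma near_pairs_bound:
  fixes D s :: real and m :: nat
  assumes s: "0 < s" "s \<le> 1" and D: "D \<ge> 1"
    and circ: "\<And>K. K > 0 \<Longrightarrow> int K \<le> p ^ (2 * m) \<Longrightarrow> real (card (circle_points K)) \<le> D"
    and A0: "card A > 0"
    and Ap: "real (card A) \<le> real_of_int p"
  defines "R \<equiv> real_of_int p ^ m"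
  shows "real (card (near_pairs (s\<^sup>2) m)) \<le>
    (real m + 1) * D * (6 * s ^ 3 * R\<^sup>2 + 8 * s * R + 2 * real (card A) ^ m)"
proof -
  define q where "q = real_of_int p"
  define a where "a = real (card A)"
  have q: "q > 1" using p_gt_1 by (simp add: q_def)
  have circ': "real (card (circle_points K)) \<le> D" if "K > 0" "int K \<le> p ^ (2 * k)" "k \<le> m" for K k
  proof -
    have "p ^ (2 * k) \<le> p ^ (2 * m)" using that p_gt_1 by (intro power_increasing) auto
    with that circ show ?thesis by auto
  qed
  have pol: "finite (polar (s\<^sup>2) k)"
    "real (card (polar (s\<^sup>2) k)) \<le> D * (6 * s ^ 3 * (q ^ k)\<^sup>2 + 8 * s * q ^ k + 2)" if "k \<le> m" for k
    using card_polar[OF s D, of k] circ' that unfolding q_def by blast+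
  have "real (card (near_pairs (s\<^sup>2) m)) \<le>
      real (\<Sum>c\<le>m. card A ^ c * card (polar (s\<^sup>2) (m - c)))"
    by (intro of_nat_mono card_near_pairs pol)
  also have "\<dots> = (\<Sum>c\<le>m. a ^ c * real (card (polar (s\<^sup>2) (m - c))))"
    by (simp add: a_def)
  also have "\<dots> \<le> (\<Sum>c\<le>m. D * (6 * s ^ 3 * R\<^sup>2 + 8 * s * R + 2 * a ^ m))"
  proof (intro sum_mono)
    fix c assume "c \<in> {..m}"
    then have c: "c \<le> m" by simp
    have qm: "q ^ c * q ^ (m - c) = R" using c by (simp add: R_def q_def flip: power_add)
    have aq: "a ^ c \<le> q ^ c" using Ap by (intro power_mono) (auto simp: a_def q_def)
    have "a ^ c * real (card (polar (s\<^sup>2) (m - c))) \<le>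
        a ^ c * (D * (6 * s ^ 3 * (q ^ (m - c))\<^sup>2 + 8 * s * q ^ (m - c) + 2))"
      using pol(2)[of "m - c"] by (intro mult_left_mono) (auto simp: a_def)
    also have "\<dots> = D * (6 * s ^ 3 * (a ^ c * (q ^ (m - c))\<^sup>2) + 8 * s * (a ^ c * q ^ (m - c)) + 2 * a ^ c)"
      by (simp add: algebra_simps)
    also have "\<dots> \<le> D * (6 * s ^ 3 * R\<^sup>2 + 8 * s * R + 2 * a ^ m)"
    proof (intro mult_left_mono add_mono)
      show "a ^ c * q ^ (m - c) \<le> R"
        unfolding qm[symmetric] using aq q by (intro mult_right_mono) auto
      have "q ^ c * 1 \<le> q ^ c * q ^ c" using q by (intro mult_left_mono) auto
      then have "a ^ c \<le> (q ^ c)\<^sup>2" using aq by (simp add: power2_eq_square)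
      then have "a ^ c * (q ^ (m - c))\<^sup>2 \<le> (q ^ c)\<^sup>2 * (q ^ (m - c))\<^sup>2"
        by (intro mult_right_mono) auto
      then show "a ^ c * (q ^ (m - c))\<^sup>2 \<le> R\<^sup>2"
        by (simp add: power_mult_distrib flip: qm)
      show "a ^ c \<le> a ^ m"
        using A0 c by (intro power_increasing) (auto simp: a_def)
    qed (use D s in auto)
    finally show "a ^ c * real (card (polar (s\<^sup>2) (m - c))) \<le> D * (6 * s ^ 3 * R\<^sup>2 + 8 * s * R + 2 * a ^ m)" .
  qed
  finally show ?thesis by (simp add: a_def add.commute mult.assoc)
qed

end

section \<open>A concrete set of letters\<close>

section \<open>Seventy-five letters of norm 149\<close>

text \<open>One quaternion from each conjugate pair among the 150 integral quaternions of norm 149 with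
  odd positive real part and even imaginary parts. The only numerical input needed later is
  \<open>149 ^ 6 \<le> 75 ^ 7\<close>.\<close>

definition letters_list :: "int quat list" where
  "letters_list = [
    Quat 1 0 2 (-12), Quat 1 0 2 12, Quat 1 0 12 (-2), Quat 1 0 12 2, Quat 1 2 (-12) 0,
    Quat 1 2 0 (-12), Quat 1 2 0 12, Quat 1 2 12 0, Quat 1 12 (-2) 0, Quat 1 12 0 (-2),
    Quat 1 12 0 2, Quat 1 12 2 0, Quat 3 2 (-10) (-6), Quat 3 2 (-10) 6, Quat 3 2 (-6) (-10),
    Quat 3 2 (-6) 10, Quat 3 2 6 (-10), Quat 3 2 6 10, Quat 3 2 10 (-6), Quat 3 2 10 6,
    Quat 3 6 (-10) (-2), Quat 3 6 (-10) 2, Quat 3 6 (-2) (-10), Quat 3 6 (-2) 10,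
    Quat 3 6 2 (-10), Quat 3 6 2 10, Quat 3 6 10 (-2), Quat 3 6 10 2, Quat 3 10 (-6) (-2),
    Quat 3 10 (-6) 2, Quat 3 10 (-2) (-6), Quat 3 10 (-2) 6, Quat 3 10 2 (-6), Quat 3 10 2 6,
    Quat 3 10 6 (-2), Quat 3 10 6 2, Quat 7 0 0 10, Quat 7 0 6 (-8), Quat 7 0 6 8,
    Quat 7 0 8 (-6), Quat 7 0 8 6, Quat 7 0 10 0, Quat 7 6 (-8) 0, Quat 7 6 0 (-8), Quat 7 6 0 8,
    Quat 7 6 8 0, Quat 7 8 (-6) 0, Quat 7 8 0 (-6), Quat 7 8 0 6, Quat 7 8 6 0, Quat 7 10 0 0,
    Quat 9 0 2 (-8), Quat 9 0 2 8, Quat 9 0 8 (-2), Quat 9 0 8 2, Quat 9 2 (-8) 0,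
    Quat 9 2 0 (-8), Quat 9 2 0 8, Quat 9 2 8 0, Quat 9 4 (-6) (-4), Quat 9 4 (-6) 4,
    Quat 9 4 (-4) (-6), Quat 9 4 (-4) 6, Quat 9 4 4 (-6), Quat 9 4 4 6, Quat 9 4 6 (-4),
    Quat 9 4 6 4, Quat 9 6 (-4) (-4), Quat 9 6 (-4) 4, Quat 9 6 4 (-4), Quat 9 6 4 4,
    Quat 9 8 (-2) 0, Quat 9 8 0 (-2), Quat 9 8 0 2, Quat 9 8 2 0]"

definition letters :: "int quat set" where
  "letters = set letters_list"

text \<open>The last inequality is a numerical form of lexicographic positivity of the imaginary
  part, in base 25 because all entries are at most 12 in absolute value. It separates the letters
  from their conjugates.\<close>

lemma letters_properties:
  assumes "s \<in> letters"
  shows "qnorm s = 149" "odd (q0 s)" "q0 s > 0" "even (q1 s)" "even (q2 s)" "even (q3 s)"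
    "625 * q1 s + 25 * q2 s + q3 s > 0"
proof -
  have "list_all (\<lambda>s. qnorm s = 149 \<and> odd (q0 s) \<and> q0 s > 0 \<and> even (q1 s) \<and> even (q2 s) \<and> even (q3 s)
     \<and> 625 * q1 s + 25 * q2 s + q3 s > 0) letters_list"
    by code_simp
  with assms show "qnorm s = 149" "odd (q0 s)" "q0 s > 0" "even (q1 s)" "even (q2 s)" "even (q3 s)"
    "625 * q1 s + 25 * q2 s + q3 s > 0"
    by (simp_all add: letters_def list_all_iff)
qed

lemma card_letters: "card letters = 75"
proof -
  have "distinct letters_list" "length letters_list = 75"
    by code_simp+
  then show ?thesis by (simp add: letters_def distinct_card)
qed

lemma prime_149: "prime (149::int)"
proof -
  have "prime (149::nat)" by code_simp
  then show ?thesis by (metis of_nat_numeral prime_nat_int_transfer)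
qed

lemma qnorm_eq_0_iff: "qnorm (x :: int quat) = 0 \<longleftrightarrow> x = 0"
proof -
  have "q0 x * q0 x + q1 x * q1 x + q2 x * q2 x + q3 x * q3 x = 0 \<longleftrightarrow>
      q0 x = 0 \<and> q1 x = 0 \<and> q2 x = 0 \<and> q3 x = 0"
    by (smt (verit) mult_eq_0_iff zero_le_square)
  then show ?thesis by (cases x) (simp add: qdot_def zero_quat_def)
qed

text \<open>By the parities of the coordinates all inner products are odd, and they are at most 149
  in absolute value. A multiple of 149 would thus be 149 or -149, forcing \<open>s = t\<close> or
  \<open>s = - t\<close>; positive real parts exclude the latter.\<close>

interpretation letters: prime_quats 149 letters
proof
  show "prime (149::int)" by (rule prime_149)
  show "finite letters" by (simp add: letters_def)
  show "qnorm s = 149" if "s \<in> letters" for s using letters_properties(1)[OF that] .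
  have B: "qnorm s = 149" "odd (q0 s)" "q0 s > 0" "even (q1 s)" "even (q2 s)" "even (q3 s)"
    if "s \<in> letters \<union> qcnj ` letters" for s
    using that letters_properties by (auto simp: qcnj_def qdot_def)
  show "\<not> 149 dvd 2 * qdot s t"
    if st: "s \<in> letters \<union> qcnj ` letters" "t \<in> letters \<union> qcnj ` letters" "s \<noteq> t" for s t
  proof
    assume d: "149 dvd 2 * qdot s t"
    define x where "x = qdot s t"
    have "odd x" using B[OF st(1)] B[OF st(2)] by (simp add: x_def qdot_def)
    have minus: "qnorm (s - t) = 298 - 2 * x" and plus: "qnorm (s + t) = 298 + 2 * x"
      using B(1)[OF st(1)] B(1)[OF st(2)] by (simp_all add: x_def quat_simps algebra_simps)
    have nn: "qnorm r \<ge> 0" for r :: "int quat" by (simp add: qdot_def)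
    have "x \<noteq> 149" using minus qnorm_eq_0_iff[of "s - t"] st(3) by auto
    moreover have "x \<noteq> - 149"
    proof
      assume "x = - 149"
      then have "s + t = 0" using plus qnorm_eq_0_iff[of "s + t"] by simp
      then have "q0 s + q0 t = 0" by (simp add: quat_defs)
      then show False using B(3)[OF st(1)] B(3)[OF st(2)] by simp
    qed
    moreover have "\<bar>x\<bar> \<le> 149" using minus plus nn[of "s - t"] nn[of "s + t"] by linarith
    moreover have "149 dvd x" using d unfolding x_def by presburger
    ultimately show False using \<open>odd x\<close> by presburger
  qed
  show "letters \<inter> qcnj ` letters = {}"
  proof -
    have "625 * q1 s + 25 * q2 s + q3 s < 0" if s: "s \<in> qcnj ` letters" for s
    proof -
      obtain x where "x \<in> letters" "s = qcnj x" using s by blast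
      with letters_properties(7)[of x] show ?thesis by (simp add: qcnj_def)
    qed
    then show ?thesis using letters_properties(7) by fastforce
  qed
qed

section \<open>Norms of word sums in the representations\<close>

section \<open>Hilbert-Schmidt energies of words\<close>

text \<open>\<open>cheb n (qdot x y)\<close> is the trace of \<open>repm n x\<close> times the
  adjoint of \<open>repm n y\<close>, the Hilbert-Schmidt inner product of the two matrices, which
  is additive in each argument.\<close>

lemma cheb_sum:
  assumes "\<And>i. i \<in> I \<Longrightarrow> qnorm (f i) = 1" "\<And>i. i \<in> I \<Longrightarrow> qnorm (g i) = 1"
  shows "complex_of_real (\<Sum>i\<in>I. \<Sum>i'\<in>I. cheb n (qdot (f i) (g i'))) =
    (\<Sum>j\<le>n. \<Sum>k\<le>n. (\<Sum>i\<in>I. repm n (f i) j k) * cnj (\<Sum>i\<in>I. repm n (g i) j k))"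
proof -
  have one: "complex_of_real (cheb n (qdot (f i) (g i'))) =
      (\<Sum>j\<le>n. \<Sum>k\<le>n. repm n (f i) j k * cnj (repm n (g i') j k))" if "i \<in> I" "i' \<in> I" for i i'
  proof -
    have "qnorm (f i * qcnj (g i')) = 1" using assms that by (simp add: qnorm_mult)
    from repm_trace[OF this, of n]
    have "complex_of_real (cheb n (qdot (f i) (g i'))) = (\<Sum>j\<le>n. repm n (f i * qcnj (g i')) j j)"
      by (simp add: q0_mult_qcnj)
    also have "\<dots> = (\<Sum>j\<le>n. \<Sum>k\<le>n. repm n (f i) j k * repm n (qcnj (g i')) k j)"
      by (intro sum.cong) (simp_all add: repm_mult)
    also have "\<dots> = (\<Sum>j\<le>n. \<Sum>k\<le>n. repm n (f i) j k * cnj (repm n (g i') j k))"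
      by (intro sum.cong) (simp_all add: repm_qcnj)
    finally show ?thesis .
  qed
  have "complex_of_real (\<Sum>i\<in>I. \<Sum>i'\<in>I. cheb n (qdot (f i) (g i'))) =
      (\<Sum>i\<in>I. \<Sum>i'\<in>I. \<Sum>j\<le>n. \<Sum>k\<le>n. repm n (f i) j k * cnj (repm n (g i') j k))"
    by (simp add: one)
  also have "\<dots> = (\<Sum>i\<in>I. \<Sum>j\<le>n. \<Sum>i'\<in>I. \<Sum>k\<le>n. repm n (f i) j k * cnj (repm n (g i') j k))"
    by (intro sum.cong refl sum.swap)
  also have "\<dots> = (\<Sum>i\<in>I. \<Sum>j\<le>n. \<Sum>k\<le>n. \<Sum>i'\<in>I. repm n (f i) j k * cnj (repm n (g i') j k))"
    by (intro sum.cong refl sum.swap)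
  also have "\<dots> = (\<Sum>j\<le>n. \<Sum>i\<in>I. \<Sum>k\<le>n. \<Sum>i'\<in>I. repm n (f i) j k * cnj (repm n (g i') j k))"
    by (rule sum.swap)
  also have "\<dots> = (\<Sum>j\<le>n. \<Sum>k\<le>n. \<Sum>i\<in>I. \<Sum>i'\<in>I. repm n (f i) j k * cnj (repm n (g i') j k))"
    by (intro sum.cong refl sum.swap)
  also have "\<dots> = (\<Sum>j\<le>n. \<Sum>k\<le>n. (\<Sum>i\<in>I. repm n (f i) j k) * cnj (\<Sum>i\<in>I. repm n (g i) j k))"
    by (simp add: sum_product)
  finally show ?thesis .
qed

definition hs_sq :: "nat \<Rightarrow> (nat \<Rightarrow> nat \<Rightarrow> complex) \<Rightarrow> real" where
  "hs_sq n X = (\<Sum>j\<le>n. \<Sum>k\<le>n. (cmod (X j k))\<^sup>2)"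

lemma cheb_sum_self:
  assumes "\<And>i. i \<in> I \<Longrightarrow> qnorm (f i) = 1"
  shows "(\<Sum>i\<in>I. \<Sum>i'\<in>I. cheb n (qdot (f i) (f i'))) = hs_sq n (\<lambda>j k. \<Sum>i\<in>I. repm n (f i) j k)"
proof -
  have "complex_of_real (\<Sum>i\<in>I. \<Sum>i'\<in>I. cheb n (qdot (f i) (f i'))) =
      (\<Sum>j\<le>n. \<Sum>k\<le>n. (\<Sum>i\<in>I. repm n (f i) j k) * cnj (\<Sum>i\<in>I. repm n (f i) j k))"
    by (rule cheb_sum) (simp_all add: assms)
  also have "\<dots> = complex_of_real (hs_sq n (\<lambda>j k. \<Sum>i\<in>I. repm n (f i) j k))"
    unfolding hs_sq_def of_real_sum complex_norm_square ..
  finally show ?thesis by (simp only: of_real_eq_iff)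
qed

text \<open>Twice the real part of an inner product is at most the sum of the squared norms. This
  bounds shifted correlations by unshifted ones.\<close>

lemma cheb_sum_le:
  assumes "\<And>i. i \<in> I \<Longrightarrow> qnorm (f i) = 1" "\<And>i. i \<in> I \<Longrightarrow> qnorm (g i) = 1"
  shows "2 * (\<Sum>i\<in>I. \<Sum>i'\<in>I. cheb n (qdot (f i) (g i'))) \<le>
    (\<Sum>i\<in>I. \<Sum>i'\<in>I. cheb n (qdot (f i) (f i'))) + (\<Sum>i\<in>I. \<Sum>i'\<in>I. cheb n (qdot (g i) (g i')))"
proof -
  define F where "F = (\<lambda>j k. \<Sum>i\<in>I. repm n (f i) j k)"
  define G where "G = (\<lambda>j k. \<Sum>i\<in>I. repm n (g i) j k)"
  have "(\<Sum>i\<in>I. \<Sum>i'\<in>I. cheb n (qdot (f i) (g i'))) = Re (\<Sum>j\<le>n. \<Sum>k\<le>n. F j k * cnj (G j k))"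
  proof -
    have "complex_of_real (\<Sum>i\<in>I. \<Sum>i'\<in>I. cheb n (qdot (f i) (g i'))) =
        (\<Sum>j\<le>n. \<Sum>k\<le>n. F j k * cnj (G j k))"
      unfolding F_def G_def by (rule cheb_sum) (simp_all add: assms)
    from arg_cong[OF this, of Re] show ?thesis by (simp only: Re_complex_of_real)
  qed
  also have "\<dots> = (\<Sum>j\<le>n. \<Sum>k\<le>n. Re (F j k * cnj (G j k)))" by simp
  also have "2 * \<dots> \<le> (\<Sum>j\<le>n. \<Sum>k\<le>n. (cmod (F j k))\<^sup>2 + (cmod (G j k))\<^sup>2)"
    unfolding sum_distrib_left
  proof (intro sum_mono)
    fix j k
    have "Re (F j k * cnj (G j k)) \<le> cmod (F j k) * cmod (G j k)"
      using complex_Re_le_cmod[of "F j k * cnj (G j k)"] by (simp add: norm_mult)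
    then show "2 * Re (F j k * cnj (G j k)) \<le> (cmod (F j k))\<^sup>2 + (cmod (G j k))\<^sup>2"
      using sum_squares_bound[of "cmod (F j k)" "cmod (G j k)"] by linarith
  qed
  also have "\<dots> = hs_sq n F + hs_sq n G"
    by (simp add: hs_sq_def sum.distrib)
  finally show ?thesis
    by (simp only: cheb_sum_self assms F_def G_def)
qed

lemma hs_sq_nonneg: "hs_sq n X \<ge> 0"
  by (simp add: hs_sq_def sum_nonneg)

lemma hs_sq_mult:
  "hs_sq n (\<lambda>j l. \<Sum>k\<le>n. X j k * Y k l) \<le> hs_sq n X * hs_sq n Y"
proof -
  have one: "(cmod (\<Sum>k\<le>n. X j k * Y k l))\<^sup>2 \<le> (\<Sum>k\<le>n. (cmod (X j k))\<^sup>2) * (\<Sum>k\<le>n. (cmod (Y k l))\<^sup>2)" for j l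
  proof -
    have "cmod (\<Sum>k\<le>n. X j k * Y k l) \<le> (\<Sum>k\<le>n. cmod (X j k) * cmod (Y k l))"
      by (rule order_trans[OF norm_sum]) (simp add: norm_mult)
    then have "(cmod (\<Sum>k\<le>n. X j k * Y k l))\<^sup>2 \<le> (\<Sum>k\<le>n. cmod (X j k) * cmod (Y k l))\<^sup>2"
      by (intro power_mono) auto
    also have "\<dots> \<le> (\<Sum>k\<le>n. (cmod (X j k))\<^sup>2) * (\<Sum>k\<le>n. (cmod (Y k l))\<^sup>2)"
      by (rule Cauchy_Schwarz_ineq_sum)
    finally show ?thesis .
  qed
  have "hs_sq n (\<lambda>j l. \<Sum>k\<le>n. X j k * Y k l) \<le>
      (\<Sum>j\<le>n. \<Sum>l\<le>n. (\<Sum>k\<le>n. (cmod (X j k))\<^sup>2) * (\<Sum>k\<le>n. (cmod (Y k l))\<^sup>2))"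
    unfolding hs_sq_def by (intro sum_mono one)
  also have "\<dots> = (\<Sum>j\<le>n. \<Sum>k\<le>n. (cmod (X j k))\<^sup>2) * (\<Sum>l\<le>n. \<Sum>k\<le>n. (cmod (Y k l))\<^sup>2)"
    by (simp only: sum_product)
  also have "(\<Sum>l\<le>n. \<Sum>k\<le>n. (cmod (Y k l))\<^sup>2) = hs_sq n Y"
    unfolding hs_sq_def by (rule sum.swap)
  finally show ?thesis by (simp add: hs_sq_def)
qed

lemma words_add: "bij_betw (\<lambda>(v, w). v @ w) (words S a \<times> words S b) (words S (a + b))"
proof (rule bij_betwI[where g = "\<lambda>w. (take a w, drop a w)"])
  show "(\<lambda>w. (take a w, drop a w)) \<in> words S (a + b) \<rightarrow> words S a \<times> words S b"
    by (auto simp: words_def dest: in_set_takeD in_set_dropD)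
qed (auto simp: words_def)

definition word_rep :: "real quat set \<Rightarrow> nat \<Rightarrow> nat \<Rightarrow> nat \<Rightarrow> nat \<Rightarrow> complex" where
  "word_rep S n N j k = (\<Sum>w\<in>words S N. repm n (prod_list w) j k)"

lemma word_rep_add:
  assumes "j \<le> n" "l \<le> n"
  shows "word_rep S n (a + b) j l = (\<Sum>k\<le>n. word_rep S n a j k * word_rep S n b k l)"
proof -
  have "word_rep S n (a + b) j l = (\<Sum>(v, w)\<in>words S a \<times> words S b. repm n (prod_list (v @ w)) j l)"
    unfolding word_rep_def sum.reindex_bij_betw[OF words_add, symmetric]
    by (intro sum.cong) auto
  also have "\<dots> = (\<Sum>v\<in>words S a. \<Sum>w\<in>words S b. \<Sum>k\<le>n. repm n (prod_list v) j k * repm n (prod_list w) k l)"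
    by (simp add: sum.cartesian_product[symmetric] repm_mult[OF assms])
  also have "\<dots> = (\<Sum>v\<in>words S a. \<Sum>k\<le>n. \<Sum>w\<in>words S b. repm n (prod_list v) j k * repm n (prod_list w) k l)"
    by (intro sum.cong refl sum.swap)
  also have "\<dots> = (\<Sum>k\<le>n. \<Sum>v\<in>words S a. \<Sum>w\<in>words S b. repm n (prod_list v) j k * repm n (prod_list w) k l)"
    by (rule sum.swap)
  also have "\<dots> = (\<Sum>k\<le>n. word_rep S n a j k * word_rep S n b k l)"
    by (simp add: word_rep_def sum_product)
  finally show ?thesis .
qed

abbreviation pair_sum :: "real quat set \<Rightarrow> nat \<Rightarrow> (real quat \<Rightarrow> real quat \<Rightarrow> real) \<Rightarrow> real" where
  "pair_sum S N f \<equiv> (\<Sum>v\<in>words S N. \<Sum>w\<in>words S N. f (prod_list v) (prod_list w))"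

locale unit_quats =
  fixes S :: "real quat set"
  assumes finite_S: "finite S" and S_ne: "S \<noteq> {}" and unit_S: "s \<in> S \<Longrightarrow> qnorm s = 1"
begin

lemma unit_word: "w \<in> words S N \<Longrightarrow> qnorm (prod_list w) = 1"
  by (induction N arbitrary: w) (auto simp: words_Suc qnorm_mult unit_S, simp add: qdot_def one_quat_def)

text \<open>Not normalized: a word sum without any cancellation has energy
  \<open>(n + 1) * card S ^ (2 * N)\<close>, so decay means decay relative to
  \<open>card S ^ (2 * N)\<close>.\<close>

definition energy :: "nat \<Rightarrow> nat \<Rightarrow> real" where
  "energy n N = hs_sq n (word_rep S n N)"

lemma energy_eq:
  "energy n N = (\<Sum>v\<in>words S N. \<Sum>w\<in>words S N. cheb n (qdot (prod_list v) (prod_list w)))"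
  unfolding energy_def word_rep_def by (rule cheb_sum_self[symmetric]) (rule unit_word)

lemma energy_nonneg: "energy n N \<ge> 0"
  by (simp add: energy_def hs_sq_nonneg)

lemma energy_add: "energy n (a + b) \<le> energy n a * energy n b"
proof -
  have "energy n (a + b) = hs_sq n (\<lambda>j l. \<Sum>k\<le>n. word_rep S n a j k * word_rep S n b k l)"
    unfolding energy_def hs_sq_def by (intro sum.cong refl) (simp add: word_rep_add)
  also have "\<dots> \<le> energy n a * energy n b" unfolding energy_def by (rule hs_sq_mult)
  finally show ?thesis .
qed

lemma energy_mult: "energy n (q * m) \<le> energy n m ^ q * energy n 0"
proof (induction q)
  case (Suc q)
  have "energy n (Suc q * m) \<le> energy n m * energy n (q * m)"
    using energy_add[of n m "q * m"] by simp
  also have "\<dots> \<le> energy n m * (energy n m ^ q * energy n 0)"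
    by (intro mult_left_mono Suc energy_nonneg)
  finally show ?case by (simp add: mult_ac)
qed simp

lemma energy_trivial: "energy n N \<le> (real n + 1) * real (card S) ^ (2 * N)"
proof -
  let ?W = "words S N"
  have one: "(\<Sum>j\<le>n. \<Sum>k\<le>n. (cmod (repm n (prod_list w) j k))\<^sup>2) = real n + 1" if "w \<in> ?W" for w
    using cheb_sum_self[of "{w}" prod_list n] unit_word[OF that] by (simp add: hs_sq_def cheb_one)
  have "energy n N = (\<Sum>j\<le>n. \<Sum>k\<le>n. (cmod (\<Sum>w\<in>?W. repm n (prod_list w) j k))\<^sup>2)"
    by (simp add: energy_def hs_sq_def word_rep_def)
  also have "\<dots> \<le> (\<Sum>j\<le>n. \<Sum>k\<le>n. real (card ?W) * (\<Sum>w\<in>?W. (cmod (repm n (prod_list w) j k))\<^sup>2))"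
  proof (intro sum_mono)
    fix j k
    have "cmod (\<Sum>w\<in>?W. repm n (prod_list w) j k) \<le> (\<Sum>w\<in>?W. 1 * cmod (repm n (prod_list w) j k))"
      using norm_sum[of "\<lambda>w. repm n (prod_list w) j k" ?W] by simp
    then have "(cmod (\<Sum>w\<in>?W. repm n (prod_list w) j k))\<^sup>2 \<le> (\<Sum>w\<in>?W. 1 * cmod (repm n (prod_list w) j k))\<^sup>2"
      by (intro power_mono) auto
    also have "\<dots> \<le> (\<Sum>w\<in>?W. 1\<^sup>2) * (\<Sum>w\<in>?W. (cmod (repm n (prod_list w) j k))\<^sup>2)"
      by (rule Cauchy_Schwarz_ineq_sum)
    finally show "(cmod (\<Sum>w\<in>?W. repm n (prod_list w) j k))\<^sup>2 \<le>
        real (card ?W) * (\<Sum>w\<in>?W. (cmod (repm n (prod_list w) j k))\<^sup>2)" by simp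
  qed
  also have "\<dots> = real (card ?W) * (\<Sum>j\<le>n. \<Sum>k\<le>n. \<Sum>w\<in>?W. (cmod (repm n (prod_list w) j k))\<^sup>2)"
    by (simp only: sum_distrib_left)
  also have "(\<Sum>j\<le>n. \<Sum>k\<le>n. \<Sum>w\<in>?W. (cmod (repm n (prod_list w) j k))\<^sup>2) =
      (\<Sum>w\<in>?W. \<Sum>j\<le>n. \<Sum>k\<le>n. (cmod (repm n (prod_list w) j k))\<^sup>2)"
    by (subst sum.swap, subst sum.swap) (intro sum.cong refl sum.swap)
  also have "\<dots> = real (card ?W) * (real n + 1)"
    using one by simp
  finally show ?thesis
    by (simp add: card_words[OF finite_S] power_mult power2_eq_square power_mult_distrib mult_ac)
qed

lemma power_sum_energy:
  "pair_sum S N (\<lambda>v w. (2 * qdot v w) ^ M) =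
    (\<Sum>n\<le>M. real (ballot M n) * energy n N)"
proof -
  have "pair_sum S N (\<lambda>v w. (2 * qdot v w) ^ M) =
    (\<Sum>v\<in>words S N. \<Sum>n\<le>M. \<Sum>w\<in>words S N. real (ballot M n) * cheb n (qdot (prod_list v) (prod_list w)))"
    unfolding two_x_power_cheb by (intro sum.cong refl sum.swap)
  also have "\<dots> = (\<Sum>n\<le>M. \<Sum>v\<in>words S N. \<Sum>w\<in>words S N. real (ballot M n) * cheb n (qdot (prod_list v) (prod_list w)))"
    by (rule sum.swap)
  finally show ?thesis by (simp only: energy_eq sum_distrib_left)
qed

text \<open>Right multiplication by \<open>h\<close> preserves inner products, so both squared norms
  in \<open>cheb_sum_le\<close> equal the unshifted energy. The nonnegative \<open>ballot\<close>
  weights allow the comparison degree by degree.\<close>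

lemma power_sum_shift_energy:
  assumes "qnorm h = 1"
  shows "pair_sum S N (\<lambda>v w. (2 * qdot (v * h) w) ^ M) \<le>
    (\<Sum>n\<le>M. real (ballot M n) * energy n N)"
proof -
  have "pair_sum S N (\<lambda>v w. (2 * qdot (v * h) w) ^ M) =
    (\<Sum>v\<in>words S N. \<Sum>n\<le>M. \<Sum>w\<in>words S N. real (ballot M n) * cheb n (qdot (prod_list v * h) (prod_list w)))"
    unfolding two_x_power_cheb by (intro sum.cong refl sum.swap)
  also have "\<dots> = (\<Sum>n\<le>M. \<Sum>v\<in>words S N. \<Sum>w\<in>words S N. real (ballot M n) * cheb n (qdot (prod_list v * h) (prod_list w)))"
    by (rule sum.swap)
  also have "\<dots> = (\<Sum>n\<le>M. real (ballot M n) * pair_sum S N (\<lambda>v w. cheb n (qdot (v * h) w)))"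
    by (simp only: sum_distrib_left)
  also have "\<dots> \<le> (\<Sum>n\<le>M. real (ballot M n) * energy n N)"
  proof (intro sum_mono mult_left_mono)
    fix n
    have "2 * pair_sum S N (\<lambda>v w. cheb n (qdot (v * h) w)) \<le>
       pair_sum S N (\<lambda>v w. cheb n (qdot (v * h) (w * h))) + energy n N"
      unfolding energy_eq by (rule cheb_sum_le) (simp_all add: qnorm_mult unit_word assms)
    also have "pair_sum S N (\<lambda>v w. cheb n (qdot (v * h) (w * h))) = energy n N"
      by (simp add: energy_eq qdot_mult_right assms)
    finally show "pair_sum S N (\<lambda>v w. cheb n (qdot (v * h) w)) \<le> energy n N"
      by simp
  qed simp
  finally show ?thesis .
qed

end

section \<open>Exponential decay of the energies\<close>

section \<open>Decay of correlations\<close>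

definition qreal :: "int quat \<Rightarrow> real quat" where
  "qreal x = Quat (real_of_int (q0 x)) (real_of_int (q1 x)) (real_of_int (q2 x)) (real_of_int (q3 x))"

lemma qreal_mult: "qreal (x * y) = qreal x * qreal y"
  by (simp add: qreal_def times_quat_def)

lemma qdot_qreal: "qdot (qreal x) (qreal y) = real_of_int (qdot x y)"
  by (simp add: qreal_def qdot_def)

lemma qdot_qscale: "qdot (qscale a x) (qscale b y) = a * b * qdot x y"
  by (simp add: qscale_def qdot_def algebra_simps)

lemma qdot_abs_le_1:
  fixes x y :: "real quat"
  assumes "qnorm x = 1" "qnorm y = 1"
  shows "\<bar>qdot x y\<bar> \<le> 1"
proof -
  have nn: "qnorm r \<ge> 0" for r :: "real quat" by (simp add: qdot_def)
  have "qnorm (x - y) = 2 - 2 * qdot x y" "qnorm (x + y) = 2 + 2 * qdot x y"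
    using assms by (simp_all add: quat_simps algebra_simps)
  then show ?thesis using nn[of "x - y"] nn[of "x + y"] by linarith
qed

lemma words_image: "words (f ` A) N = map f ` words A N"
proof (induction N)
  case (Suc N)
  show ?case unfolding words_Suc Suc by (auto simp: image_iff)
qed simp

text \<open>Bounds the right side of \<open>energy_le\<close> divided by
  \<open>card A ^ (2 * m)\<close>, for \<open>x = n\<close>, \<open>s = x powr (-199 / 200)\<close>
  and \<open>p ^ m\<close> between \<open>x ^ 3\<close> and \<open>q * x ^ 3\<close>. The dominant
  power of \<open>x\<close> is \<open>2 + 1 / 100 - 597 / 200 + 6 / 7 = - 33 / 280\<close>, which
  leaves room for the logarithm and for \<open>-1 / 20\<close>.\<close>

definition decay_error :: "real \<Rightarrow> real \<Rightarrow> real \<Rightarrow> real" where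
  "decay_error C q x = 12 * x\<^sup>2 * ((2 + 3 * ln x) * (C * (q * x ^ 3) powr (1 / 300)) *
     (6 * (x powr (-199 / 200)) ^ 3 * (q * x ^ 3) powr (2 / 7)
       + 8 * x powr (-199 / 200) * (x ^ 3) powr (-5 / 7) + 2 * (x ^ 3) powr (-6 / 7))
     + exp (- 2 * x powr (1 / 100)))"

lemma decay_error_asymptotics:
  fixes C q :: real
  assumes "C > 0" "q > 1"
  shows "eventually (\<lambda>x. decay_error C q x \<le> x powr (-1 / 20)) at_top"
  unfolding decay_error_def using assms by real_asymp

text \<open>\<open>card A\<close> is at least \<open>p powr (6 / 7)\<close>. For
  \<open>p ^ m\<close> of size \<open>n ^ 3\<close> the shortfall against \<open>p\<close> then
  costs about \<open>n powr (6 / 7)\<close>, less than the gain of nearly \<open>n\<close> from the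
  small caps; the break-even exponent would be 5/6.\<close>

locale dense_prime_quats = prime_quats +
  assumes p_ge: "p \<ge> 3"
    and card_A_le: "real (card A) \<le> real_of_int p"
    and card_A_ge: "p ^ 6 \<le> int (card A) ^ 7"
begin

definition hat :: "int quat \<Rightarrow> real quat" where
  "hat s = qscale (1 / sqrt (real_of_int p)) (qreal s)"

abbreviation a :: real where "a \<equiv> real (card A)"
abbreviation q :: real where "q \<equiv> real_of_int p"

lemma card_A_pos: "card A > 0"
proof -
  have "p ^ 6 > 0" using p_ge by simp
  then have "int (card A) ^ 7 > 0" using card_A_ge by linarith
  then show ?thesis by (cases "card A = 0") auto
qed

lemma inj_hat: "inj hat"
proof (rule injI)
  fix x y assume "hat x = hat y"
  then show "x = y" using p_ge by (cases x; cases y) (simp add: hat_def qscale_def qreal_def)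
qed

lemma prod_list_hat: "prod_list (map hat w) = qscale (1 / sqrt q ^ length w) (qreal (prod_list w))"
proof (induction w)
  case Nil
  show ?case by (simp add: qscale_def qreal_def one_quat_def)
next
  case (Cons s w)
  then show ?case
    by (simp add: hat_def qreal_mult qscale_mult_left qscale_mult_right) (simp add: qscale_def)
qed

lemma qdot_hat:
  assumes "v \<in> words A m" "w \<in> words A m"
  shows "qdot (prod_list (map hat v)) (prod_list (map hat w)) = real_of_int (qdot (prod_list v) (prod_list w)) / q ^ m"
proof -
  have l: "length v = m" "length w = m" using assms by (auto simp: words_def)
  have "1 / sqrt q ^ m * (1 / sqrt q ^ m) = 1 / q ^ m"
    using p_ge by (simp flip: power_mult_distrib)
  then show ?thesis
    unfolding prod_list_hat qdot_qscale qdot_qreal l by simp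
qed

sublocale unit_quats "hat ` A"
proof
  show "finite (hat ` A)" using finite_A by simp
  show "hat ` A \<noteq> {}" using card_A_pos by auto
  fix s assume "s \<in> hat ` A"
  then obtain x where x: "x \<in> A" "s = hat x" by blast
  have "[x] \<in> words A 1" using x by (simp add: words_def)
  from qdot_hat[OF this this] x p_ge qnorm_A[OF x(1)] show "qnorm s = 1" by simp
qed

lemma card_hat: "card (hat ` A) = card A"
  by (rule card_image) (rule inj_on_subset[OF inj_hat subset_UNIV])

lemma sum_words_hat: "(\<Sum>w\<in>words (hat ` A) m. f w) = (\<Sum>w\<in>words A m. f (map hat w))"
  unfolding words_image using inj_hat by (subst sum.reindex) (auto intro: inj_onI)

lemma power_sum_le:
  assumes "0 \<le> t" "t \<le> 1"
  shows "(\<Sum>v\<in>words (hat ` A) m. \<Sum>w\<in>words (hat ` A) m. qdot (prod_list v) (prod_list w) ^ (2 * L)) \<le>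
    real (card (near_pairs t m)) + a ^ (2 * m) * (1 - t) ^ (2 * L)"
proof -
  let ?W = "words A m"
  let ?N = "{x \<in> ?W \<times> ?W. near t m x}"
  let ?f = "\<lambda>(v, w). qdot (prod_list (map hat v)) (prod_list (map hat w)) ^ (2 * L)"
  have finW: "finite (?W \<times> ?W)" using finite_words[OF finite_A] by simp
  have unit: "qnorm (prod_list (map hat v)) = 1" if "v \<in> ?W" for v
    using unit_word[of "map hat v" m] that by (auto simp: words_image)
  have "(\<Sum>v\<in>words (hat ` A) m. \<Sum>w\<in>words (hat ` A) m. qdot (prod_list v) (prod_list w) ^ (2 * L)) =
      (\<Sum>x\<in>?W \<times> ?W. ?f x)"
    unfolding sum_words_hat by (rule sum.cartesian_product)
  also have "\<dots> \<le> (\<Sum>x\<in>?W \<times> ?W. (if near t m x then 1 else 0) + (1 - t) ^ (2 * L))"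
  proof (intro sum_mono)
    fix x assume "x \<in> ?W \<times> ?W"
    then obtain v w where x: "x = (v, w)" "v \<in> ?W" "w \<in> ?W" by auto
    define c where "c = qdot (prod_list (map hat v)) (prod_list (map hat w))"
    have c1: "\<bar>c\<bar> \<le> 1" unfolding c_def using unit x by (intro qdot_abs_le_1) auto
    have fx: "?f x = \<bar>c\<bar> ^ (2 * L)" by (simp add: x c_def power_mult)
    show "?f x \<le> (if near t m x then 1 else 0) + (1 - t) ^ (2 * L)"
    proof (cases "near t m x")
      case True
      have "\<bar>c\<bar> ^ (2 * L) \<le> 1" using c1 by (intro power_le_one) auto
      moreover have "0 \<le> (1 - t) ^ (2 * L)" using assms by simp
      ultimately have "\<bar>c\<bar> ^ (2 * L) \<le> 1 + (1 - t) ^ (2 * L)" by linarith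
      then show ?thesis unfolding fx using True by simp
    next
      case False
      then have "\<bar>real_of_int (qdot (prod_list v) (prod_list w))\<bar> < (1 - t) * q ^ m"
        by (simp add: near_def x)
      then have "\<bar>c\<bar> \<le> 1 - t"
        unfolding c_def qdot_hat[OF x(2,3)] using p_ge by (simp add: abs_divide divide_le_eq)
      then have "\<bar>c\<bar> ^ (2 * L) \<le> (1 - t) ^ (2 * L)" by (intro power_mono) auto
      with False show ?thesis unfolding fx by simp
    qed
  qed
  also have "\<dots> = real (card ?N) + real (card (?W \<times> ?W)) * (1 - t) ^ (2 * L)"
    using finW by (simp add: sum.distrib sum.If_cases Int_def)
  also have "real (card (?W \<times> ?W)) = a ^ (2 * m)"
    by (simp add: card_cartesian_product card_words[OF finite_A] power_mult power2_eq_square power_mult_distrib)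
  finally show ?thesis .
qed

text \<open>All terms of the Chebyshev expansion of the power sum are nonnegative, so the single
  term \<open>k = n\<close> is bounded by the whole sum.\<close>

lemma energy_le:
  assumes n: "even n" "n \<ge> 2" and t: "0 \<le> t" "t \<le> 1"
  shows "energy n m \<le> 12 * (real n)\<^sup>2 *
    (real (card (near_pairs t m)) + a ^ (2 * m) * (1 - t) ^ (2 * n\<^sup>2))"
proof -
  let ?P = "\<Sum>v\<in>words (hat ` A) m. \<Sum>w\<in>words (hat ` A) m. qdot (prod_list v) (prod_list w) ^ (2 * n\<^sup>2)"
  have "real (ballot (2 * n\<^sup>2) n) * energy n m \<le> (\<Sum>k\<le>2 * n\<^sup>2. real (ballot (2 * n\<^sup>2) k) * energy k m)"
    by (rule member_le_sum) (auto simp: energy_nonneg power2_eq_square)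
  also have "\<dots> = 4 ^ n\<^sup>2 * ?P"
    unfolding power_sum_energy[symmetric] power_mult_distrib by (simp add: sum_distrib_left power_mult)
  finally have 1: "real (ballot (2 * n\<^sup>2) n) * energy n m \<le> 4 ^ n\<^sup>2 * ?P" .
  have "4 ^ n\<^sup>2 / (12 * (real n)\<^sup>2) * energy n m \<le> real (ballot (2 * n\<^sup>2) n) * energy n m"
    by (intro mult_right_mono ballot_lower n energy_nonneg)
  with 1 have "4 ^ n\<^sup>2 / (12 * (real n)\<^sup>2) * energy n m \<le> 4 ^ n\<^sup>2 * ?P" by linarith
  then have "energy n m \<le> 12 * (real n)\<^sup>2 * ?P"
    using n by (simp add: field_simps)
  also have "\<dots> \<le> 12 * (real n)\<^sup>2 *
    (real (card (near_pairs t m)) + a ^ (2 * m) * (1 - t) ^ (2 * n\<^sup>2))"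
    by (intro mult_left_mono power_sum_le t) auto
  finally show ?thesis .
qed

text \<open>Choose \<open>m\<close> with \<open>p ^ m\<close> of size \<open>n ^ 3\<close> and the threshold \<open>t = s\<^sup>2\<close> with \<open>s = n powr (-199 / 200)\<close>. Since
  \<open>card A\<close> is at least \<open>p powr (6 / 7)\<close>, the near pairs contribute about \<open>n powr (-1 / 7)\<close> to \<open>energy_le\<close>.\<close>

lemma energy_decay:
  "\<exists>n0\<ge>3. \<forall>n\<ge>n0. even n \<longrightarrow> (\<exists>m\<ge>1. real m \<le> 1 + 3 * ln (real n) \<and>
     energy n m \<le> a ^ (2 * m) * real n powr (-1 / 20))"
proof -
  \<comment> \<open>\<open>K\<close> runs up to \<open>(q * x ^ 3)\<^sup>2\<close>, which doubles
    the exponent to the \<open>1 / 300\<close> of \<open>decay_error\<close>.\<close>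
  obtain C0 where C0: "C0 > 0" "\<And>K. K > 0 \<Longrightarrow> real (card (circle_points K)) \<le> C0 * real K powr (1 / 600)"
    using circle_points_bound[of "1 / 600"] by auto
  define C where "C = C0 + 1"
  have C: "C > 0" "C \<ge> 1" using C0 by (auto simp: C_def)
  have q3: "q \<ge> 3" using p_ge by simp
  have "eventually (\<lambda>n::nat. decay_error C q (real n) \<le> real n powr (-1 / 20)) sequentially"
    using eventually_compose_filterlim[OF decay_error_asymptotics[OF C(1), of q]
        filterlim_real_sequentially] q3 by simp
  then obtain n1 where n1: "\<And>n::nat. n \<ge> n1 \<Longrightarrow> decay_error C q (real n) \<le> real n powr (-1 / 20)"
    by (auto simp: eventually_sequentially)
  have "\<exists>m\<ge>1. real m \<le> 1 + 3 * ln (real n) \<and> energy n m \<le> a ^ (2 * m) * real n powr (-1 / 20)"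
    if n: "n \<ge> max n1 3" "even n" for n
  proof -
    define x where "x = real n"
    have x: "x \<ge> 3" using n by (simp add: x_def)
    define s where "s = x powr (-199 / 200)"
    have s: "0 < s" "s \<le> 1" using x using powr_mono2'[of "-199 / 200" 1 x] by (auto simp: s_def)
    obtain m0 where m0: "x ^ 3 \<le> q ^ m0"
      using real_arch_pow[of q "x ^ 3"] q3 by (auto intro: less_imp_le)
    \<comment> \<open>The least such power overshoots \<open>x ^ 3\<close> by at most a factor
      \<open>q\<close> and keeps \<open>m\<close> logarithmic in \<open>n\<close>.\<close>
    define m where "m = (LEAST m. x ^ 3 \<le> q ^ m)"
    define R where "R = q ^ m"
    have R1: "x ^ 3 \<le> R" unfolding m_def R_def by (rule LeastI[where P = "\<lambda>m. x ^ 3 \<le> q ^ m", OF m0])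
    have x31: "1 < x ^ 3" using x by (simp add: one_less_power)
    have m1: "m \<ge> 1" using R1 x31 unfolding R_def by (cases m) auto
    have lt: "q ^ (m - 1) < x ^ 3"
      using not_less_Least[of "m - 1" "\<lambda>m. x ^ 3 \<le> q ^ m"] m1 unfolding m_def[symmetric] by auto
    have Rq: "R = q * q ^ (m - 1)" unfolding R_def using m1 by (cases m) auto
    have R2: "R \<le> q * x ^ 3" unfolding Rq using lt q3 by simp
    have Rpos: "R > 0" using R1 x31 by linarith
    have mln: "real m \<le> 1 + 3 * ln x"
    proof -
      have "real (m - 1) * 1 \<le> real (m - 1) * ln q"
      proof (intro mult_left_mono)
        have "exp 1 \<le> q" using exp_le q3 by linarith
        then show "1 \<le> ln q" using q3 by (subst ln_ge_iff) auto
      qed simp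
      also have "\<dots> = ln (q ^ (m - 1))" using q3 by (simp add: ln_realpow)
      also have "\<dots> \<le> ln (x ^ 3)" using lt q3 x by (subst ln_le_cancel_iff) auto
      also have "\<dots> = 3 * ln x" using x by (simp add: ln_realpow)
      finally show ?thesis using m1 by (simp add: of_nat_diff)
    qed
    define D where "D = C * (q * x ^ 3) powr (1 / 300)"
    have D1: "D \<ge> 1"
    proof -
      have "1 \<le> (q * x ^ 3) powr (1 / 300)"
        using R1 R2 x31 by (intro ge_one_powr_ge_zero) auto
      then have "1 * 1 \<le> C * (q * x ^ 3) powr (1 / 300)" using C by (intro mult_mono) auto
      then show ?thesis by (simp add: D_def)
    qed
    have circ: "real (card (circle_points K)) \<le> D" if K: "K > 0" "int K \<le> p ^ (2 * m)" for K
    proof -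
      have "real K = real_of_int (int K)" by simp
      also have "\<dots> \<le> real_of_int (p ^ (2 * m))" using K(2) by (simp only: of_int_le_iff)
      also have "\<dots> = R\<^sup>2" by (simp add: R_def power_even_eq)
      also have "\<dots> \<le> (q * x ^ 3)\<^sup>2" using R2 Rpos by (intro power_mono) auto
      finally have "real K powr (1 / 600) \<le> ((q * x ^ 3)\<^sup>2) powr (1 / 600)"
        by (intro powr_mono2) auto
      also have "\<dots> = (q * x ^ 3) powr (1 / 300)"
        using q3 x by (simp add: powr_powr flip: powr_numeral)
      finally have "C0 * real K powr (1 / 600) \<le> C * (q * x ^ 3) powr (1 / 300)"
        using C0 by (intro mult_mono) (auto simp: C_def)
      with C0(2)[OF K(1)] show ?thesis by (simp add: D_def)
    qed
    define N where "N = real (card (near_pairs (s\<^sup>2) m))"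
    have N: "N \<le> (real m + 1) * D * (6 * s ^ 3 * R\<^sup>2 + 8 * s * R + 2 * a ^ m)"
      unfolding N_def R_def by (rule near_pairs_bound[OF s D1 circ card_A_pos card_A_le])
    have aR: "R powr (6 / 7) \<le> a ^ m"
    proof -
      have "q ^ 6 \<le> a ^ 7"
      proof -
        have "real_of_int (p ^ 6) \<le> real_of_int (int (card A) ^ 7)" using card_A_ge by (simp only: of_int_le_iff)
        then show ?thesis by simp
      qed
      then have "(q ^ 6) powr (1 / 7) \<le> (a ^ 7) powr (1 / 7)" using q3 by (intro powr_mono2) auto
      also have "(a ^ 7) powr (1 / 7) = a" using card_A_pos by (simp add: powr_powr flip: powr_numeral)
      also have "(q ^ 6) powr (1 / 7) = q powr (6 / 7)" using q3 by (simp add: powr_powr flip: powr_numeral)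
      finally have "(q powr (6 / 7)) ^ m \<le> a ^ m" by (intro power_mono) auto
      moreover have "(q powr (6 / 7)) ^ m = R powr (6 / 7)"
        unfolding R_def using q3 by (simp add: powr_powr mult.commute flip: powr_realpow)
      ultimately show ?thesis by simp
    qed
    have apos: "a ^ m > 0" using card_A_pos by simp
    have e1: "R\<^sup>2 / a ^ (2 * m) \<le> (q * x ^ 3) powr (2 / 7)"
    proof -
      have "R\<^sup>2 / a ^ (2 * m) = (R / a ^ m)\<^sup>2" by (simp add: power_divide power_even_eq)
      also have "\<dots> \<le> (R / R powr (6 / 7))\<^sup>2"
        using aR Rpos apos by (intro power_mono divide_left_mono) auto
      also have "\<dots> = R powr (2 / 7)"
      proof -
        have "R / R powr (6 / 7) = R powr (1 / 7)"
          using powr_diff[of R 1 "6 / 7"] Rpos by simp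
        then show ?thesis by (simp add: power2_eq_square flip: powr_add)
      qed
      also have "\<dots> \<le> (q * x ^ 3) powr (2 / 7)" using R2 Rpos by (intro powr_mono2) auto
      finally show ?thesis .
    qed
    have e2: "R / a ^ (2 * m) \<le> (x ^ 3) powr (-5 / 7)"
    proof -
      have "R / a ^ (2 * m) = R / (a ^ m)\<^sup>2" by (simp add: power_even_eq)
      also have "\<dots> \<le> R / (R powr (6 / 7))\<^sup>2"
        using aR Rpos apos by (intro divide_left_mono power_mono) auto
      also have "\<dots> = R powr (-5 / 7)"
      proof -
        have "(R powr (6 / 7))\<^sup>2 = R powr (12 / 7)" by (simp add: power2_eq_square flip: powr_add)
        then show ?thesis using powr_diff[of R 1 "12 / 7"] Rpos by simp
      qed
      also have "\<dots> \<le> (x ^ 3) powr (-5 / 7)" using R1 x31 x by (intro powr_mono2') auto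
      finally show ?thesis .
    qed
    have e3: "a ^ m / a ^ (2 * m) \<le> (x ^ 3) powr (-6 / 7)"
    proof -
      have "a ^ m / a ^ (2 * m) = 1 / a ^ m" using apos by (simp add: power_even_eq power2_eq_square)
      also have "\<dots> \<le> 1 / R powr (6 / 7)"
        using aR Rpos apos by (intro divide_left_mono) auto
      also have "\<dots> = R powr (-6 / 7)" using Rpos by (simp add: powr_minus_divide)
      also have "\<dots> \<le> (x ^ 3) powr (-6 / 7)" using R1 x31 x by (intro powr_mono2') auto
      finally show ?thesis .
    qed
    \<comment> \<open>The exponent \<open>199 / 200\<close> stays below 1 so that
      \<open>x\<^sup>2 * s\<^sup>2 = x powr (1 / 100)\<close> still grows and the far pairs become
      negligible.\<close>
    have e4: "(1 - s\<^sup>2) ^ (2 * n\<^sup>2) \<le> exp (- 2 * x powr (1 / 100))"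
    proof -
      have "(1 - s\<^sup>2) ^ (2 * n\<^sup>2) \<le> exp (- s\<^sup>2) ^ (2 * n\<^sup>2)"
        using s exp_ge_add_one_self[of "- s\<^sup>2"] by (intro power_mono) (auto simp: power_le_one)
      also have "\<dots> = exp (real (2 * n\<^sup>2) * (- s\<^sup>2))" by (rule exp_of_nat_mult[symmetric])
      also have "real (2 * n\<^sup>2) * (- s\<^sup>2) = - 2 * (x\<^sup>2 * s\<^sup>2)" by (simp add: x_def)
      also have "x\<^sup>2 * s\<^sup>2 = x powr 2 * x powr (-199 / 100)"
        using x by (simp add: s_def power2_eq_square flip: powr_add)
      also have "\<dots> = x powr (1 / 100)" by (simp flip: powr_add)
      finally show ?thesis .
    qed
    have "energy n m \<le> 12 * x\<^sup>2 * (N + a ^ (2 * m) * (1 - s\<^sup>2) ^ (2 * n\<^sup>2))"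
      unfolding N_def x_def using n s by (intro energy_le) (auto simp: power_le_one)
    also have "\<dots> = a ^ (2 * m) * (12 * x\<^sup>2 * (N / a ^ (2 * m) + (1 - s\<^sup>2) ^ (2 * n\<^sup>2)))"
      using card_A_pos by (simp add: field_simps)
    also have "\<dots> \<le> a ^ (2 * m) * (12 * x\<^sup>2 * ((2 + 3 * ln x) * D *
        (6 * s ^ 3 * (q * x ^ 3) powr (2 / 7) + 8 * s * (x ^ 3) powr (-5 / 7) + 2 * (x ^ 3) powr (-6 / 7))
        + exp (- 2 * x powr (1 / 100))))"
    proof (intro mult_left_mono add_mono e4)
      have "N / a ^ (2 * m) \<le> (real m + 1) * D * (6 * s ^ 3 * R\<^sup>2 + 8 * s * R + 2 * a ^ m) / a ^ (2 * m)"
        using N by (intro divide_right_mono) auto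
      also have "\<dots> = (real m + 1) * D * (6 * s ^ 3 * (R\<^sup>2 / a ^ (2 * m)) + 8 * s * (R / a ^ (2 * m))
          + 2 * (a ^ m / a ^ (2 * m)))"
        by (simp add: add_divide_distrib distrib_left)
      also have "\<dots> \<le> (2 + 3 * ln x) * D * (6 * s ^ 3 * (q * x ^ 3) powr (2 / 7) + 8 * s * (x ^ 3) powr (-5 / 7)
          + 2 * (x ^ 3) powr (-6 / 7))"
      proof (rule mult_mono)
        show "(real m + 1) * D \<le> (2 + 3 * ln x) * D"
          using mln D1 by (intro mult_right_mono) auto
        show "6 * s ^ 3 * (R\<^sup>2 / a ^ (2 * m)) + 8 * s * (R / a ^ (2 * m)) + 2 * (a ^ m / a ^ (2 * m)) \<le>
          6 * s ^ 3 * (q * x ^ 3) powr (2 / 7) + 8 * s * (x ^ 3) powr (-5 / 7) + 2 * (x ^ 3) powr (-6 / 7)"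
          using s by (intro add_mono mult_left_mono e1 e2 e3) auto
        show "0 \<le> (2 + 3 * ln x) * D" using x D1 by simp
        show "0 \<le> 6 * s ^ 3 * (R\<^sup>2 / a ^ (2 * m)) + 8 * s * (R / a ^ (2 * m)) + 2 * (a ^ m / a ^ (2 * m))"
          using s Rpos by simp
      qed
      finally show "N / a ^ (2 * m) \<le> (2 + 3 * ln x) * D * (6 * s ^ 3 * (q * x ^ 3) powr (2 / 7)
          + 8 * s * (x ^ 3) powr (-5 / 7) + 2 * (x ^ 3) powr (-6 / 7))" .
    qed auto
    also have "\<dots> \<le> a ^ (2 * m) * x powr (-1 / 20)"
      using n1[of n] n unfolding D_def s_def x_def decay_error_def by (intro mult_left_mono) auto
    finally show ?thesis using m1 mln unfolding x_def by blast
  qed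
  then show ?thesis by (meson max.cobounded2)
qed

text \<open>Cut \<open>N\<close> into blocks of the length \<open>m \<le> 4 * ln n\<close> from
  \<open>energy_decay\<close>. Each gains \<open>n powr (-1 / 20)\<close>, a rate of
  \<open>1 / (20 * 4)\<close> per letter, independent of \<open>n\<close>. Three factors
  \<open>n + 1\<close> pay for the empty word, the incomplete last block and the rounding of
  \<open>N / m\<close>.\<close>

lemma energy_bound:
  "\<exists>n0\<ge>3. \<forall>n\<ge>n0. even n \<longrightarrow> (\<forall>N.
     energy n N \<le> a ^ (2 * N) * ((real n + 1) ^ 3 * exp (- real N / 80)))"
proof -
  obtain n0 where n0: "n0 \<ge> 3" "\<And>n. n \<ge> n0 \<Longrightarrow> even n \<Longrightarrow> \<exists>m\<ge>1. real m \<le> 1 + 3 * ln (real n) \<and>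
     energy n m \<le> a ^ (2 * m) * real n powr (-1 / 20)"
    using energy_decay by blast
  have "energy n N \<le> a ^ (2 * N) * ((real n + 1) ^ 3 * exp (- real N / 80))"
    if n: "n \<ge> n0" "even n" for n N
  proof -
    obtain m where m: "m \<ge> 1" "real m \<le> 1 + 3 * ln (real n)" "energy n m \<le> a ^ (2 * m) * real n powr (-1 / 20)"
      using n0(2)[OF n] by blast
    define x where "x = real n"
    have x: "x \<ge> 3" using n n0(1) by (simp add: x_def)
    have "exp 1 \<le> x" using exp_le x by linarith
    then have lnx: "ln x \<ge> 1" using x by (subst ln_ge_iff) auto
    define c where "c = N div m"
    define r where "r = N mod m"
    have N: "N = c * m + r" by (simp add: c_def r_def)
    have "r < m" unfolding r_def using m by simp
    then have "real N \<le> (real c + 1) * real m" unfolding N by (simp add: algebra_simps)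
    also have "\<dots> \<le> (real c + 1) * (4 * ln x)"
      using m(2) lnx by (intro mult_left_mono) (auto simp: x_def)
    also have "\<dots> = 4 * (ln x * real c) + 4 * ln x" by (simp add: algebra_simps)
    finally have Nc: "real N \<le> 4 * (ln x * real c) + 4 * ln x" .
    have "energy n N \<le> energy n (c * m) * energy n r" unfolding N by (rule energy_add)
    also have "\<dots> \<le> (energy n m ^ c * energy n 0) * ((real n + 1) * real (card (hat ` A)) ^ (2 * r))"
      by (intro mult_mono energy_mult energy_trivial energy_nonneg mult_nonneg_nonneg zero_le_power)
    also have "\<dots> \<le> ((a ^ (2 * m) * x powr (-1 / 20)) ^ c * (x + 1)) * ((x + 1) * a ^ (2 * r))"
      using m(3) energy_trivial[of n 0] energy_nonneg
      by (intro mult_mono power_mono) (auto simp: x_def card_hat)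
    also have "\<dots> = a ^ (2 * N) * ((x + 1)\<^sup>2 * (x powr (-1 / 20)) ^ c)"
      unfolding N by (simp add: power_mult_distrib power_mult[symmetric] power_add algebra_simps power2_eq_square)
    also have "(x powr (-1 / 20)) ^ c = exp (- (ln x * real c / 20))"
      using x by (simp add: powr_def flip: exp_of_nat_mult)
    also have "\<dots> \<le> exp (ln x + - real N / 80)"
    proof -
      have "- (ln x * real c / 20) \<le> ln x + - real N / 80" using Nc lnx by linarith
      then show ?thesis by simp
    qed
    also have "\<dots> = x * exp (- real N / 80)" using x by (simp only: exp_add exp_ln)
    also have "a ^ (2 * N) * ((x + 1)\<^sup>2 * (x * exp (- real N / 80))) \<le>
        a ^ (2 * N) * ((x + 1) ^ 3 * exp (- real N / 80))"
      using x by (intro mult_left_mono) (auto simp: power2_eq_square power3_eq_cube intro!: mult_mono)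
    finally show ?thesis using x by (simp add: x_def mult_left_mono mult_right_mono)
  qed
  with n0(1) show ?thesis by blast
qed

text \<open>\<open>L powr (-3 / 2)\<close> is the order of the mean of the \<open>2 * L\<close>-th
  power of the cosine over all unit quaternions, so words mimic Haar measure up to a constant. Low
  degrees have small weight by \<open>ballot_upper\<close>. In the others two factors
  \<open>n + 1\<close> are at most \<open>3 * L\<close>, the third is summed by
  \<open>sum_ballot\<close>, and \<open>280 = 80 * 7 / 2\<close> brings the exponential down to
  \<open>L powr (-7 / 2)\<close>.\<close>

lemma correlation_bound:
  "\<exists>C>0. \<forall>L\<ge>1. \<forall>N h. real N \<ge> 280 * ln (real L) \<longrightarrow> qnorm h = 1 \<longrightarrow>
    pair_sum (hat ` A) N (\<lambda>v w. qdot (v * h) w ^ (2 * L)) \<le>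
      C * real L powr (-3 / 2) * a ^ (2 * N)"
proof -
  obtain n0 where n0: "n0 \<ge> 3" "\<And>n N. n \<ge> n0 \<Longrightarrow> even n \<Longrightarrow>
      energy n N \<le> a ^ (2 * N) * ((real n + 1) ^ 3 * exp (- real N / 80))"
    using energy_bound by blast
  define C where "C = 2 * real n0 * (real n0 + 1)\<^sup>2 + 9"
  have "pair_sum (hat ` A) N (\<lambda>v w. qdot (v * h) w ^ (2 * L)) \<le>
      C * real L powr (-3 / 2) * a ^ (2 * N)"
    if L: "L \<ge> 1" and N: "real N \<ge> 280 * ln (real L)" and h: "qnorm h = 1" for L N h
  proof -
    let ?P = "\<Sum>v\<in>words (hat ` A) N. \<Sum>w\<in>words (hat ` A) N. qdot (prod_list v * h) (prod_list w) ^ (2 * L)"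
    define b where "b = (\<lambda>n. real (ballot (2 * L) n) / 4 ^ L)"
    define l where "l = real L"
    have l: "l \<ge> 1" using L by (simp add: l_def)
    have b0: "b n \<ge> 0" for n by (simp add: b_def)
    have bsum: "(\<Sum>n\<le>2 * L. b n * (real n + 1)) = 1"
      using sum_ballot[of "2 * L"] by (simp add: b_def power_mult flip: sum_divide_distrib)
    have ex: "exp (- real N / 80) \<le> l powr (-7 / 2)"
      using N l by (simp add: powr_def l_def)
    have "4 ^ L * ?P = pair_sum (hat ` A) N (\<lambda>v w. (2 * qdot (v * h) w) ^ (2 * L))"
      by (simp add: power_mult_distrib sum_distrib_left power_mult)
    also have "\<dots> \<le> (\<Sum>n\<le>2 * L. real (ballot (2 * L) n) * energy n N)"
      by (rule power_sum_shift_energy[OF h])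
    finally have "?P \<le> (\<Sum>n\<le>2 * L. real (ballot (2 * L) n) * energy n N) / 4 ^ L"
      by (simp add: le_divide_eq mult.commute)
    also have "\<dots> = (\<Sum>n\<le>2 * L. b n * energy n N)"
      by (simp add: sum_divide_distrib b_def)
    also have "\<dots> \<le> (\<Sum>n\<le>2 * L. (if n < n0 then 2 * (real n0 + 1)\<^sup>2 * l powr (-3 / 2) * a ^ (2 * N) else 0)
        + b n * (real n + 1) * (9 * l powr (-3 / 2) * a ^ (2 * N)))"
    proof (intro sum_mono)
      fix n assume n: "n \<in> {..2 * L}"
      show "b n * energy n N \<le> (if n < n0 then 2 * (real n0 + 1)\<^sup>2 * l powr (-3 / 2) * a ^ (2 * N) else 0)
        + b n * (real n + 1) * (9 * l powr (-3 / 2) * a ^ (2 * N))"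
      proof (cases "n < n0")
        case True
        have "b n \<le> 2 * (real n + 1) / ((2 * l + 1) * sqrt (2 * l + 1))"
          unfolding b_def l_def by (rule ballot_upper)
        also have "\<dots> \<le> 2 * (real n + 1) / (l * sqrt l)"
          using l by (intro divide_left_mono mult_mono) auto
        also have "l * sqrt l = l powr (3 / 2)"
          using l by (simp add: powr_half_sqrt[symmetric] powr_mult_base)
        also have "2 * (real n + 1) / l powr (3 / 2) = 2 * (real n + 1) * l powr (-3 / 2)"
          by (simp add: powr_minus_divide)
        finally have "b n * energy n N \<le> (2 * (real n + 1) * l powr (-3 / 2)) * ((real n + 1) * a ^ (2 * N))"
          using energy_trivial[of n N] by (intro mult_mono energy_nonneg) (auto simp: card_hat)
        also have "\<dots> = 2 * (real n + 1)\<^sup>2 * (l powr (-3 / 2) * a ^ (2 * N))"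
          by (simp add: power2_eq_square)
        also have "\<dots> \<le> 2 * (real n0 + 1)\<^sup>2 * (l powr (-3 / 2) * a ^ (2 * N))"
          using True by (intro mult_right_mono mult_left_mono power_mono) auto
        finally have "b n * energy n N \<le> 2 * (real n0 + 1)\<^sup>2 * (l powr (-3 / 2) * a ^ (2 * N))" .
        moreover have "0 \<le> b n * (real n + 1) * (9 * l powr (-3 / 2) * a ^ (2 * N))"
          using b0 by simp
        ultimately show ?thesis using True by (simp only: mult.assoc if_True)
      next
        case False
        show ?thesis
        proof (cases "even n")
          case True
          have "energy n N \<le> a ^ (2 * N) * ((real n + 1) ^ 3 * exp (- real N / 80))"
            using n0(2)[of n N] False True by simp
          also have "\<dots> \<le> a ^ (2 * N) * (((real n + 1) * (3 * l)\<^sup>2) * l powr (-7 / 2))"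
          proof (intro mult_left_mono mult_mono ex)
            have "(real n + 1) * (real n + 1)\<^sup>2 \<le> (real n + 1) * (3 * l)\<^sup>2"
              using n l by (intro mult_left_mono power_mono) (auto simp: l_def)
            then show "(real n + 1) ^ 3 \<le> (real n + 1) * (3 * l)\<^sup>2"
              by (simp add: power3_eq_cube power2_eq_square mult.assoc)
          qed auto
          also have "\<dots> = (real n + 1) * (9 * (l powr 2 * l powr (-7 / 2)) * a ^ (2 * N))"
            using l by (simp add: power_mult_distrib)
          also have "l powr 2 * l powr (-7 / 2) = l powr (-3 / 2)"
            by (simp flip: powr_add)
          finally have "b n * energy n N \<le> b n * ((real n + 1) * (9 * l powr (-3 / 2) * a ^ (2 * N)))"
            by (intro mult_left_mono b0)
          then show ?thesis using False by (simp add: mult.assoc)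
        next
          case odd: False
          then have "b n = 0" using ballot_odd[of "2 * L" n] by (simp add: b_def)
          then show ?thesis using False by simp
        qed
      qed
    qed
    also have "\<dots> = (\<Sum>n\<le>2 * L. (if n < n0 then 2 * (real n0 + 1)\<^sup>2 * l powr (-3 / 2) * a ^ (2 * N) else 0)) +
        9 * l powr (-3 / 2) * a ^ (2 * N)"
      by (simp add: sum.distrib bsum flip: sum_distrib_right)
    also have "(\<Sum>n\<le>2 * L. (if n < n0 then 2 * (real n0 + 1)\<^sup>2 * l powr (-3 / 2) * a ^ (2 * N) else 0)) \<le>
        (\<Sum>n<n0. 2 * (real n0 + 1)\<^sup>2 * l powr (-3 / 2) * a ^ (2 * N))"
    proof -
      have "card ({..2 * L} \<inter> {x. x < n0}) \<le> card {..<n0}" by (intro card_mono) auto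
      then show ?thesis by (subst sum.If_cases) (auto intro!: mult_right_mono)
    qed
    also have "\<dots> = 2 * real n0 * (real n0 + 1)\<^sup>2 * l powr (-3 / 2) * a ^ (2 * N)"
      by simp
    finally show ?thesis by (simp add: C_def l_def algebra_simps)
  qed
  moreover have "C > 0" by (simp add: C_def add_nonneg_pos)
  ultimately show ?thesis by blast
qed

end

theorem expanding_unit_quats:
  obtains S :: "real quat set" and C K :: real
  where "finite S" "S \<noteq> {}" "\<And>s. s \<in> S \<Longrightarrow> qnorm s = 1" "C > 0" "K > 0"
    "\<And>L N h. L \<ge> 1 \<Longrightarrow> real N \<ge> K * ln (real L) \<Longrightarrow> qnorm h = 1 \<Longrightarrow>
      pair_sum S N (\<lambda>v w. qdot (v * h) w ^ (2 * L)) \<le>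
        C * real L powr (-3 / 2) * real (card S) ^ (2 * N)"
proof -
  interpret d: dense_prime_quats 149 letters
    by unfold_locales (simp_all add: card_letters)
  obtain C where C: "C > 0" "\<And>L N h. L \<ge> 1 \<Longrightarrow> real N \<ge> 280 * ln (real L) \<Longrightarrow> qnorm h = 1 \<Longrightarrow>
    pair_sum (d.hat ` letters) N (\<lambda>v w. qdot (v * h) w ^ (2 * L)) \<le>
      C * real L powr (-3 / 2) * real (card letters) ^ (2 * N)"
    using d.correlation_bound by blast
  show ?thesis
    by (rule that[of "d.hat ` letters" C 280])
      (use C d.finite_S d.S_ne d.unit_S in \<open>auto simp: d.card_hat\<close>)
qed

section \<open>Collisions of words acting on the two-sphere\<close>

section \<open>Close pairs on the two-sphere\<close>

locale expanding_quats = unit_quats +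
  fixes C K :: real
  assumes C_pos: "C > 0" and K_pos: "K > 0"
    and correlation: "\<lbrakk>L \<ge> 1; real N \<ge> K * ln (real L); qnorm h = 1\<rbrakk> \<Longrightarrow>
      pair_sum S N (\<lambda>v w. qdot (v * h) w ^ (2 * L)) \<le>
        C * real L powr (-3 / 2) * real (card S) ^ (2 * N)"

text \<open>\<open>a * cos t + c * sin t\<close> is \<open>sqrt (a\<^sup>2 + c\<^sup>2)\<close>
  times the cosine of the distance from \<open>t\<close> to a fixed angle. The grid has a point
  within \<open>2 * pi / J\<close> of that angle, and
  \<open>cos u \<ge> 1 - u\<^sup>2 / 2\<close>.\<close>

lemma close_to_grid_angle:
  fixes a c :: real and J :: nat
  assumes J: "J > 0"
  shows "\<exists>i<J. a * cos (2 * pi * real i / real J) + c * sin (2 * pi * real i / real J) \<ge>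
    sqrt (a\<^sup>2 + c\<^sup>2) * (1 - 2 * pi\<^sup>2 / (real J)\<^sup>2)"
proof -
  define \<rho> where "\<rho> = sqrt (a\<^sup>2 + c\<^sup>2)"
  obtain \<theta> where \<theta>: "0 \<le> \<theta>" "\<theta> < 2 * pi" "a = \<rho> * cos \<theta>" "c = \<rho> * sin \<theta>"
  proof (cases "\<rho> = 0")
    case True
    then have "a = 0" "c = 0" by (auto simp: \<rho>_def sum_power2_eq_zero_iff)
    with True that[of 0] show ?thesis by simp
  next
    case False
    then have "(a / \<rho>)\<^sup>2 + (c / \<rho>)\<^sup>2 = 1"
      by (simp add: \<rho>_def power_divide add_divide_distrib[symmetric])
    then obtain t where "0 \<le> t" "t < 2 * pi" "a / \<rho> = cos t" "c / \<rho> = sin t"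
      using sincos_total_2pi by metis
    with False that[of t] show ?thesis by (simp add: field_simps)
  qed
  define u where "u = \<theta> * real J / (2 * pi)"
  define i where "i = nat \<lfloor>u\<rfloor>"
  have u: "0 \<le> u" "u < real J" using \<theta> J by (simp_all add: u_def field_simps)
  have i: "real i \<le> u" "u < real i + 1" "i < J" using u unfolding i_def by linarith+
  define \<phi> where "\<phi> = 2 * pi * real i / real J"
  have th: "\<theta> = 2 * pi * u / real J" using J by (simp add: u_def)
  have "\<theta> - \<phi> = 2 * pi * (u - real i) / real J"
    by (simp add: th \<phi>_def diff_divide_distrib right_diff_distrib)
  moreover have "0 \<le> 2 * pi * (u - real i) / real J" using i by simp
  moreover have "2 * pi * (u - real i) / real J \<le> 2 * pi / real J"
    using i J by (intro divide_right_mono) auto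
  ultimately have d: "0 \<le> \<theta> - \<phi>" "\<theta> - \<phi> \<le> 2 * pi / real J" by simp_all
  have "(\<theta> - \<phi>)\<^sup>2 \<le> (2 * pi / real J)\<^sup>2" using d by (intro power_mono) auto
  then have "1 - 2 * pi\<^sup>2 / (real J)\<^sup>2 \<le> 1 - (\<theta> - \<phi>)\<^sup>2 / 2"
    by (simp add: power_divide power_mult_distrib)
  also have "\<dots> \<le> cos (\<theta> - \<phi>)"
  proof -
    have "\<bar>sin ((\<theta> - \<phi>) / 2)\<bar> \<le> \<bar>(\<theta> - \<phi>) / 2\<bar>" by (rule abs_sin_x_le_abs_x)
    then have "(sin ((\<theta> - \<phi>) / 2))\<^sup>2 \<le> ((\<theta> - \<phi>) / 2)\<^sup>2" by (simp only: abs_le_square_iff)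
    moreover have "cos (\<theta> - \<phi>) = 1 - 2 * (sin ((\<theta> - \<phi>) / 2))\<^sup>2"
    proof -
      have "\<theta> - \<phi> = 2 * ((\<theta> - \<phi>) / 2)" by simp
      then show ?thesis using cos_double_sin by metis
    qed
    ultimately show ?thesis by (simp add: power_divide)
  qed
  finally have "\<rho> * (1 - 2 * pi\<^sup>2 / (real J)\<^sup>2) \<le> \<rho> * cos (\<theta> - \<phi>)"
    by (intro mult_left_mono) (auto simp: \<rho>_def)
  also have "\<dots> = a * cos \<phi> + c * sin \<phi>"
    by (simp add: \<theta>(3,4) cos_diff algebra_simps)
  finally show ?thesis using i(3) unfolding \<phi>_def \<rho>_def by blast
qed

definition qrot :: "real quat \<Rightarrow> real quat \<Rightarrow> real quat" where
  "qrot g v = g * v * qcnj g"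

text \<open>For an imaginary unit \<open>v\<close> these quaternions form the stabilizer of
  \<open>v\<close> under \<open>qrot\<close>; \<open>qaxis v t\<close> rotates about
  \<open>v\<close> by the angle \<open>2 * t\<close>.\<close>

definition qaxis :: "real quat \<Rightarrow> real \<Rightarrow> real quat" where
  "qaxis v t = Quat (cos t) (sin t * q1 v) (sin t * q2 v) (sin t * q3 v)"

lemma qnorm_qaxis: "q0 v = 0 \<Longrightarrow> qnorm v = 1 \<Longrightarrow> qnorm (qaxis v t) = 1"
proof -
  assume v: "q0 v = 0" "qnorm v = 1"
  have "qnorm (qaxis v t) = cos t * cos t + sin t * sin t * (qnorm v)"
    by (simp add: qdot_def qaxis_def v(1) algebra_simps)
  then show ?thesis using v by (simp flip: power2_eq_square)
qed

text \<open>Multiplying by \<open>qcnj g\<close> and \<open>g'\<close> is isometric and turns the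
  difference into the commutator of \<open>v\<close> and \<open>r\<close>, which has twice the
  length of the part of \<open>r\<close> orthogonal to 1 and \<open>v\<close>.\<close>

lemma qnorm_qrot_diff:
  assumes g: "qnorm g = 1" "qnorm g' = 1" and v: "q0 v = 0" "qnorm v = 1"
  defines "r \<equiv> qcnj g * g'"
  shows "qnorm (qrot g v - qrot g' v) = 4 * (1 - (q0 r)\<^sup>2 - (qdot r v)\<^sup>2)"
proof -
  have r1: "qnorm r = 1" using g by (simp add: r_def qnorm_mult)
  have gg: "qcnj g * g = 1" "qcnj g' * g' = 1"
    using g qcnj_mult_self[of g] qcnj_mult_self[of g'] by (simp_all add: qscale_def one_quat_def)
  have "qcnj g * (qrot g v - qrot g' v) * g' = v * r - r * v"
    unfolding qrot_def r_def right_diff_distrib left_diff_distrib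
    by (simp add: mult.assoc gg(2)) (simp add: mult.assoc[symmetric] gg(1))
  then have "qnorm (v * r - r * v) = qnorm (qcnj g * (qrot g v - qrot g' v) * g')" by simp
  also have "\<dots> = qnorm (qrot g v - qrot g' v)" using g by (simp add: qnorm_mult)
  finally have "qnorm (qrot g v - qrot g' v) = qnorm (v * r - r * v)" ..
  also have "\<dots> = 4 * ((qnorm r - (q0 r)\<^sup>2) * qnorm v - (qdot r v)\<^sup>2)"
    using v(1) by (simp add: quat_simps power2_eq_square algebra_simps)
  finally show ?thesis using r1 v(2) by simp
qed

context expanding_quats
begin

text \<open>A rotation that moves the unit vector \<open>v\<close> by at most \<open>\<delta>\<close> is within \<open>O(\<delta>)\<close> of a rotation about \<open>v\<close>,
  and \<open>O(1 / \<delta>)\<close> equally spaced angles suffice for those.\<close>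

lemma near_stabilizer:
  assumes g: "qnorm g = 1" "qnorm g' = 1" and v: "q0 v = 0" "qnorm v = 1"
    and \<delta>: "0 < \<delta>" "\<delta> < 1" and close: "qnorm (qrot g v - qrot g' v) \<le> \<delta>\<^sup>2"
    and J: "real J \<ge> 7 / \<delta>" 
  shows "\<exists>i<J. qdot (g * qaxis v (2 * pi * real i / real J)) g' \<ge> 1 - \<delta>\<^sup>2"
proof -
  define r where "r = qcnj g * g'"
  define a where "a = q0 r"
  define c where "c = qdot r v"
  have e: "qnorm (qrot g v - qrot g' v) = 4 * (1 - a\<^sup>2 - c\<^sup>2)"
    unfolding a_def c_def r_def by (rule qnorm_qrot_diff[OF g v])
  have low: "a\<^sup>2 + c\<^sup>2 \<ge> 1 - \<delta>\<^sup>2 / 4" using close e by simp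
  have "qnorm (qrot g v - qrot g' v) \<ge> 0" by (simp add: qdot_def)
  then have high: "a\<^sup>2 + c\<^sup>2 \<le> 1" using e by simp
  have "7 / \<delta> > 0" using \<delta> by simp
  then have J0: "real J > 0" using J by linarith
  obtain i where i: "i < J" "a * cos (2 * pi * real i / real J) + c * sin (2 * pi * real i / real J) \<ge>
    sqrt (a\<^sup>2 + c\<^sup>2) * (1 - 2 * pi\<^sup>2 / (real J)\<^sup>2)"
    using close_to_grid_angle[of J a c] J0 by auto
  define t where "t = 2 * pi * real i / real J"
  have "qdot (g * qaxis v t) g' = qdot (qaxis v t) r"
  proof -
    have "qdot (g * qaxis v t) g' = qdot (qcnj g * (g * qaxis v t)) (qcnj g * g')"
      using g by (simp add: qdot_mult_left)
    also have "qcnj g * (g * qaxis v t) = qaxis v t"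
      using g qcnj_mult_self[of g] by (simp add: mult.assoc[symmetric]) (simp add: qscale_def one_quat_def quat_defs)
    finally show ?thesis by (simp add: r_def)
  qed
  also have "\<dots> = a * cos t + c * sin t"
    using v(1) by (simp add: qdot_def qaxis_def a_def c_def algebra_simps)
  finally have q: "qdot (g * qaxis v t) g' = a * cos t + c * sin t" .
  define e2 where "e2 = 2 * pi\<^sup>2 / (real J)\<^sup>2"
  have pi10: "pi\<^sup>2 \<le> 10"
  proof -
    have "pi \<le> 3.15" using pi_approx by simp
    then have "pi\<^sup>2 \<le> 3.15\<^sup>2" by (intro power_mono) auto
    then show ?thesis by (simp add: power2_eq_square)
  qed
  \<comment> \<open>The number 7 comes from here:
    \<open>2 * pi\<^sup>2 \<le> 20 < 49 / 2\<close>.\<close>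
  have e2: "e2 \<le> \<delta>\<^sup>2 / 2"
  proof -
    have "e2 \<le> 2 * 10 / (7 / \<delta>)\<^sup>2"
      unfolding e2_def using J \<delta> pi10 J0 by (intro frac_le mult_left_mono power_mono) auto
    also have "\<dots> = 20 / 49 * \<delta>\<^sup>2" using \<delta> by (simp add: power_divide)
    also have "\<dots> \<le> \<delta>\<^sup>2 / 2" by simp
    finally show ?thesis .
  qed
  have e20: "e2 \<ge> 0" by (simp add: e2_def)
  have d1: "\<delta>\<^sup>2 < 1" using \<delta> by (simp add: power_less_one_iff)
  have "a\<^sup>2 + c\<^sup>2 \<le> sqrt (a\<^sup>2 + c\<^sup>2)"
    by (rule real_le_rsqrt) (use high in \<open>simp add: power2_eq_square mult_left_le\<close>)
  then have "1 - \<delta>\<^sup>2 / 4 \<le> sqrt (a\<^sup>2 + c\<^sup>2)" using low by linarith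
  then have "(1 - \<delta>\<^sup>2 / 4) * (1 - e2) \<le> sqrt (a\<^sup>2 + c\<^sup>2) * (1 - e2)"
    using e2 d1 by (intro mult_right_mono) auto
  moreover have "1 - \<delta>\<^sup>2 \<le> (1 - \<delta>\<^sup>2 / 4) * (1 - e2)"
  proof -
    have "(1 - x) * (1 - e2) = 1 - x - e2 + x * e2" for x by (simp add: algebra_simps)
    then have "(1 - \<delta>\<^sup>2 / 4) * (1 - e2) = 1 - \<delta>\<^sup>2 / 4 - e2 + \<delta>\<^sup>2 / 4 * e2" .
    moreover have "\<delta>\<^sup>2 / 4 * e2 \<ge> 0" using e20 by simp
    ultimately show ?thesis using e2 zero_le_power2[of \<delta>] by linarith
  qed
  moreover have "sqrt (a\<^sup>2 + c\<^sup>2) * (1 - e2) \<le> qdot (g * qaxis v t) g'"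
    using i(2) unfolding q by (simp only: e2_def t_def)
  ultimately have "1 - \<delta>\<^sup>2 \<le> qdot (g * qaxis v t) g'" by linarith
  with i(1) show ?thesis unfolding t_def by blast
qed

definition close_pairs :: "nat \<Rightarrow> real quat \<Rightarrow> real \<Rightarrow> (real quat list \<times> real quat list) set" where
  "close_pairs N v \<delta> = {(w, w') \<in> words S N \<times> words S N.
     qnorm (qrot (prod_list w) v - qrot (prod_list w') v) \<le> \<delta>\<^sup>2}"

text \<open>The \<open>2 * L\<close>-th power with \<open>L\<close> about
  \<open>1 / (4 * \<delta>\<^sup>2)\<close> majorizes, up to a factor 2, closeness at scale
  \<open>\<delta>\<close> on the group, and \<open>near_stabilizer\<close> reduces closeness on the
  sphere to \<open>O(1 / \<delta>)\<close> shifts. Each shift has proportion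
  \<open>L powr (-3 / 2)\<close>, of order \<open>\<delta> ^ 3\<close>; together they leave
  \<open>\<delta>\<^sup>2\<close>, the area of a disc.\<close>

lemma card_close_pairs:
  assumes v: "q0 v = 0" "qnorm v = 1" and \<delta>: "0 < \<delta>" and N: "real N \<ge> 2 * K * ln (1 / \<delta>)"
  shows "real (card (close_pairs N v \<delta>)) \<le> (16 * 8 powr (3 / 2) * C + 4) * \<delta>\<^sup>2 * real (card S) ^ (2 * N)"
proof (cases "\<delta> \<le> 1 / 2")
  \<comment> \<open>For \<open>\<delta> > 1 / 2\<close> the summand 4 of the constant makes the
    bound trivial.\<close>
  case False
  have "card (close_pairs N v \<delta>) \<le> card (words S N \<times> words S N)"
    unfolding close_pairs_def using finite_words[OF finite_S] by (intro card_mono) auto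
  also have "\<dots> = card S ^ (2 * N)"
    by (simp add: card_cartesian_product card_words[OF finite_S] power_mult power2_eq_square power_mult_distrib)
  finally have "real (card (close_pairs N v \<delta>)) \<le> real (card S ^ (2 * N))" by (rule of_nat_mono)
  also have "\<dots> = 1 * real (card S) ^ (2 * N)" by simp
  also have "\<dots> \<le> (16 * 8 powr (3 / 2) * C + 4) * \<delta>\<^sup>2 * real (card S) ^ (2 * N)"
  proof (intro mult_right_mono)
    have "(1 / 2)\<^sup>2 \<le> \<delta>\<^sup>2" using False by (intro power_mono) auto
    then have "4 * (1 / 4) \<le> (16 * 8 powr (3 / 2) * C + 4) * \<delta>\<^sup>2"
      using C_pos by (intro mult_mono) (auto simp: power2_eq_square)
    then show "1 \<le> (16 * 8 powr (3 / 2) * C + 4) * \<delta>\<^sup>2" by simp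
  qed simp
  finally show ?thesis .
next
  case True
  define J where "J = nat \<lceil>7 / \<delta>\<rceil>"
  \<comment> \<open>Small enough for Bernoulli's inequality to keep
    \<open>(1 - \<delta>\<^sup>2) ^ (2 * L)\<close> at least \<open>1 / 2\<close>.\<close>
  define L where "L = nat \<lfloor>1 / (4 * \<delta>\<^sup>2)\<rfloor>"
  have J: "real J \<ge> 7 / \<delta>" "real J \<le> 8 / \<delta>"
  proof -
    show "real J \<ge> 7 / \<delta>" unfolding J_def by linarith
    have "real J \<le> 7 / \<delta> + 1" unfolding J_def using \<delta> by (simp add: of_nat_nat)
    also have "\<dots> \<le> 8 / \<delta>" using True \<delta> by (simp add: field_simps)
    finally show "real J \<le> 8 / \<delta>" .
  qed
  have \<delta>1: "\<delta> < 1" using True by simp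
  have d2: "\<delta>\<^sup>2 \<le> 1 / 4" using power_mono[OF True, of 2] \<delta> by (simp add: power2_eq_square)
  have d20: "\<delta>\<^sup>2 > 0" using \<delta> by simp
  have q1: "1 / (4 * \<delta>\<^sup>2) \<ge> 1" using d2 d20 by (simp add: le_divide_eq)
  have L: "L \<ge> 1" "real L \<le> 1 / (4 * \<delta>\<^sup>2)" "real L \<ge> 1 / (8 * \<delta>\<^sup>2)"
  proof -
    show "L \<ge> 1" unfolding L_def using q1 by linarith
    show "real L \<le> 1 / (4 * \<delta>\<^sup>2)" unfolding L_def using q1 by (simp add: of_nat_nat)
    have "real L > 1 / (4 * \<delta>\<^sup>2) - 1" unfolding L_def using q1 by linarith
    moreover have "1 / (4 * \<delta>\<^sup>2) = 2 * (1 / (8 * \<delta>\<^sup>2))" by simp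
    moreover have "real L \<ge> 1" using \<open>L \<ge> 1\<close> by simp
    ultimately show "real L \<ge> 1 / (8 * \<delta>\<^sup>2)" by linarith
  qed
  have NL: "real N \<ge> K * ln (real L)"
  proof -
    have "real L \<le> (1 / \<delta>)\<^sup>2"
      using L(2) \<delta> by (rule_tac order_trans[OF L(2)]) (simp add: power_divide frac_le)
    then have "ln (real L) \<le> ln ((1 / \<delta>)\<^sup>2)" using L(1) \<delta> by (subst ln_le_cancel_iff) auto
    also have "\<dots> = 2 * ln (1 / \<delta>)" using \<delta> by (simp add: ln_realpow)
    finally have "K * ln (real L) \<le> K * (2 * ln (1 / \<delta>))" using K_pos by (intro mult_left_mono) auto
    with N show ?thesis by simp
  qed
  define h where "h = (\<lambda>i. qaxis v (2 * pi * real i / real J))"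
  have h1: "qnorm (h i) = 1" for i unfolding h_def by (rule qnorm_qaxis[OF v])
  let ?W = "words S N"
  have half: "1 / 2 \<le> (1 - \<delta>\<^sup>2) ^ (2 * L)"
  proof -
    have "1 + real (2 * L) * (- \<delta>\<^sup>2) \<le> (1 + - \<delta>\<^sup>2) ^ (2 * L)"
      using d2 by (intro Bernoulli_inequality) auto
    moreover have "real L * \<delta>\<^sup>2 \<le> 1 / 4"
      using mult_right_mono[OF L(2), of "\<delta>\<^sup>2"] d20 by simp
    ultimately show ?thesis by simp
  qed
  have ind: "(if (w, w') \<in> close_pairs N v \<delta> then 1 else 0) \<le>
      2 * (\<Sum>i<J. qdot (prod_list w * h i) (prod_list w') ^ (2 * L))" if "w \<in> ?W" "w' \<in> ?W" for w w'
  proof (cases "(w, w') \<in> close_pairs N v \<delta>")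
    case in_pairs: True
    then have "qnorm (qrot (prod_list w) v - qrot (prod_list w') v) \<le> \<delta>\<^sup>2" by (simp add: close_pairs_def)
    from near_stabilizer[OF unit_word[OF that(1)] unit_word[OF that(2)] v \<delta> \<delta>1 this J(1)]
    obtain i where i: "i < J" "qdot (prod_list w * h i) (prod_list w') \<ge> 1 - \<delta>\<^sup>2"
      unfolding h_def by blast
    have "1 / 2 \<le> (1 - \<delta>\<^sup>2) ^ (2 * L)" by (rule half)
    also have "\<dots> \<le> qdot (prod_list w * h i) (prod_list w') ^ (2 * L)"
      using i(2) d2 by (intro power_mono) auto
    also have "\<dots> \<le> (\<Sum>i<J. qdot (prod_list w * h i) (prod_list w') ^ (2 * L))"
      using i(1) by (intro member_le_sum) (auto simp: power_mult)
    finally show ?thesis using in_pairs by simp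
  next
    case False
    then show ?thesis by (simp add: sum_nonneg power_mult)
  qed
  have "real (card (close_pairs N v \<delta>)) = (\<Sum>x\<in>?W \<times> ?W. if x \<in> close_pairs N v \<delta> then 1 else 0)"
  proof -
    have "close_pairs N v \<delta> = (?W \<times> ?W) \<inter> close_pairs N v \<delta>" by (auto simp: close_pairs_def)
    then show ?thesis using finite_words[OF finite_S, of N] by (simp add: sum.If_cases)
  qed
  also have "\<dots> = (\<Sum>w\<in>?W. \<Sum>w'\<in>?W. if (w, w') \<in> close_pairs N v \<delta> then 1 else 0)"
    by (simp add: sum.cartesian_product case_prod_unfold)
  also have "\<dots> \<le> (\<Sum>w\<in>?W. \<Sum>w'\<in>?W. 2 * (\<Sum>i<J. qdot (prod_list w * h i) (prod_list w') ^ (2 * L)))"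
    by (intro sum_mono ind)
  also have "\<dots> = 2 * (\<Sum>w\<in>?W. \<Sum>w'\<in>?W. \<Sum>i<J. qdot (prod_list w * h i) (prod_list w') ^ (2 * L))"
    by (simp add: sum_distrib_left)
  also have "(\<Sum>w\<in>?W. \<Sum>w'\<in>?W. \<Sum>i<J. qdot (prod_list w * h i) (prod_list w') ^ (2 * L)) =
      (\<Sum>w\<in>?W. \<Sum>i<J. \<Sum>w'\<in>?W. qdot (prod_list w * h i) (prod_list w') ^ (2 * L))"
    by (intro sum.cong refl sum.swap)
  also have "\<dots> = (\<Sum>i<J. \<Sum>w\<in>?W. \<Sum>w'\<in>?W. qdot (prod_list w * h i) (prod_list w') ^ (2 * L))"
    by (rule sum.swap)
  also have "\<dots> \<le> (\<Sum>i<J. C * real L powr (-3 / 2) * real (card S) ^ (2 * N))"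
    by (intro sum_mono correlation L(1) NL h1)
  also have "\<dots> = real J * (C * real L powr (-3 / 2)) * real (card S) ^ (2 * N)" by simp
  also have "2 * \<dots> \<le> 2 * ((8 / \<delta>) * (C * (8 powr (3 / 2) * \<delta> ^ 3)) * real (card S) ^ (2 * N))"
  proof (intro mult_left_mono mult_right_mono mult_mono J(2))
    have "real L powr (-3 / 2) \<le> (1 / (8 * \<delta>\<^sup>2)) powr (-3 / 2)"
      using L(3) d20 by (intro powr_mono2') auto
    also have "\<dots> = (8 * \<delta>\<^sup>2) powr (3 / 2)"
      using d20 by (simp add: powr_minus_divide powr_divide)
    also have "\<dots> = 8 powr (3 / 2) * (\<delta>\<^sup>2) powr (3 / 2)" using d20 by (simp add: powr_mult)
    also have "(\<delta>\<^sup>2) powr (3 / 2) = \<delta> ^ 3"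
      using \<delta> by (simp add: powr_powr flip: powr_numeral)
    finally show "real L powr (-3 / 2) \<le> 8 powr (3 / 2) * \<delta> ^ 3" .
  qed (use C_pos \<delta> in auto)
  also have "\<dots> = (16 * 8 powr (3 / 2) * C) * \<delta>\<^sup>2 * real (card S) ^ (2 * N)"
    using \<delta> by (simp add: power2_eq_square power3_eq_cube)
  also have "\<dots> \<le> (16 * 8 powr (3 / 2) * C + 4) * \<delta>\<^sup>2 * real (card S) ^ (2 * N)"
    by (intro mult_right_mono) auto
  finally show ?thesis by simp
qed

end

section \<open>Mesh cells and elementary counting\<close>

section \<open>Mesh cells\<close>

definition cell :: "real \<Rightarrow> real^'n \<Rightarrow> 'n \<Rightarrow> int" where
  "cell \<delta> x = (\<lambda>i. \<lfloor>x $ i / \<delta>\<rfloor>)"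

lemma mesh_count_eq_card_cells:
  assumes "\<delta> > 0"
  shows "mesh_count \<delta> E = card (cell \<delta> ` E)"
proof -
  have "\<delta> * of_int k \<le> t \<and> t < \<delta> * (of_int k + 1) \<longleftrightarrow> k = \<lfloor>t / \<delta>\<rfloor>" for k :: int and t
    using assms by (subst eq_commute) (simp add: floor_eq_iff field_simps)
  then have "{m. \<exists>x\<in>E. \<forall>i. \<delta> * of_int (m i) \<le> x $ i \<and> x $ i < \<delta> * (of_int (m i) + 1)} = cell \<delta> ` E"
    by (auto simp: cell_def fun_eq_iff image_iff)
  then show ?thesis by (simp add: mesh_count_def)
qed

lemma cell_eq_imp_close:
  assumes "\<delta> > 0" "cell \<delta> x i = cell \<delta> y i"
  shows "\<bar>x $ i - y $ i\<bar> \<le> \<delta>"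
proof -
  have "\<bar>x $ i / \<delta> - y $ i / \<delta>\<bar> \<le> 1"
    using assms(2) unfolding cell_def by linarith
  then have "\<bar>(x $ i - y $ i) / \<delta>\<bar> \<le> 1" by (simp add: diff_divide_distrib)
  then show ?thesis using assms(1) by (simp add: abs_divide divide_le_eq)
qed

text \<open>A half-open interval of length \<open>\<delta>\<close> meets at most two mesh intervals
  of length \<open>\<delta>'\<close>, so a fine cell and one bit per coordinate determine the coarse
  cell.\<close>

lemma card_cells_coarser:
  fixes E :: "(real^'n) set"
  assumes "0 < \<delta>" "\<delta> \<le> \<delta>'" "finite E"
  shows "card (cell \<delta>' ` E) \<le> 2 ^ CARD('n) * card (cell \<delta> ` E)"
proof -
  define F where "F = (\<lambda>m::'n \<Rightarrow> int. (\<lambda>B i. \<lfloor>\<delta> * of_int (m i) / \<delta>'\<rfloor> + (if i \<in> B then 1 else 0)) ` (UNIV :: 'n set set))"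
  have "cell \<delta>' ` E \<subseteq> (\<Union>m\<in>cell \<delta> ` E. F m)"
  proof
    fix m' assume "m' \<in> cell \<delta>' ` E"
    then obtain x where x: "x \<in> E" "m' = cell \<delta>' x" by blast
    define m where "m = cell \<delta> x"
    define B where "B = {i. m' i \<noteq> \<lfloor>\<delta> * of_int (m i) / \<delta>'\<rfloor>}"
    have "m' i = \<lfloor>\<delta> * of_int (m i) / \<delta>'\<rfloor> + (if i \<in> B then 1 else 0)" for i
    proof -
      define t where "t = \<delta> * of_int (m i) / \<delta>'"
      have "of_int (m i) \<le> x $ i / \<delta>" "x $ i / \<delta> < of_int (m i) + 1"
        unfolding m_def cell_def by linarith+
      then have "\<delta> * of_int (m i) \<le> x $ i" "x $ i < \<delta> * of_int (m i) + \<delta>'"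
        using assms by (simp_all add: field_simps)
      then have "t \<le> x $ i / \<delta>'" "x $ i / \<delta>' < t + 1"
        using assms by (simp_all add: t_def field_simps)
      then have "\<lfloor>x $ i / \<delta>'\<rfloor> = \<lfloor>t\<rfloor> \<or> \<lfloor>x $ i / \<delta>'\<rfloor> = \<lfloor>t\<rfloor> + 1" by linarith
      then show ?thesis unfolding B_def t_def x(2) cell_def by auto
    qed
    then have "m' \<in> F m" unfolding F_def by auto
    then show "m' \<in> (\<Union>m\<in>cell \<delta> ` E. F m)" using x(1) m_def by blast
  qed
  then have "card (cell \<delta>' ` E) \<le> card (\<Union>m\<in>cell \<delta> ` E. F m)"
    using assms by (intro card_mono) (auto simp: F_def)
  also have "\<dots> \<le> (\<Sum>m\<in>cell \<delta> ` E. card (F m))"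
    using assms by (intro card_UN_le) auto
  also have "\<dots> \<le> (\<Sum>m\<in>cell \<delta> ` E. 2 ^ CARD('n))"
  proof (intro sum_mono)
    fix m
    have "card (F m) \<le> card (UNIV :: 'n set set)" unfolding F_def by (intro card_image_le) simp
    also have "\<dots> = 2 ^ CARD('n)" using card_Pow[of "UNIV :: 'n set"] by simp
    finally show "card (F m) \<le> 2 ^ CARD('n)" .
  qed
  finally show ?thesis by (simp add: mult.commute)
qed

lemma card_le_fibres:
  assumes "finite X" "\<And>y. y \<in> g ` X \<Longrightarrow> real (card {x \<in> X. g x = y}) \<le> F"
  shows "real (card X) \<le> F * real (card (g ` X))"
proof -
  have "X = (\<Union>y\<in>g ` X. {x \<in> X. g x = y})" by blast
  then have "card X \<le> (\<Sum>y\<in>g ` X. card {x \<in> X. g x = y})"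
    using card_UN_le[of "g ` X" "\<lambda>y. {x \<in> X. g x = y}"] assms(1) by simp
  then have "real (card X) \<le> (\<Sum>y\<in>g ` X. real (card {x \<in> X. g x = y}))"
    by (simp flip: of_nat_sum)
  also have "\<dots> \<le> (\<Sum>y\<in>g ` X. F)" by (intro sum_mono assms(2))
  finally show ?thesis by (simp add: mult.commute)
qed

text \<open>Cauchy-Schwarz over the fibres of \<open>f\<close>: a map with few collisions has a
  large image.\<close>

lemma card_sq_le_fibre_pairs:
  assumes "finite W"
  shows "(real (card W))\<^sup>2 \<le> real (card (f ` W)) * real (card {(w, w') \<in> W \<times> W. f w = f w'})"
proof -
  let ?n = "\<lambda>y. real (card {w \<in> W. f w = y})"
  have W: "W = (\<Union>y\<in>f ` W. {w \<in> W. f w = y})" by blast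
  have "card W = (\<Sum>y\<in>f ` W. card {w \<in> W. f w = y})"
    by (subst W, rule card_UN_disjoint) (use assms in auto)
  then have 1: "real (card W) = (\<Sum>y\<in>f ` W. 1 * ?n y)" by simp
  have "{(w, w') \<in> W \<times> W. f w = f w'} = (\<Union>y\<in>f ` W. {w \<in> W. f w = y} \<times> {w \<in> W. f w = y})" by auto
  then have "card {(w, w') \<in> W \<times> W. f w = f w'} = (\<Sum>y\<in>f ` W. card ({w \<in> W. f w = y} \<times> {w \<in> W. f w = y}))"
    by (simp only:, intro card_UN_disjoint) (use assms in auto)
  then have 2: "real (card {(w, w') \<in> W \<times> W. f w = f w'}) = (\<Sum>y\<in>f ` W. (?n y)\<^sup>2)"
    by (simp add: card_cartesian_product power2_eq_square)
  have "(\<Sum>y\<in>f ` W. 1 * ?n y)\<^sup>2 \<le> (\<Sum>y\<in>f ` W. 1\<^sup>2) * (\<Sum>y\<in>f ` W. (?n y)\<^sup>2)"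
    by (rule Cauchy_Schwarz_ineq_sum)
  then show ?thesis unfolding 1 2 by simp
qed

lemma pigeonhole_images:
  assumes "finite T" "P \<subseteq> (\<Union>t\<in>T. Q t)" "P \<noteq> {}" "\<And>t. t \<in> T \<Longrightarrow> finite (Q t)"
  shows "\<exists>t\<in>T. real (card (f ` P)) \<le> real (card T) * real (card (f ` Q t))"
proof (rule ccontr)
  assume "\<not> ?thesis"
  then have less: "real (card T) * real (card (f ` Q t)) < real (card (f ` P))" if "t \<in> T" for t
    using that by force
  have T: "T \<noteq> {}" using assms(2,3) by auto
  have "f ` P \<subseteq> (\<Union>t\<in>T. f ` Q t)" using assms(2) by blast
  then have "card (f ` P) \<le> card (\<Union>t\<in>T. f ` Q t)"
    using assms by (intro card_mono) auto
  also have "\<dots> \<le> (\<Sum>t\<in>T. card (f ` Q t))" by (rule card_UN_le[OF assms(1)])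
  finally have "real (card (f ` P)) \<le> (\<Sum>t\<in>T. real (card (f ` Q t)))"
    by (simp flip: of_nat_sum)
  then have "real (card T) * real (card (f ` P)) \<le> (\<Sum>t\<in>T. real (card T) * real (card (f ` Q t)))"
    by (simp add: mult_left_mono flip: sum_distrib_left)
  also have "\<dots> < (\<Sum>t\<in>T. real (card (f ` P)))"
    using T assms(1) less by (intro sum_strict_mono) auto
  finally show False by simp
qed

lemma card_int_diameter:
  assumes "finite Z" "0 \<le> D" "\<And>z z'. z \<in> Z \<Longrightarrow> z' \<in> Z \<Longrightarrow> \<bar>real_of_int z - real_of_int z'\<bar> \<le> D"
  shows "real (card Z) \<le> D + 1"
proof (cases "Z = {}")
  case False
  define z0 where "z0 = Min Z"
  have z0: "z0 \<in> Z" "\<And>z. z \<in> Z \<Longrightarrow> z0 \<le> z" using assms(1) False by (auto simp: z0_def)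
  have "Z \<subseteq> {z0..z0 + \<lfloor>D\<rfloor>}"
  proof
    fix z assume z: "z \<in> Z"
    then have "real_of_int (z - z0) \<le> D" using assms(3)[OF z z0(1)] by simp
    then have "z - z0 \<le> \<lfloor>D\<rfloor>" by (simp only: le_floor_iff)
    then show "z \<in> {z0..z0 + \<lfloor>D\<rfloor>}" using z0(2)[OF z] by simp
  qed
  then have "card Z \<le> card {z0..z0 + \<lfloor>D\<rfloor>}" by (intro card_mono) auto
  moreover have "0 \<le> \<lfloor>D\<rfloor>" using assms(2) by simp
  ultimately show ?thesis by simp linarith
qed (use assms in simp)

section \<open>Rotations of coordinate triples\<close>

section \<open>Rotations in three coordinates\<close>

definition block :: "'n \<Rightarrow> 'n \<Rightarrow> 'n \<Rightarrow> real quat \<Rightarrow> real^'n \<Rightarrow> real^'n" where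
  "block a b c g x = (let r = qrot g (Quat 0 (x $ a) (x $ b) (x $ c)) in
     \<chi> i. if i = a then q1 r else if i = b then q2 r else if i = c then q3 r else x $ i)"

lemma q0_qrot: "q0 v = 0 \<Longrightarrow> q0 (qrot g v) = 0"
  by (simp add: qrot_def quat_simps algebra_simps)

lemma qnorm_qrot: "qnorm g = 1 \<Longrightarrow> qnorm (qrot g v) = qnorm v"
  by (simp add: qrot_def qnorm_mult)

lemma qrot_mult: "qrot (g * h) v = qrot g (qrot h v)"
  by (simp add: qrot_def qcnj_mult mult.assoc)

lemma block_other: "i \<notin> {a, b, c} \<Longrightarrow> block a b c g x $ i = x $ i"
  by (simp add: block_def Let_def)

lemma block_coords:
  assumes "distinct [a, b, c]"
  shows "Quat 0 (block a b c g x $ a) (block a b c g x $ b) (block a b c g x $ c) =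
    qrot g (Quat 0 (x $ a) (x $ b) (x $ c))"
  using assms q0_qrot[of "Quat 0 (x $ a) (x $ b) (x $ c)" g]
  by (cases "qrot g (Quat 0 (x $ a) (x $ b) (x $ c))") (auto simp: block_def Let_def)

lemma block_mult:
  assumes "distinct [a, b, c]"
  shows "block a b c (g * h) x = block a b c g (block a b c h x)"
proof -
  have "block a b c (g * h) x $ i = block a b c g (block a b c h x) $ i" for i
    unfolding block_def[of a b c g] block_coords[OF assms] qrot_mult[symmetric]
    unfolding block_def by (simp add: Let_def)
  then show ?thesis by (simp add: vec_eq_iff)
qed

lemma qrot_one: "qrot 1 v = v"
  by (simp add: qrot_def qcnj_def one_quat_def) (cases v, simp add: times_quat_def)

lemma block_one: "block a b c 1 x = x"
  by (simp add: block_def qrot_one vec_eq_iff Let_def)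

lemma linear_block: "linear (block a b c g)"
proof (rule linearI)
  have add: "qrot g (Quat 0 (x1 + y1) (x2 + y2) (x3 + y3)) = qrot g (Quat 0 x1 x2 x3) + qrot g (Quat 0 y1 y2 y3)"
    for x1 x2 x3 y1 y2 y3 by (simp add: qrot_def quat_simps algebra_simps)
  have scale: "qrot g (Quat 0 (t * x1) (t * x2) (t * x3)) = qscale t (qrot g (Quat 0 x1 x2 x3))"
    for t x1 x2 x3 by (simp add: qrot_def quat_simps algebra_simps)
  show "block a b c g (x + y) = block a b c g x + block a b c g y" for x y
    by (simp add: block_def Let_def vec_eq_iff add plus_quat_def)
  show "block a b c g (t *\<^sub>R x) = t *\<^sub>R block a b c g x" for t x
    by (simp add: block_def Let_def vec_eq_iff scale qscale_def)
qed

lemma matrix_block: "matrix (block a b c g) *v x = block a b c g x"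
  using matrix_vector_mul(2)[OF linear_block] by (rule fun_cong)

lemma block_sum_squares:
  assumes abc: "distinct [a, b, c]" "{a, b, c} \<subseteq> I" and g: "qnorm g = 1"
  shows "(\<Sum>i\<in>I. (block a b c g x $ i)\<^sup>2) = (\<Sum>i\<in>I. (x $ i)\<^sup>2)"
proof -
  have fin: "finite I" by simp
  have split: "(\<Sum>i\<in>I. f i) = (\<Sum>i\<in>I - {a, b, c}. f i) + (f a + f b + f c)" for f :: "'a \<Rightarrow> real"
    using sum.subset_diff[OF abc(2) fin, of f] abc(1) by simp
  have "qnorm (Quat 0 (block a b c g x $ a) (block a b c g x $ b) (block a b c g x $ c)) =
      qnorm (Quat 0 (x $ a) (x $ b) (x $ c))"
    unfolding block_coords[OF abc(1)] by (rule qnorm_qrot[OF g])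
  then have "(block a b c g x $ a)\<^sup>2 + (block a b c g x $ b)\<^sup>2 + (block a b c g x $ c)\<^sup>2 =
      (x $ a)\<^sup>2 + (x $ b)\<^sup>2 + (x $ c)\<^sup>2"
    by (simp add: qdot_def power2_eq_square)
  moreover have "(\<Sum>i\<in>I - {a, b, c}. (block a b c g x $ i)\<^sup>2) = (\<Sum>i\<in>I - {a, b, c}. (x $ i)\<^sup>2)"
    by (intro sum.cong) (auto simp: block_other)
  ultimately show ?thesis by (simp only: split)
qed

lemma norm_vec_squares: "(norm (x :: real^'n))\<^sup>2 = (\<Sum>i\<in>UNIV. (x $ i)\<^sup>2)"
  unfolding power2_norm_eq_inner inner_vec_def by (simp add: power2_eq_square)

lemma norm_block:
  assumes "distinct [a, b, c]" "qnorm g = 1"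
  shows "norm (block a b c g x) = norm x"
proof -
  have "(norm (block a b c g x))\<^sup>2 = (norm x)\<^sup>2"
    unfolding norm_vec_squares using assms by (intro block_sum_squares) auto
  then show ?thesis by simp
qed

text \<open>Halves the rotation angle: \<open>h\<close> is \<open>1 + g\<close> normalized, where
  \<open>qnorm (1 + g) = 2 * (1 + q0 g)\<close>. At \<open>g = -1\<close> this degenerates and an
  imaginary unit is the root.\<close>

lemma unit_quat_sqrt:
  assumes "qnorm (g :: real quat) = 1"
  obtains h where "qnorm h = 1" "h * h = g"
proof (cases "q0 g = -1")
  case True
  then have "q1 g * q1 g + q2 g * q2 g + q3 g * q3 g = 0" using assms by (simp add: qdot_def)
  then have "q1 g = 0" "q2 g = 0" "q3 g = 0"
    by (smt (verit) mult_eq_0_iff zero_le_square)+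
  then have "g = - 1" using True by (cases g) (simp add: quat_defs)
  moreover have "qnorm (Quat 0 1 0 0 :: real quat) = 1" "Quat 0 1 0 0 * Quat 0 1 0 0 = (- 1 :: real quat)"
    by (simp_all add: quat_simps)
  ultimately show ?thesis using that by blast
next
  case False
  have n: "q0 g * q0 g + q1 g * q1 g + q2 g * q2 g + q3 g * q3 g = 1" using assms by (simp add: qdot_def)
  have "\<bar>q0 g\<bar> \<le> 1"
  proof -
    have "(q0 g)\<^sup>2 \<le> 1\<^sup>2"
      using n zero_le_square[of "q1 g"] zero_le_square[of "q2 g"] zero_le_square[of "q3 g"]
      unfolding power2_eq_square by linarith
    then show ?thesis by (simp add: abs_square_le_1)
  qed
  with False have pos: "2 * (1 + q0 g) > 0" by auto
  define t where "t = 1 / sqrt (2 * (1 + q0 g))"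
  have t: "t * t * (2 * (1 + q0 g)) = 1" using pos by (simp add: t_def)
  define h where "h = qscale t (1 + g)"
  have "qnorm h = t * t * (2 * (1 + q0 g))"
  proof -
    have "qnorm h = t * t * (qnorm g + 1 + 2 * q0 g)"
      by (simp add: h_def quat_simps algebra_simps)
    then show ?thesis using assms by simp
  qed
  moreover have "h * h = qscale (t * t * (2 * (1 + q0 g))) g"
  proof -
    have "(1 + g) * (1 + g) = qscale (2 * (1 + q0 g)) g"
      using n by (cases g) (simp add: quat_simps algebra_simps)
    then show ?thesis
      by (simp add: h_def qscale_mult_left qscale_mult_right) (simp add: qscale_def mult_ac)
  qed
  ultimately show ?thesis using that[of h] t by (cases g) (simp add: qscale_def)
qed

lemma rotation_matrix_block:
  assumes "distinct [a, b, c]" "qnorm g = 1"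
  shows "rotation_matrix (matrix (block a b c g))"
proof -
  \<comment> \<open>The determinant is 1 because the rotation is a square.\<close>
  have orth: "orthogonal_matrix (matrix (block a b c h))" if "qnorm h = 1" for h
  proof -
    have "orthogonal_transformation (block a b c h)"
      by (simp add: orthogonal_transformation linear_block norm_block[OF assms(1) that])
    then show ?thesis using orthogonal_transformation_matrix by blast
  qed
  obtain h where h: "qnorm h = 1" "h * h = g" using unit_quat_sqrt[OF assms(2)] .
  have "block a b c g = block a b c h \<circ> block a b c h"
    using block_mult[OF assms(1)] h(2) by (auto simp: fun_eq_iff)
  then have "matrix (block a b c g) = matrix (block a b c h) ** matrix (block a b c h)"
    by (simp add: matrix_compose linear_block)
  then have "det (matrix (block a b c g)) = det (matrix (block a b c h)) * det (matrix (block a b c h))"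
    by (simp add: det_mul)
  also have "\<dots> = 1" using det_orthogonal_matrix[OF orth[OF h(1)]] by auto
  finally show ?thesis using orth[OF assms(2)] by (simp add: rotation_matrix_def)
qed

section \<open>Orbits, and the cells reached through one triple\<close>

section \<open>Orbits\<close>

definition reach :: "(real^'n^'n) set \<Rightarrow> nat \<Rightarrow> real^'n \<Rightarrow> (real^'n) set" where
  "reach G N x = (\<lambda>As. foldr (\<lambda>A v. A *v v) As x) ` words G N"

lemma finite_reach: "finite G \<Longrightarrow> finite (reach G N x)"
  by (simp add: reach_def finite_words)

lemma reach_add: "y \<in> reach G N x \<Longrightarrow> z \<in> reach G M y \<Longrightarrow> z \<in> reach G (N + M) x"
proof -
  assume "y \<in> reach G N x" "z \<in> reach G M y"
  then obtain As Bs where "As \<in> words G N" "y = foldr (\<lambda>A v. A *v v) As x"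
    "Bs \<in> words G M" "z = foldr (\<lambda>A v. A *v v) Bs y"
    by (auto simp: reach_def)
  then have "Bs @ As \<in> words G (N + M)" "z = foldr (\<lambda>A v. A *v v) (Bs @ As) x"
    by (auto simp: words_def)
  then show ?thesis unfolding reach_def by blast
qed

definition gens :: "real quat set \<Rightarrow> (real^'n^'n) set" where
  "gens S = {matrix (block a b c s) | a b c s. distinct [a, b, c] \<and> s \<in> S}"

lemma finite_gens: "finite S \<Longrightarrow> finite (gens S :: (real^'n^'n) set)"
proof -
  assume "finite S"
  have "gens S \<subseteq> (\<lambda>(a, b, c, s). matrix (block a b c s) :: real^'n^'n) ` (UNIV \<times> UNIV \<times> UNIV \<times> S)"
  proof
    fix M :: "real^'n^'n" assume "M \<in> gens S"
    then obtain a b c s where "M = matrix (block a b c s)" "s \<in> S" unfolding gens_def by blast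
    then show "M \<in> (\<lambda>(a, b, c, s). matrix (block a b c s)) ` (UNIV \<times> UNIV \<times> UNIV \<times> S)"
      by (intro image_eqI[of _ _ "(a, b, c, s)"]) simp_all
  qed
  then show ?thesis by (rule finite_subset) (use \<open>finite S\<close> in simp)
qed

context expanding_quats
begin

lemma rotation_matrix_gens: "A \<in> gens S \<Longrightarrow> rotation_matrix A"
  unfolding gens_def using rotation_matrix_block unit_S by blast

lemma block_word_reach:
  assumes "distinct [a, b, c]"
  shows "w \<in> words S N \<Longrightarrow> block a b c (prod_list w) x \<in> reach (gens S) N x"
proof (induction N arbitrary: w)
  case 0
  then show ?case by (simp add: reach_def block_one)
next
  case (Suc N)
  then obtain s w' where w: "w = s # w'" "s \<in> S" "w' \<in> words S N" by (auto simp: words_Suc)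
  from Suc.IH[OF w(3)] obtain As where As: "As \<in> words (gens S) N"
    "block a b c (prod_list w') x = foldr (\<lambda>A v. A *v v) As x"
    by (auto simp: reach_def)
  have "matrix (block a b c s) # As \<in> words (gens S) (Suc N)"
  proof -
    have "matrix (block a b c s) \<in> gens S" using w(2) assms unfolding gens_def by blast
    with As(1) show ?thesis by (simp add: words_def)
  qed
  moreover have "block a b c (prod_list w) x = foldr (\<lambda>A v. A *v v) (matrix (block a b c s) # As) x"
    by (simp add: w(1) block_mult[OF assms] As(2) matrix_block)
  ultimately show ?case unfolding reach_def by blast
qed

lemma norm_reach: "y \<in> reach (gens S) N x \<Longrightarrow> norm y = norm x"
proof -
  have "norm (foldr (\<lambda>A v. A *v v) As x) = norm x" if "set As \<subseteq> gens S" for As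
    using that
  proof (induction As)
    case (Cons A As)
    then obtain a b c s where "A = matrix (block a b c s)" "distinct [a, b, c]" "s \<in> S"
      unfolding gens_def by auto
    with Cons show ?case by (simp add: matrix_block norm_block unit_S)
  qed simp
  then show "y \<in> reach (gens S) N x \<Longrightarrow> norm y = norm x" by (auto simp: reach_def words_def)
qed

definition C' :: real where "C' = 16 * 8 powr (3 / 2) * C + 4"

lemma C'_pos: "C' > 0" using C_pos by (simp add: C'_def add_pos_pos)

text \<open>Two words with equal cells move the normalized triple \<open>v\<close> to points at most
  \<open>sqrt 3 * \<delta> / \<rho>\<close> apart. \<open>card_close_pairs\<close> makes such
  collisions rare, and Cauchy-Schwarz turns few collisions into many cells.\<close>

lemma block_cells:
  assumes abc: "distinct [a, b, c]" and x: "norm x = 1" and \<tau>: "\<tau> > 0" "\<tau>\<^sup>2 \<le> (x $ a)\<^sup>2 + (x $ b)\<^sup>2 + (x $ c)\<^sup>2"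
    and \<delta>: "0 < \<delta>" "\<delta> \<le> 1" and N: "real N \<ge> 2 * K * ln (1 / \<delta>)"
  shows "real (card (cell \<delta> ` (\<lambda>w. block a b c (prod_list w) x) ` words S N)) \<ge> \<tau>\<^sup>2 / (3 * C') / \<delta>\<^sup>2"
proof -
  define \<rho> where "\<rho> = sqrt ((x $ a)\<^sup>2 + (x $ b)\<^sup>2 + (x $ c)\<^sup>2)"
  have \<rho>2: "\<rho>\<^sup>2 = (x $ a)\<^sup>2 + (x $ b)\<^sup>2 + (x $ c)\<^sup>2" by (simp add: \<rho>_def)
  have "\<rho>\<^sup>2 > 0" using \<tau> \<rho>2 by (smt (verit) zero_less_power2)
  then have \<rho>0: "\<rho> > 0" by (simp add: \<rho>_def)
  have "(\<Sum>i\<in>{a, b, c}. (x $ i)\<^sup>2) \<le> (\<Sum>i\<in>UNIV. (x $ i)\<^sup>2)" by (intro sum_mono2) auto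
  then have "\<rho>\<^sup>2 \<le> 1" using abc x unfolding norm_vec_squares[symmetric] \<rho>2 by (simp add: add.assoc)
  then have \<rho>1: "\<rho> \<le> 1" using power2_le_imp_le[of \<rho> 1] by simp
  define u where "u = Quat 0 (x $ a) (x $ b) (x $ c)"
  define v where "v = qscale (1 / \<rho>) u"
  have uv: "u = qscale \<rho> v" using \<rho>0 by (simp add: v_def qscale_def u_def)
  have v: "q0 v = 0" "qnorm v = 1"
  proof -
    show "q0 v = 0" by (simp add: v_def u_def qscale_def)
    have "qnorm u = \<rho>\<^sup>2" using \<rho>2 unfolding power2_eq_square by (simp add: u_def qdot_def)
    moreover have "qnorm u = \<rho>\<^sup>2 * qnorm v"
      unfolding uv by (simp add: qscale_def qdot_def power2_eq_square algebra_simps)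
    ultimately show "qnorm v = 1" using \<rho>0 by simp
  qed
  define \<delta>1 where "\<delta>1 = sqrt 3 * \<delta> / \<rho>"
  have \<delta>1: "\<delta>1 > 0" using \<delta> \<rho>0 by (simp add: \<delta>1_def)
  have \<delta>1sq: "\<delta>1\<^sup>2 = 3 * \<delta>\<^sup>2 / \<rho>\<^sup>2" by (simp add: \<delta>1_def power_divide power_mult_distrib)
  have N1: "real N \<ge> 2 * K * ln (1 / \<delta>1)"
  proof -
    have "1 \<le> sqrt 3" by simp
    with \<rho>1 have "\<rho> \<le> sqrt 3" by linarith
    then have "\<rho> * \<delta> \<le> sqrt 3 * \<delta>" using \<delta> by (intro mult_right_mono) auto
    then have "\<delta> \<le> \<delta>1" using \<rho>0 by (simp add: \<delta>1_def le_divide_eq mult.commute)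
    then have "1 / \<delta>1 \<le> 1 / \<delta>" using \<delta> by (simp add: frac_le)
    then have "ln (1 / \<delta>1) \<le> ln (1 / \<delta>)" using \<delta> \<delta>1 by simp
    then have "2 * K * ln (1 / \<delta>1) \<le> 2 * K * ln (1 / \<delta>)" using K_pos by (intro mult_left_mono) auto
    with N show ?thesis by linarith
  qed
  let ?f = "\<lambda>w. cell \<delta> (block a b c (prod_list w) x)"
  let ?W = "words S N"
  have sub: "{(w, w') \<in> ?W \<times> ?W. ?f w = ?f w'} \<subseteq> close_pairs N v \<delta>1"
  proof clarify
    fix w w' assume w: "w \<in> ?W" "w' \<in> ?W" and eq: "?f w = ?f w'"
    define y where "y = block a b c (prod_list w) x"
    define z where "z = block a b c (prod_list w') x"
    have d: "\<bar>y $ i - z $ i\<bar> \<le> \<delta>" for i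
      using cell_eq_imp_close[OF \<delta>(1), of y i z] eq by (simp add: y_def z_def)
    have sq: "(y $ i - z $ i)\<^sup>2 \<le> \<delta>\<^sup>2" for i using d[of i] \<delta>(1) by (simp add: abs_le_square_iff[symmetric])
    have "qrot (prod_list w) u - qrot (prod_list w') u = Quat 0 (y $ a - z $ a) (y $ b - z $ b) (y $ c - z $ c)"
      unfolding u_def block_coords[OF abc, symmetric] by (simp add: y_def z_def minus_quat_def)
    then have "qnorm (qrot (prod_list w) u - qrot (prod_list w') u) =
        (y $ a - z $ a)\<^sup>2 + (y $ b - z $ b)\<^sup>2 + (y $ c - z $ c)\<^sup>2"
      by (simp add: qdot_def power2_eq_square)
    also have "\<dots> \<le> 3 * \<delta>\<^sup>2" using sq[of a] sq[of b] sq[of c] by linarith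
    finally have "qnorm (qrot (prod_list w) u - qrot (prod_list w') u) \<le> 3 * \<delta>\<^sup>2" .
    moreover have "qrot g u = qscale \<rho> (qrot g v)" for g
      by (simp add: uv qrot_def qscale_mult_left qscale_mult_right)
    then have "qnorm (qrot (prod_list w) u - qrot (prod_list w') u) =
        \<rho>\<^sup>2 * qnorm (qrot (prod_list w) v - qrot (prod_list w') v)"
      by (simp add: qscale_def qdot_def minus_quat_def power2_eq_square algebra_simps)
    ultimately have "qnorm (qrot (prod_list w) v - qrot (prod_list w') v) \<le> \<delta>1\<^sup>2"
      using \<rho>0 by (simp add: \<delta>1sq le_divide_eq mult.commute)
    with w show "(w, w') \<in> close_pairs N v \<delta>1" by (simp add: close_pairs_def)
  qed
  have finW: "finite ?W" by (rule finite_words[OF finite_S])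
  have "finite (close_pairs N v \<delta>1)"
    by (rule finite_subset[of _ "?W \<times> ?W"]) (use finW in \<open>auto simp: close_pairs_def\<close>)
  then have "real (card {(w, w') \<in> ?W \<times> ?W. ?f w = ?f w'}) \<le> real (card (close_pairs N v \<delta>1))"
    using sub by (intro of_nat_mono card_mono)
  also have "\<dots> \<le> C' * \<delta>1\<^sup>2 * real (card S) ^ (2 * N)"
    unfolding C'_def by (rule card_close_pairs[OF v \<delta>1 N1])
  also have "real (card S) ^ (2 * N) = (real (card ?W))\<^sup>2"
    by (simp add: card_words[OF finite_S] power_even_eq)
  finally have p: "real (card {(w, w') \<in> ?W \<times> ?W. ?f w = ?f w'}) \<le> C' * \<delta>1\<^sup>2 * (real (card ?W))\<^sup>2" .
  have "(real (card ?W))\<^sup>2 \<le> real (card (?f ` ?W)) * real (card {(w, w') \<in> ?W \<times> ?W. ?f w = ?f w'})"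
    by (rule card_sq_le_fibre_pairs[OF finW])
  also have "\<dots> \<le> real (card (?f ` ?W)) * (C' * \<delta>1\<^sup>2 * (real (card ?W))\<^sup>2)"
    by (intro mult_left_mono p) auto
  finally have "1 * (real (card ?W))\<^sup>2 \<le> (real (card (?f ` ?W)) * (C' * \<delta>1\<^sup>2)) * (real (card ?W))\<^sup>2"
    by (simp add: mult.assoc)
  moreover have "real (card ?W) > 0"
    using S_ne finite_S by (simp add: card_words[OF finite_S] card_gt_0_iff)
  ultimately have "1 \<le> real (card (?f ` ?W)) * (C' * \<delta>1\<^sup>2)" by (simp add: mult_le_cancel_right)
  then have "\<rho>\<^sup>2 \<le> real (card (?f ` ?W)) * (3 * C' * \<delta>\<^sup>2)"
    using \<rho>0 unfolding \<delta>1sq by (simp add: field_simps)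
  then have "\<tau>\<^sup>2 \<le> real (card (?f ` ?W)) * (3 * C' * \<delta>\<^sup>2)" using \<tau>(2) \<rho>2 by linarith
  then have "\<tau>\<^sup>2 / (3 * C') / \<delta>\<^sup>2 \<le> real (card (?f ` ?W))"
    using C'_pos \<delta> by (simp add: divide_le_eq)
  then show ?thesis by (simp add: image_image)
qed

end

section \<open>Induction on the number of moving coordinates\<close>

section \<open>Spreading in all dimensions\<close>

text \<open>Forgetting a coordinate is encoded as resetting it to 0, which keeps the index type;
  each fibre then corresponds to a set of integers of bounded diameter.\<close>

lemma card_erase_coordinate:
  fixes X :: "('n \<Rightarrow> int) set"
  assumes "finite X" "0 \<le> D"
    "\<And>m m'. m \<in> X \<Longrightarrow> m' \<in> X \<Longrightarrow> m(a := 0) = m'(a := 0) \<Longrightarrow> \<bar>real_of_int (m a) - real_of_int (m' a)\<bar> \<le> D"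
  shows "real (card X) \<le> (D + 1) * real (card ((\<lambda>m. m(a := 0)) ` X))"
proof (rule card_le_fibres[OF assms(1)])
  fix \<mu>
  let ?F = "{m \<in> X. m(a := 0) = \<mu>}"
  have inj: "inj_on (\<lambda>m. m a) ?F"
  proof (rule inj_onI)
    fix m m' assume "m \<in> ?F" "m' \<in> ?F" "m a = m' a"
    then have "m(a := 0) = m'(a := 0)" "m a = m' a" by auto
    then show "m = m'" by (metis fun_upd_triv fun_upd_upd)
  qed
  have "real (card ((\<lambda>m. m a) ` ?F)) \<le> D + 1"
    using assms by (intro card_int_diameter) auto
  then show "real (card ?F) \<le> D + 1" by (simp add: card_image[OF inj])
qed

context expanding_quats
begin

text \<open>From every unit vector whose coordinates in \<open>I\<close> are not too small, words of length
  \<open>(card I - 2) * N\<close> that only move these coordinates visit as many cells as a sphere of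
  dimension \<open>card I - 1\<close> has.\<close>

definition covers :: "real \<Rightarrow> 'n::finite set \<Rightarrow> real^'n \<Rightarrow> real \<Rightarrow> nat \<Rightarrow> bool" where
  "covers c I x \<delta> N \<longleftrightarrow> (\<exists>P \<subseteq> reach (gens S) ((card I - 2) * N) x.
     (\<forall>y\<in>P. \<forall>i. i \<notin> I \<longrightarrow> y $ i = x $ i) \<and> c / \<delta> ^ (card I - 1) \<le> real (card (cell \<delta> ` P)))"

text \<open>The order of quantifiers matters: \<open>c\<close> depends on \<open>\<rho>\<close> but
  not on \<open>I\<close>, \<open>x\<close>, \<open>\<delta>\<close> or \<open>N\<close>. The mass
  bound \<open>\<rho>\<close> varies because the induction leaves out a coordinate.\<close>

definition spreads :: "'n::finite itself \<Rightarrow> nat \<Rightarrow> bool" where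
  "spreads _ k \<longleftrightarrow> (\<forall>\<rho>>0. \<exists>c>0. \<forall>(I :: 'n set) (x :: real^'n) \<delta> N. card I = k \<longrightarrow> norm x = 1 \<longrightarrow>
     \<rho>\<^sup>2 \<le> (\<Sum>i\<in>I. (x $ i)\<^sup>2) \<longrightarrow> 0 < \<delta> \<longrightarrow> \<delta> \<le> 1 \<longrightarrow> real N \<ge> 2 * K * ln (1 / \<delta>) \<longrightarrow>
     covers c I x \<delta> N)"

lemma spreads_3: "spreads TYPE('n::finite) 3"
  unfolding spreads_def
proof (intro allI impI)
  fix \<rho> :: real assume \<rho>: "\<rho> > 0"
  show "\<exists>c>0. \<forall>(I :: 'n set) (x :: real^'n) \<delta> N. card I = 3 \<longrightarrow> norm x = 1 \<longrightarrow>
     \<rho>\<^sup>2 \<le> (\<Sum>i\<in>I. (x $ i)\<^sup>2) \<longrightarrow> 0 < \<delta> \<longrightarrow> \<delta> \<le> 1 \<longrightarrow> real N \<ge> 2 * K * ln (1 / \<delta>) \<longrightarrow>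
     covers c I x \<delta> N"
  proof (intro exI[of _ "\<rho>\<^sup>2 / (3 * C')"] conjI allI impI)
    show "\<rho>\<^sup>2 / (3 * C') > 0" using \<rho> C'_pos by simp
    fix I :: "'n set" and x :: "real^'n" and \<delta> N
    assume I: "card I = 3" and x: "norm x = 1" and s: "\<rho>\<^sup>2 \<le> (\<Sum>i\<in>I. (x $ i)\<^sup>2)"
      and \<delta>: "0 < \<delta>" "\<delta> \<le> 1" and N: "real N \<ge> 2 * K * ln (1 / \<delta>)"
    obtain a b c where abc: "I = {a, b, c}" "a \<noteq> b" "b \<noteq> c" "a \<noteq> c"
      using I by (auto simp: card_3_iff)
    then have d: "distinct [a, b, c]" by simp
    let ?P = "(\<lambda>w. block a b c (prod_list w) x) ` words S N"
    have "\<rho>\<^sup>2 \<le> (x $ a)\<^sup>2 + (x $ b)\<^sup>2 + (x $ c)\<^sup>2" using s abc by (simp add: add.assoc)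
    from block_cells[OF d x \<rho> this \<delta> N]
    have "\<rho>\<^sup>2 / (3 * C') / \<delta> ^ (card I - 1) \<le> real (card (cell \<delta> ` ?P))" by (simp add: I)
    moreover have "?P \<subseteq> reach (gens S) ((card I - 2) * N) x" using block_word_reach[OF d] by (auto simp: I)
    moreover have "\<forall>y\<in>?P. \<forall>i. i \<notin> I \<longrightarrow> y $ i = x $ i" using abc by (auto intro: block_other)
    ultimately show "covers (\<rho>\<^sup>2 / (3 * C')) I x \<delta> N" unfolding covers_def by blast
  qed
qed

lemma squares_close:
  assumes "\<And>i. i \<in> J \<Longrightarrow> \<bar>y i\<bar> \<le> 1" "\<And>i. i \<in> J \<Longrightarrow> \<bar>z i\<bar> \<le> (1::real)"
    "\<And>i. i \<in> J \<Longrightarrow> \<bar>y i - z i\<bar> \<le> \<delta>" "\<delta> \<ge> 0"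
  shows "\<bar>(\<Sum>i\<in>J. (y i)\<^sup>2) - (\<Sum>i\<in>J. (z i)\<^sup>2)\<bar> \<le> 2 * real (card J) * \<delta>"
proof -
  have "\<bar>(\<Sum>i\<in>J. (y i)\<^sup>2) - (\<Sum>i\<in>J. (z i)\<^sup>2)\<bar> \<le> (\<Sum>i\<in>J. \<bar>(y i)\<^sup>2 - (z i)\<^sup>2\<bar>)"
    by (simp add: sum_subtractf[symmetric])
  also have "\<dots> \<le> (\<Sum>i\<in>J. 2 * \<delta>)"
  proof (rule sum_mono)
    fix i assume i: "i \<in> J"
    have "\<bar>(y i)\<^sup>2 - (z i)\<^sup>2\<bar> = \<bar>y i + z i\<bar> * \<bar>y i - z i\<bar>"
      by (simp add: abs_mult[symmetric] power2_eq_square algebra_simps)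
    also have "\<dots> \<le> 2 * \<delta>"
      using assms(1)[OF i] assms(2)[OF i] assms(3)[OF i] by (intro mult_mono) auto
    finally show "\<bar>(y i)\<^sup>2 - (z i)\<^sup>2\<bar> \<le> 2 * \<delta>" .
  qed
  finally show ?thesis by (simp add: mult_ac)
qed

text \<open>On a sphere, away from the equator \<open>y $ a = 0\<close>, the coordinate \<open>y $ a\<close> is determined up to
  \<open>O(\<delta>)\<close> by the cells of the others; forgetting \<open>b\<close> as well costs a factor \<open>O(1 / \<delta>)\<close>.\<close>

lemma card_erase_two_coordinates:
  fixes Q :: "(real^'n) set"
  assumes ab: "a \<in> I" "b \<in> I" "a \<noteq> b" and \<delta>: "0 < \<delta>" "\<delta> \<le> 1" and \<tau>: "\<tau> > 0"
    and fin: "finite Q" and norm1: "\<And>y. y \<in> Q \<Longrightarrow> norm y = 1"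
    and sphere: "\<And>y. y \<in> Q \<Longrightarrow> (\<Sum>i\<in>I. (y $ i)\<^sup>2) = \<sigma>"
    and sgn: "\<And>y. y \<in> Q \<Longrightarrow> s * y $ a \<ge> \<tau>" and s: "\<bar>s\<bar> = (1::real)"
  shows "real (card (cell \<delta> ` Q)) \<le> (real CARD('n) / \<tau> + 2) * (4 / \<delta>) *
    real (card ((\<lambda>m. m(b := 0)) ` (\<lambda>m. m(a := 0)) ` cell \<delta> ` Q))"
proof -
  have le1: "\<bar>y $ i\<bar> \<le> 1" if "y \<in> Q" for y i
    using component_le_norm_cart[of y i] norm1[OF that] by simp
  have s1: "real (card (cell \<delta> ` Q)) \<le> ((real CARD('n) / \<tau> + 1) + 1) * real (card ((\<lambda>m. m(a := 0)) ` cell \<delta> ` Q))"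
  proof (rule card_erase_coordinate)
    show "finite (cell \<delta> ` Q)" using fin by simp
    show "0 \<le> real CARD('n) / \<tau> + 1" using \<tau> by (simp add: add_nonneg_nonneg)
    fix m m' assume "m \<in> cell \<delta> ` Q" "m' \<in> cell \<delta> ` Q" and eq: "m(a := 0) = m'(a := 0)"
    then obtain y z where yz: "y \<in> Q" "z \<in> Q" "m = cell \<delta> y" "m' = cell \<delta> z" by blast
    have "cell \<delta> y i = cell \<delta> z i" if "i \<noteq> a" for i
      using fun_cong[OF eq, of i] that yz by simp
    then have cl: "\<bar>y $ i - z $ i\<bar> \<le> \<delta>" if "i \<noteq> a" for i
      using cell_eq_imp_close[OF \<delta>(1)] that by blast
    let ?J = "I - {a}"
    have "(y $ a)\<^sup>2 + (\<Sum>i\<in>?J. (y $ i)\<^sup>2) = (z $ a)\<^sup>2 + (\<Sum>i\<in>?J. (z $ i)\<^sup>2)"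
      using sphere[OF yz(1)] sphere[OF yz(2)] sum.remove[of I a "\<lambda>i. (y $ i)\<^sup>2"]
        sum.remove[of I a "\<lambda>i. (z $ i)\<^sup>2"] ab by simp
    moreover have "\<bar>(\<Sum>i\<in>?J. (y $ i)\<^sup>2) - (\<Sum>i\<in>?J. (z $ i)\<^sup>2)\<bar> \<le> 2 * real (card ?J) * \<delta>"
      using le1 yz cl \<delta> by (intro squares_close) auto
    moreover have "card ?J \<le> CARD('n)" by (intro card_mono) auto
    then have "2 * real (card ?J) * \<delta> \<le> 2 * real CARD('n) * \<delta>"
      using \<delta> by (intro mult_right_mono) auto
    ultimately have sq: "\<bar>(y $ a)\<^sup>2 - (z $ a)\<^sup>2\<bar> \<le> 2 * real CARD('n) * \<delta>" by linarith
    have "2 * \<tau> \<le> \<bar>y $ a + z $ a\<bar>"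
    proof -
      have "2 * \<tau> \<le> s * (y $ a + z $ a)" using sgn[OF yz(1)] sgn[OF yz(2)] by (simp add: distrib_left)
      also have "\<dots> \<le> \<bar>s * (y $ a + z $ a)\<bar>" by simp
      finally show ?thesis using s by (simp add: abs_mult)
    qed
    then have "2 * \<tau> * \<bar>y $ a - z $ a\<bar> \<le> \<bar>y $ a + z $ a\<bar> * \<bar>y $ a - z $ a\<bar>"
      by (intro mult_right_mono) auto
    also have "\<dots> = \<bar>(y $ a)\<^sup>2 - (z $ a)\<^sup>2\<bar>"
      by (simp add: abs_mult[symmetric] power2_eq_square algebra_simps)
    finally have "\<tau> * \<bar>y $ a - z $ a\<bar> \<le> real CARD('n) * \<delta>" using sq by linarith
    then have "\<bar>y $ a - z $ a\<bar> / \<delta> \<le> real CARD('n) / \<tau>"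
      using \<tau> \<delta> by (simp add: field_simps)
    then have "\<bar>y $ a / \<delta> - z $ a / \<delta>\<bar> \<le> real CARD('n) / \<tau>"
      using \<delta> by (simp add: abs_divide flip: diff_divide_distrib)
    moreover have "\<bar>real_of_int (m a) - real_of_int (m' a)\<bar> \<le> \<bar>y $ a / \<delta> - z $ a / \<delta>\<bar> + 1"
      unfolding yz cell_def by linarith
    ultimately show "\<bar>real_of_int (m a) - real_of_int (m' a)\<bar> \<le> real CARD('n) / \<tau> + 1" by linarith
  qed
  have s2: "real (card ((\<lambda>m. m(a := 0)) ` cell \<delta> ` Q)) \<le>
      ((2 / \<delta> + 1) + 1) * real (card ((\<lambda>m. m(b := 0)) ` (\<lambda>m. m(a := 0)) ` cell \<delta> ` Q))"
  proof (rule card_erase_coordinate)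
    show "finite ((\<lambda>m. m(a := 0)) ` cell \<delta> ` Q)" using fin by simp
    show "0 \<le> 2 / \<delta> + 1" using \<delta> by (simp add: add_nonneg_nonneg)
    fix m m' assume "m \<in> (\<lambda>m. m(a := 0)) ` cell \<delta> ` Q" "m' \<in> (\<lambda>m. m(a := 0)) ` cell \<delta> ` Q"
    then obtain y z where yz: "y \<in> Q" "z \<in> Q" "m = (cell \<delta> y)(a := 0)" "m' = (cell \<delta> z)(a := 0)" by blast
    have "\<bar>y $ b / \<delta>\<bar> \<le> 1 / \<delta>" "\<bar>z $ b / \<delta>\<bar> \<le> 1 / \<delta>"
      using le1[OF yz(1), of b] le1[OF yz(2), of b] \<delta> by (simp_all add: abs_divide divide_right_mono)
    moreover have "2 / \<delta> = 1 / \<delta> + 1 / \<delta>" by simp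
    moreover have "m b = \<lfloor>y $ b / \<delta>\<rfloor>" "m' b = \<lfloor>z $ b / \<delta>\<rfloor>" using yz ab by (auto simp: cell_def)
    ultimately show "\<bar>real_of_int (m b) - real_of_int (m' b)\<bar> \<le> 2 / \<delta> + 1" by linarith
  qed
  have "(2 / \<delta> + 1) + 1 \<le> 4 / \<delta>" using \<delta> by (simp add: field_simps)
  then have "((2 / \<delta> + 1) + 1) * real (card ((\<lambda>m. m(b := 0)) ` (\<lambda>m. m(a := 0)) ` cell \<delta> ` Q)) \<le>
      4 / \<delta> * real (card ((\<lambda>m. m(b := 0)) ` (\<lambda>m. m(a := 0)) ` cell \<delta> ` Q))"
    by (intro mult_right_mono) auto
  with s2 have "real (card ((\<lambda>m. m(a := 0)) ` cell \<delta> ` Q)) \<le>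
      4 / \<delta> * real (card ((\<lambda>m. m(b := 0)) ` (\<lambda>m. m(a := 0)) ` cell \<delta> ` Q))"
    by (rule order_trans)
  moreover have "0 \<le> real CARD('n) / \<tau> + 2" using \<tau> by (simp add: add_nonneg_nonneg)
  ultimately have "(real CARD('n) / \<tau> + 2) * real (card ((\<lambda>m. m(a := 0)) ` cell \<delta> ` Q)) \<le>
      (real CARD('n) / \<tau> + 2) * (4 / \<delta> * real (card ((\<lambda>m. m(b := 0)) ` (\<lambda>m. m(a := 0)) ` cell \<delta> ` Q)))"
    by (rule mult_left_mono)
  moreover have "(real CARD('n) / \<tau> + 1) + 1 = real CARD('n) / \<tau> + 2" by simp
  ultimately show ?thesis using s1 by (simp only: mult.assoc)
qed

text \<open>The new coordinate \<open>j\<close> is frozen while those in \<open>I\<close> move, so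
  after erasing \<open>a\<close> and \<open>b\<close> the classes differ only outside
  \<open>a\<close>, \<open>b\<close>, \<open>j\<close>. The last block does not touch those
  coordinates, hence the cells from different classes stay disjoint and their numbers add.\<close>

lemma spreads_Suc:
  assumes k: "k \<ge> 3" and spr: "spreads TYPE('n::finite) k"
  shows "spreads TYPE('n) (Suc k)"
  unfolding spreads_def
proof (intro allI impI)
  fix \<rho> :: real assume \<rho>: "\<rho> > 0"
  \<comment> \<open>Of any two coordinates one carries at most half of the mass on
    \<open>I'\<close>, so leaving it out keeps at least \<open>\<rho>\<^sup>2 / 2\<close>.\<close>
  define \<rho>' where "\<rho>' = \<rho> / sqrt 2"
  have \<rho>': "\<rho>' > 0" "\<rho>'\<^sup>2 = \<rho>\<^sup>2 / 2" using \<rho> by (simp_all add: \<rho>'_def power_divide)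
  obtain c where c: "c > 0" "\<And>(I :: 'n set) (x :: real^'n) \<delta> N. card I = k \<Longrightarrow> norm x = 1 \<Longrightarrow>
     \<rho>'\<^sup>2 \<le> (\<Sum>i\<in>I. (x $ i)\<^sup>2) \<Longrightarrow> 0 < \<delta> \<Longrightarrow> \<delta> \<le> 1 \<Longrightarrow> real N \<ge> 2 * K * ln (1 / \<delta>) \<Longrightarrow>
     covers c I x \<delta> N"
    using spr \<rho>'(1) unfolding spreads_def by blast
  define \<tau> where "\<tau> = \<rho>' / sqrt (real k)"
  have \<tau>: "\<tau> > 0" "\<tau>\<^sup>2 = \<rho>'\<^sup>2 / real k" using \<rho>' k by (simp_all add: \<tau>_def power_divide)
  define F where "F = real CARD('n) / \<tau> + 2"
  have F: "F > 0" using \<tau> by (simp add: F_def add_nonneg_pos)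
  define e where "e = \<tau>\<^sup>2 / (3 * C')"
  have e: "e > 0" using \<tau>(1) C'_pos by (simp add: e_def)
  show "\<exists>c>0. \<forall>(I :: 'n set) (x :: real^'n) \<delta> N. card I = Suc k \<longrightarrow> norm x = 1 \<longrightarrow>
     \<rho>\<^sup>2 \<le> (\<Sum>i\<in>I. (x $ i)\<^sup>2) \<longrightarrow> 0 < \<delta> \<longrightarrow> \<delta> \<le> 1 \<longrightarrow> real N \<ge> 2 * K * ln (1 / \<delta>) \<longrightarrow>
     covers c I x \<delta> N"
  \<comment> \<open>\<open>2 * k\<close> is lost in the pigeonhole over \<open>T\<close> and
    \<open>F * (4 / \<delta>)\<close> in erasing two coordinates;
    \<open>e / \<delta>\<^sup>2\<close> is won by the new block.\<close>
  proof (intro exI[of _ "c * e / (8 * real k * F)"] conjI allI impI)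
    show "c * e / (8 * real k * F) > 0" using c(1) e F k by simp
    fix I' :: "'n set" and x :: "real^'n" and \<delta> N
    assume I': "card I' = Suc k" and x: "norm x = 1" and sx: "\<rho>\<^sup>2 \<le> (\<Sum>i\<in>I'. (x $ i)\<^sup>2)"
      and \<delta>: "0 < \<delta>" "\<delta> \<le> 1" and N: "real N \<ge> 2 * K * ln (1 / \<delta>)"
    obtain j where j: "j \<in> I'" "\<rho>'\<^sup>2 \<le> (\<Sum>i\<in>I' - {j}. (x $ i)\<^sup>2)"
    proof -
      obtain j1 j2 where jj: "j1 \<in> I'" "j2 \<in> I'" "j1 \<noteq> j2"
      proof -
        have "I' \<noteq> {}" using I' by auto
        then obtain j1 where j1: "j1 \<in> I'" by blast
        then have "card (I' - {j1}) = k" using I' by simp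
        then have "I' - {j1} \<noteq> {}" using k by (metis card.empty not_numeral_le_zero)
        with j1 that show ?thesis by blast
      qed
      have "(\<Sum>i\<in>{j1, j2}. (x $ i)\<^sup>2) \<le> (\<Sum>i\<in>I'. (x $ i)\<^sup>2)" using jj by (intro sum_mono2) auto
      then have "(x $ j1)\<^sup>2 + (x $ j2)\<^sup>2 \<le> (\<Sum>i\<in>I'. (x $ i)\<^sup>2)" using jj by simp
      moreover have "(\<Sum>i\<in>I'. (x $ i)\<^sup>2) = (x $ j1)\<^sup>2 + (\<Sum>i\<in>I' - {j1}. (x $ i)\<^sup>2)"
        "(\<Sum>i\<in>I'. (x $ i)\<^sup>2) = (x $ j2)\<^sup>2 + (\<Sum>i\<in>I' - {j2}. (x $ i)\<^sup>2)"
        by (rule sum.remove; simp add: jj)+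
      ultimately have "\<rho>'\<^sup>2 \<le> (\<Sum>i\<in>I' - {j1}. (x $ i)\<^sup>2) \<or> \<rho>'\<^sup>2 \<le> (\<Sum>i\<in>I' - {j2}. (x $ i)\<^sup>2)"
        using sx unfolding \<rho>'(2) by linarith
      then show ?thesis using that jj by blast
    qed
    define I where "I = I' - {j}"
    have cI: "card I = k" using I' j by (simp add: I_def)
    from c(2)[OF cI x j(2)[folded I_def] \<delta> N]
    obtain P where P: "P \<subseteq> reach (gens S) ((k - 2) * N) x" "\<And>y i. y \<in> P \<Longrightarrow> i \<notin> I \<Longrightarrow> y $ i = x $ i"
      "c / \<delta> ^ (k - 1) \<le> real (card (cell \<delta> ` P))"
      unfolding covers_def cI by blast
    have finP: "finite P" using P(1) finite_reach[OF finite_gens[OF finite_S]] by (rule finite_subset)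
    have normP: "norm y = 1" if "y \<in> P" for y
      using norm_reach[OF subsetD[OF P(1) that]] x by simp
    define \<sigma> where "\<sigma> = (\<Sum>i\<in>I. (x $ i)\<^sup>2)"
    have \<sigma>: "\<sigma> \<ge> \<rho>'\<^sup>2" using j by (simp add: \<sigma>_def I_def)
    have sphere: "(\<Sum>i\<in>I. (y $ i)\<^sup>2) = \<sigma>" if "y \<in> P" for y
    proof -
      have sp: "(\<Sum>i\<in>UNIV. (z $ i)\<^sup>2) = (\<Sum>i\<in>I. (z $ i)\<^sup>2) + (\<Sum>i\<in>UNIV - I. (z $ i)\<^sup>2)" for z :: "real^'n"
        using sum.subset_diff[of I UNIV "\<lambda>i. (z $ i)\<^sup>2"] by simp
      have "(\<Sum>i\<in>UNIV - I. (y $ i)\<^sup>2) = (\<Sum>i\<in>UNIV - I. (x $ i)\<^sup>2)"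
        using P(2)[OF that] by (intro sum.cong) auto
      moreover have "(\<Sum>i\<in>UNIV. (y $ i)\<^sup>2) = (\<Sum>i\<in>UNIV. (x $ i)\<^sup>2)"
        unfolding norm_vec_squares[symmetric] by (simp add: normP[OF that] x)
      ultimately show ?thesis unfolding \<sigma>_def using sp[of y] sp[of x] by linarith
    qed
    \<comment> \<open>A large coordinate together with its sign: over given values of the other
      coordinates a sphere has two points, and the sign selects one.\<close>
    define T where "T = I \<times> {1, -1 :: real}"
    define Q where "Q = (\<lambda>(a, s). {y \<in> P. s * y $ a \<ge> \<tau>})"
    have cT: "card T = 2 * k" by (simp add: T_def card_cartesian_product cI)
    have cover: "P \<subseteq> (\<Union>t\<in>T. Q t)"
    proof
      fix y assume y: "y \<in> P"
      have "\<exists>a\<in>I. (y $ a)\<^sup>2 \<ge> \<tau>\<^sup>2"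
      proof (rule ccontr)
        assume "\<not> ?thesis"
        then have "(\<Sum>i\<in>I. (y $ i)\<^sup>2) < (\<Sum>i\<in>I. \<tau>\<^sup>2)"
          using cI k by (intro sum_strict_mono) (auto simp: not_le)
        also have "\<dots> = \<rho>'\<^sup>2" using k by (simp add: cI \<tau>(2))
        finally show False using \<sigma> sphere[OF y] by simp
      qed
      then obtain a where a: "a \<in> I" "(y $ a)\<^sup>2 \<ge> \<tau>\<^sup>2" by blast
      then have "\<tau> \<le> \<bar>y $ a\<bar>" using \<tau>(1) abs_le_square_iff[of \<tau> "y $ a"] by simp
      then have "\<tau> \<le> 1 * y $ a \<or> \<tau> \<le> (-1) * y $ a" by linarith
      then show "y \<in> (\<Union>t\<in>T. Q t)" using a y unfolding T_def Q_def by auto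
    qed
    have "c / \<delta> ^ (k - 1) > 0" using c \<delta> by simp
    then have "P \<noteq> {}" using P(3) by auto
    then obtain a s where as: "a \<in> I" "s = 1 \<or> s = (-1::real)"
      "real (card (cell \<delta> ` P)) \<le> 2 * real k * real (card (cell \<delta> ` Q (a, s)))"
    proof -
      have "finite T" by (simp add: T_def)
      moreover have "finite (Q t)" for t using finP by (cases t) (simp add: Q_def)
      ultimately obtain t where t: "t \<in> T" "real (card (cell \<delta> ` P)) \<le> real (card T) * real (card (cell \<delta> ` Q t))"
        using pigeonhole_images[of T P Q "cell \<delta>"] cover \<open>P \<noteq> {}\<close> by blast
      obtain a s where "t = (a, s)" by (cases t)
      moreover have "a \<in> I" "s = 1 \<or> s = -1" using t(1) \<open>t = (a, s)\<close> by (auto simp: T_def)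
      moreover have "real (card T) = 2 * real k" by (simp add: cT)
      ultimately show ?thesis using that[of a s] t(2) by simp
    qed
    obtain b where b: "b \<in> I" "b \<noteq> a"
    proof -
      have "card (I - {a}) > 0" using cI k as(1) by simp
      then obtain b where "b \<in> I - {a}" by (metis card_gt_0_iff ex_in_conv)
      then show ?thesis using that by blast
    qed
    define \<Gamma> where "\<Gamma> = (\<lambda>m. m(b := 0)) ` (\<lambda>m. m(a := 0)) ` cell \<delta> ` Q (a, s)"
    have QP: "y \<in> P" "s * y $ a \<ge> \<tau>" if "y \<in> Q (a, s)" for y using that by (auto simp: Q_def)
    have finQ: "finite (Q (a, s))" using finP by (simp add: Q_def)
    have "real (card (cell \<delta> ` Q (a, s))) \<le> F * (4 / \<delta>) * real (card \<Gamma>)"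
      unfolding F_def \<Gamma>_def
      by (rule card_erase_two_coordinates[where I = I and \<sigma> = \<sigma> and s = s])
        (use as b \<delta> \<tau> finQ QP normP sphere in auto)
    then have "2 * real k * real (card (cell \<delta> ` Q (a, s))) \<le> 2 * real k * (F * (4 / \<delta>) * real (card \<Gamma>))"
      by (intro mult_left_mono) auto
    with as(3) P(3) have "c / \<delta> ^ (k - 1) \<le> 2 * real k * (F * (4 / \<delta>) * real (card \<Gamma>))" by linarith
    then have "c / \<delta> ^ (k - 1) * \<delta> \<le> 2 * real k * (F * (4 / \<delta>) * real (card \<Gamma>)) * \<delta>"
      using \<delta> by (intro mult_right_mono) auto
    also have "\<dots> = real (card \<Gamma>) * (8 * real k * F)"
      using \<delta> by simp
    also have "c / \<delta> ^ (k - 1) * \<delta> = c / \<delta> ^ (k - 2)"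
    proof -
      have "k - 1 = Suc (k - 2)" using k by simp
      then show ?thesis using \<delta> by simp
    qed
    finally have "c / \<delta> ^ (k - 2) \<le> real (card \<Gamma>) * (8 * real k * F)" .
    moreover have "8 * real k * F > 0" using F k by simp
    ultimately have c\<Gamma>: "c / \<delta> ^ (k - 2) / (8 * real k * F) \<le> real (card \<Gamma>)"
      by (simp only: pos_divide_le_eq)
    define G where "G = (\<lambda>y :: real^'n. ((cell \<delta> y)(a := 0))(b := 0))"
    define Y where "Y = inv_into (Q (a, s)) G"
    have \<Gamma>G: "\<Gamma> = G ` Q (a, s)" by (simp add: \<Gamma>_def G_def image_image)
    have Y: "Y \<gamma> \<in> Q (a, s)" "((cell \<delta> (Y \<gamma>))(a := 0))(b := 0) = \<gamma>" if "\<gamma> \<in> \<Gamma>" for \<gamma>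
      using inv_into_into[of \<gamma> G "Q (a, s)"] f_inv_into_f[of \<gamma> G "Q (a, s)"] that
      unfolding \<Gamma>G Y_def G_def by blast+
    have d: "distinct [a, b, j]" using as(1) b by (auto simp: I_def)
    define R where "R = (\<lambda>\<gamma>. (\<lambda>w. block a b j (prod_list w) (Y \<gamma>)) ` words S N)"
    have R: "e / \<delta>\<^sup>2 \<le> real (card (cell \<delta> ` R \<gamma>))" if "\<gamma> \<in> \<Gamma>" for \<gamma>
    proof -
      have q: "Y \<gamma> \<in> P" "s * Y \<gamma> $ a \<ge> \<tau>" using QP Y(1)[OF that] by auto
      have "\<tau>\<^sup>2 \<le> (s * Y \<gamma> $ a)\<^sup>2" using q(2) \<tau>(1) by (intro power_mono) auto
      also have "\<dots> = (Y \<gamma> $ a)\<^sup>2" using as(2) by auto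
      also have "\<dots> \<le> (Y \<gamma> $ a)\<^sup>2 + (Y \<gamma> $ b)\<^sup>2 + (Y \<gamma> $ j)\<^sup>2" by simp
      finally show ?thesis
        unfolding e_def R_def by (intro block_cells d normP q \<tau>(1) \<delta> N)
    qed
    have coord: "cell \<delta> y i = \<gamma> i" if "\<gamma> \<in> \<Gamma>" "y \<in> R \<gamma>" "i \<notin> {a, b, j}" for \<gamma> y i
    proof -
      have "y $ i = Y \<gamma> $ i" using that block_other[OF that(3)] by (auto simp: R_def)
      then show ?thesis using fun_cong[OF Y(2)[OF that(1)], of i] that(3) by (auto simp: cell_def)
    qed
    have \<Gamma>j: "\<gamma> a = 0" "\<gamma> b = 0" "\<gamma> j = \<lfloor>x $ j / \<delta>\<rfloor>" if "\<gamma> \<in> \<Gamma>" for \<gamma>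
    proof -
      have "Y \<gamma> $ j = x $ j" using P(2) QP(1)[OF Y(1)[OF that]] by (simp add: I_def)
      then show "\<gamma> a = 0" "\<gamma> b = 0" "\<gamma> j = \<lfloor>x $ j / \<delta>\<rfloor>"
        using fun_cong[OF Y(2)[OF that], of a] fun_cong[OF Y(2)[OF that], of b] fun_cong[OF Y(2)[OF that], of j] d
        by (auto simp: cell_def)
    qed
    have disj: "cell \<delta> ` R \<gamma> \<inter> cell \<delta> ` R \<gamma>' = {}" if "\<gamma> \<in> \<Gamma>" "\<gamma>' \<in> \<Gamma>" "\<gamma> \<noteq> \<gamma>'" for \<gamma> \<gamma>'
    proof (rule ccontr)
      assume "\<not> ?thesis"
      then obtain y z where yz: "y \<in> R \<gamma>" "z \<in> R \<gamma>'" "cell \<delta> y = cell \<delta> z" by auto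
      have "\<gamma> i = \<gamma>' i" for i
        using coord[OF that(1) yz(1), of i] coord[OF that(2) yz(2), of i] yz(3) \<Gamma>j[OF that(1)] \<Gamma>j[OF that(2)]
        by (cases "i \<in> {a, b, j}") auto
      with that(3) show False by blast
    qed
    define P' where "P' = (\<Union>\<gamma>\<in>\<Gamma>. R \<gamma>)"
    have fin\<Gamma>: "finite \<Gamma>" using finQ by (simp add: \<Gamma>_def)
    have finR: "finite (R \<gamma>)" for \<gamma> using finite_words[OF finite_S] by (simp add: R_def)
    have "card (cell \<delta> ` P') = (\<Sum>\<gamma>\<in>\<Gamma>. card (cell \<delta> ` R \<gamma>))"
      unfolding P'_def image_UN using fin\<Gamma> finR disj by (intro card_UN_disjoint) auto
    then have "real (card (cell \<delta> ` P')) = (\<Sum>\<gamma>\<in>\<Gamma>. real (card (cell \<delta> ` R \<gamma>)))" by simp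
    also have "\<dots> \<ge> (\<Sum>\<gamma>\<in>\<Gamma>. e / \<delta>\<^sup>2)" by (intro sum_mono R)
    finally have "real (card \<Gamma>) * (e / \<delta>\<^sup>2) \<le> real (card (cell \<delta> ` P'))" by simp
    moreover have "c / \<delta> ^ (k - 2) / (8 * real k * F) * (e / \<delta>\<^sup>2) \<le> real (card \<Gamma>) * (e / \<delta>\<^sup>2)"
      using c\<Gamma> e by (intro mult_right_mono) auto
    moreover have "c / \<delta> ^ (k - 2) / (8 * real k * F) * (e / \<delta>\<^sup>2) = c * e / (8 * real k * F) / \<delta> ^ (Suc k - 1)"
    proof -
      have "Suc k - 1 = (k - 2) + 2" using k by simp
      then have "\<delta> ^ (Suc k - 1) = \<delta> ^ (k - 2) * \<delta>\<^sup>2" by (simp only: power_add)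
      then show ?thesis by simp
    qed
    ultimately have "c * e / (8 * real k * F) / \<delta> ^ (Suc k - 1) \<le> real (card (cell \<delta> ` P'))" by linarith
    moreover have "P' \<subseteq> reach (gens S) ((Suc k - 2) * N) x"
    proof
      fix z assume "z \<in> P'"
      then obtain \<gamma> w where z: "\<gamma> \<in> \<Gamma>" "w \<in> words S N" "z = block a b j (prod_list w) (Y \<gamma>)"
        by (auto simp: P'_def R_def)
      have "Y \<gamma> \<in> reach (gens S) ((k - 2) * N) x" using P(1) QP(1)[OF Y(1)[OF z(1)]] by blast
      from reach_add[OF this block_word_reach[OF d z(2), of "Y \<gamma>"]]
      have "z \<in> reach (gens S) ((k - 2) * N + N) x" unfolding z(3) .
      moreover have "(k - 2) * N + N = (Suc k - 2) * N" 
      proof -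
        have "Suc k - 2 = Suc (k - 2)" using k by simp
        then show ?thesis by simp
      qed
      ultimately show "z \<in> reach (gens S) ((Suc k - 2) * N) x" by simp
    qed
    moreover have "\<forall>y\<in>P'. \<forall>i. i \<notin> I' \<longrightarrow> y $ i = x $ i"
    proof (intro ballI allI impI)
      fix z i assume "z \<in> P'" and i: "i \<notin> I'"
      then obtain \<gamma> w where z: "\<gamma> \<in> \<Gamma>" "w \<in> words S N" "z = block a b j (prod_list w) (Y \<gamma>)"
        by (auto simp: P'_def R_def)
      have "i \<notin> {a, b, j}" "i \<notin> I" using i as(1) b j(1) by (auto simp: I_def)
      then have "z $ i = Y \<gamma> $ i" unfolding z(3) by (intro block_other)
      also have "\<dots> = x $ i" using QP(1)[OF Y(1)[OF z(1)]] \<open>i \<notin> I\<close> by (rule P(2))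
      finally show "z $ i = x $ i" .
    qed
    ultimately show "covers (c * e / (8 * real k * F)) I' x \<delta> N"
      unfolding covers_def I' by blast
  qed
qed

lemma reach_cells:
  assumes "CARD('n::finite) \<ge> 3"
  shows "\<exists>c>0. \<forall>(x :: real^'n) \<delta> N. norm x = 1 \<longrightarrow> 0 < \<delta> \<longrightarrow> \<delta> \<le> 1 \<longrightarrow> real N \<ge> 2 * K * ln (1 / \<delta>) \<longrightarrow>
    c / \<delta> ^ (CARD('n) - 1) \<le> real (card (cell \<delta> ` reach (gens S) ((CARD('n) - 2) * N) x))"
proof -
  have "spreads TYPE('n) k" if "k \<ge> 3" for k
    using that by (induction k rule: nat_induct_at_least) (auto intro: spreads_3 spreads_Suc)
  with assms have "spreads TYPE('n) CARD('n)" by blast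
  then obtain c where c: "c > 0" "\<And>(I :: 'n set) (x :: real^'n) \<delta> N. card I = CARD('n) \<Longrightarrow> norm x = 1 \<Longrightarrow>
     1\<^sup>2 \<le> (\<Sum>i\<in>I. (x $ i)\<^sup>2) \<Longrightarrow> 0 < \<delta> \<Longrightarrow> \<delta> \<le> 1 \<Longrightarrow> real N \<ge> 2 * K * ln (1 / \<delta>) \<Longrightarrow>
     covers c I x \<delta> N"
    unfolding spreads_def using zero_less_one by blast
  have "c / \<delta> ^ (CARD('n) - 1) \<le> real (card (cell \<delta> ` reach (gens S) ((CARD('n) - 2) * N) x))"
    if x: "norm x = 1" "0 < \<delta>" "\<delta> \<le> 1" "real N \<ge> 2 * K * ln (1 / \<delta>)" for x :: "real^'n" and \<delta> N
  proof -
    have "1\<^sup>2 \<le> (\<Sum>i\<in>UNIV. (x $ i)\<^sup>2)" using x(1) norm_vec_squares[of x] by simp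
    then have "covers c UNIV x \<delta> N" using x by (intro c(2)) auto
    then obtain P where
      P: "P \<subseteq> reach (gens S) ((CARD('n) - 2) * N) x" "c / \<delta> ^ (CARD('n) - 1) \<le> real (card (cell \<delta> ` P))"
      unfolding covers_def by blast
    have "card (cell \<delta> ` P) \<le> card (cell \<delta> ` reach (gens S) ((CARD('n) - 2) * N) x)"
      using P(1) finite_reach[OF finite_gens[OF finite_S]] by (intro card_mono) auto
    with P(2) show ?thesis by linarith
  qed
  with c(1) show ?thesis by blast
qed

end

section \<open>Long products as generators and the final bound\<close>

text \<open>Cutting words of length \<open>n * m\<close> into blocks of length \<open>m\<close>
  makes the block products usable as generators, so that a multiplicative constant can be absorbed
  by a single step.\<close>

lemma reach_words:
  fixes G :: "(real^'n^'n) set"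
  shows "reach ((\<lambda>As. foldr (**) As (mat 1)) ` words G m) n x = reach G (n * m) x"
proof (induction n)
  case (Suc n)
  have fold_mat: "foldr (**) As (mat 1) *v y = foldr (\<lambda>A v. A *v v) As y" for As and y :: "real^'n"
    by (induction As) (auto simp: matrix_vector_mul_assoc[symmetric])
  let ?G = "(\<lambda>As. foldr (**) As (mat 1)) ` words G m"
  have step: "reach H (Suc n) x = (\<Union>A\<in>H. (\<lambda>y. A *v y) ` reach H n x)" for H :: "(real^'n^'n) set"
  proof -
    have "reach H (Suc n) x = (\<lambda>(A, As). A *v foldr (\<lambda>A v. A *v v) As x) ` (H \<times> words H n)"
      by (simp add: reach_def words_Suc image_image case_prod_unfold)
    then show ?thesis by (auto simp: reach_def)
  qed
  have "reach ?G (Suc n) x = (\<Union>As\<in>words G m. (\<lambda>y. foldr (\<lambda>A v. A *v v) As y) ` reach G (n * m) x)"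
    unfolding step Suc by (simp add: fold_mat)
  also have "\<dots> = reach G (Suc n * m) x"
  proof
    show "(\<Union>As\<in>words G m. (\<lambda>y. foldr (\<lambda>A v. A *v v) As y) ` reach G (n * m) x) \<subseteq> reach G (Suc n * m) x"
    proof clarify
      fix As y assume "As \<in> words G m" "y \<in> reach G (n * m) x"
      then have "foldr (\<lambda>A v. A *v v) As y \<in> reach G (n * m + m) x"
        by (intro reach_add[of y]) (auto simp: reach_def)
      then show "foldr (\<lambda>A v. A *v v) As y \<in> reach G (Suc n * m) x" by (simp add: add.commute)
    qed
    show "reach G (Suc n * m) x \<subseteq> (\<Union>As\<in>words G m. (\<lambda>y. foldr (\<lambda>A v. A *v v) As y) ` reach G (n * m) x)"
    proof
      fix z assume "z \<in> reach G (Suc n * m) x"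
      then obtain Cs where Cs: "Cs \<in> words G (Suc n * m)" "z = foldr (\<lambda>A v. A *v v) Cs x" by (auto simp: reach_def)
      have "take m Cs \<in> words G m" "drop m Cs \<in> words G (n * m)"
        using Cs(1) by (auto simp: words_def dest: in_set_takeD in_set_dropD)
      moreover have "z = foldr (\<lambda>A v. A *v v) (take m Cs) (foldr (\<lambda>A v. A *v v) (drop m Cs) x)"
        unfolding Cs(2) by (subst (1) append_take_drop_id[of m Cs, symmetric]) (simp only: foldr_append o_apply)
      ultimately show "z \<in> (\<Union>As\<in>words G m. (\<lambda>y. foldr (\<lambda>A v. A *v v) As y) ` reach G (n * m) x)"
        unfolding reach_def by blast
    qed
  qed
  finally show ?case .
qed (auto simp: reach_def)

lemma rotation_matrix_foldr:
  assumes "\<And>A. A \<in> set As \<Longrightarrow> rotation_matrix A"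
  shows "rotation_matrix (foldr (**) As (mat 1))"
  using assms
  by (induction As) (auto simp: rotation_matrix_def orthogonal_matrix_id orthogonal_matrix_mul det_mul)

lemma orbit_words_eq_reach:
  assumes "g ` {1..k} = G"
  shows "orbit_words g k n x = reach G n x"
proof -
  have w: "words G n = map g ` words {1..k} n"
    unfolding assms[symmetric] by (rule words_image)
  have "foldr (\<lambda>A v. A *v v) (map g is) x = foldr (\<lambda>i v. g i *v v) is x" for "is"
    by (induction "is") auto
  then have "reach G n x = (\<lambda>is. foldr (\<lambda>i v. g i *v v) is x) ` words {1..k} n"
    by (simp add: reach_def w image_image)
  then show ?thesis by (auto simp: orbit_words_def words_def)
qed

theorem theorem3p1:
  assumes "CARD('n::finite) \<ge> 3"
  shows "\<exists>(k::nat) (g :: nat \<Rightarrow> real^'n^'n) (\<epsilon>::real).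
           (\<forall>i\<in>{1..k}. rotation_matrix (g i)) \<and> \<epsilon> > 0 \<and>
           (\<forall>(x::real^'n) (n::nat) (\<delta>::real). norm x = 1 \<longrightarrow> \<delta> > 0 \<longrightarrow>
              real (mesh_count \<delta> (orbit_words g k n x))
                \<ge> min ((1 + \<epsilon>) ^ n) (\<epsilon> * \<delta> powr (- real (CARD('n) - 1))))"
proof -
  define d where "d = CARD('n)"
  have d: "d \<ge> 3" using assms by (simp add: d_def)
  obtain S :: "real quat set" and C K where S: "finite S" "S \<noteq> {}" "\<And>s. s \<in> S \<Longrightarrow> qnorm s = 1" "C > 0" "K > 0"
    "\<And>L N h. L \<ge> 1 \<Longrightarrow> real N \<ge> K * ln (real L) \<Longrightarrow> qnorm h = 1 \<Longrightarrow>
      pair_sum S N (\<lambda>v w. qdot (v * h) w ^ (2 * L)) \<le>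
        C * real L powr (-3 / 2) * real (card S) ^ (2 * N)"
    by (rule expanding_unit_quats) (rule that)
  interpret expanding_quats S C K
    by unfold_locales (use S in auto)
  obtain c0 where c0: "c0 > 0" "\<And>(x :: real^'n) \<delta> N. norm x = 1 \<Longrightarrow> 0 < \<delta> \<Longrightarrow> \<delta> \<le> 1 \<Longrightarrow> real N \<ge> 2 * K * ln (1 / \<delta>) \<Longrightarrow>
    c0 / \<delta> ^ (d - 1) \<le> real (card (cell \<delta> ` reach (gens S) ((d - 2) * N) x))"
    using reach_cells[OF assms] unfolding d_def by blast
  \<comment> \<open>With \<open>c \<le> 1\<close> the second argument of the minimum is at most 1
    for \<open>\<delta> \<ge> 1\<close>, and one cell suffices.\<close>
  define c where "c = min 1 c0"
  have c: "c > 0" "c \<le> 1" using c0 by (auto simp: c_def)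
  have cells: "c / \<delta> ^ (d - 1) \<le> real (card (cell \<delta> ` reach (gens S) ((d - 2) * N) x))"
    if "norm x = 1" "0 < \<delta>" "\<delta> \<le> 1" "real N \<ge> 2 * K * ln (1 / \<delta>)" for x :: "real^'n" and \<delta> N
  proof -
    have "c / \<delta> ^ (d - 1) \<le> c0 / \<delta> ^ (d - 1)" using that by (intro divide_right_mono) (auto simp: c_def)
    with c0(2)[OF that] show ?thesis by linarith
  qed
  define K2 where "K2 = 2 * K"
  have K2: "K2 > 0" using S(5) by (simp add: K2_def)
  \<comment> \<open>\<open>2 ^ d\<close> is lost by changing the mesh and \<open>c\<close> in the
    covering bound; \<open>n1\<close> rounds per step outgrow both.\<close>
  obtain n1 :: nat where n1: "n1 \<ge> 1" "2 ^ d / c \<le> exp (real n1 / K2)"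
  proof -
    obtain n :: nat where n: "real n > K2 * (2 ^ d / c)" using reals_Archimedean2 by blast
    have "2 ^ d / c \<le> real n / K2" using n K2 by (simp add: field_simps)
    also have "\<dots> \<le> exp (real n / K2)" using exp_ge_add_one_self[of "real n / K2"] by linarith
    finally have "2 ^ d / c \<le> exp (real n / K2)" .
    moreover have "K2 * (2 ^ d / c) > 0" using K2 c by simp
    then have "n \<ge> 1" using n by (cases n) auto
    ultimately show ?thesis using that by blast
  qed
  \<comment> \<open>Long products as generators: then already \<open>n = 1\<close> beats the multiplicative constants.\<close>
  define G where "G = (\<lambda>As. foldr (**) As (mat 1)) ` words (gens S :: (real^'n^'n) set) ((d - 2) * n1)"
  have finG: "finite G" unfolding G_def by (intro finite_imageI finite_words finite_gens finite_S)
  have rotG: "rotation_matrix A" if "A \<in> G" for A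
    using that rotation_matrix_gens unfolding G_def words_def by (auto intro!: rotation_matrix_foldr)
  obtain g where g: "g ` {1..card G} = G"
    using ex_bij_betw_nat_finite_1[OF finG] by (auto simp: bij_betw_def)
  have count: "mesh_count \<delta> (orbit_words g (card G) n x) = card (cell \<delta> ` reach (gens S) ((d - 2) * (n1 * n)) x)"
    if "\<delta> > 0" for \<delta> n and x :: "real^'n"
  proof -
    have "reach G n x = reach (gens S) (n * ((d - 2) * n1)) x" unfolding G_def by (rule reach_words)
    also have "n * ((d - 2) * n1) = (d - 2) * (n1 * n)" by simp
    finally show ?thesis
      unfolding mesh_count_eq_card_cells[OF that] orbit_words_eq_reach[OF g] by simp
  qed
  have bound: "min ((1 + c) ^ n) (c * \<delta> powr (- real (d - 1))) \<le> real (mesh_count \<delta> (orbit_words g (card G) n x))"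
    if x: "norm x = 1" and \<delta>: "\<delta> > 0" for x :: "real^'n" and n \<delta>
  proof -
    let ?R = "reach (gens S) ((d - 2) * (n1 * n)) x"
    have finR: "finite ?R" by (rule finite_reach[OF finite_gens[OF finite_S]])
    have pw: "c * \<delta> powr (- real (d - 1)) = c / \<delta> ^ (d - 1)"
      using \<delta> by (simp add: powr_minus_divide powr_realpow)
    have "?R \<noteq> {}"
    proof -
      have "card (words (gens S :: (real^'n^'n) set) N) > 0" for N
      proof -
        obtain a b e :: 'n where "distinct [a, b, e]"
        proof -
          obtain T :: "'n set" where "card T = 3" using assms by (metis obtain_subset_with_card_n)
          then show ?thesis using that by (auto simp: card_3_iff)
        qed
        moreover obtain s where "s \<in> S" using S(2) by blast
        ultimately have "(gens S :: (real^'n^'n) set) \<noteq> {}" unfolding gens_def by blast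
        then have "card (gens S :: (real^'n^'n) set) > 0" using finite_gens[OF finite_S] by (simp add: card_gt_0_iff)
        then show ?thesis unfolding card_words[OF finite_gens[OF finite_S]] by simp
      qed
      then show ?thesis unfolding reach_def by (metis card.empty image_is_empty less_numeral_extra(3))
    qed
    then have one: "1 \<le> real (card (cell \<delta> ` ?R))"
      using finR by (simp add: Suc_le_eq card_gt_0_iff)
    \<comment> \<open>Words long enough for \<open>\<delta>\<close> reach the second argument of the
      minimum; shorter ones have to reach the first.\<close>
    consider "n = 0" | "\<delta> \<ge> 1" | "n > 0" "\<delta> < 1" "real (n1 * n) \<ge> 2 * K * ln (1 / \<delta>)"
      | "n > 0" "\<delta> < 1" "real (n1 * n) < 2 * K * ln (1 / \<delta>)" by linarith
    then show ?thesis
    proof cases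
      case 1
      then show ?thesis using one unfolding count[OF \<delta>] by simp
    next
      case 2
      then have "c / \<delta> ^ (d - 1) \<le> c / 1" using c by (intro divide_left_mono) auto
      with c one show ?thesis unfolding count[OF \<delta>] pw by linarith
    next
      case 3
      then show ?thesis using cells[OF x \<delta>, of "n1 * n"] unfolding count[OF \<delta>] pw by linarith
    next
      case 4
      define y where "y = real (n1 * n) / K2"
      \<comment> \<open>The mesh size for which words of this length are just long enough. It
        exceeds \<open>\<delta>\<close>, so its count passes to the finer mesh at the cost of
        \<open>2 ^ d\<close>.\<close>
      define \<delta>' where "\<delta>' = exp (- y)"
      have y0: "y \<ge> 0" using K2 by (simp add: y_def)
      have ln': "2 * K * ln (1 / \<delta>') = real (n1 * n)"
        using K2 by (simp add: \<delta>'_def ln_div y_def K2_def)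
      have "y < - ln \<delta>" using 4 K2 \<delta> by (simp add: y_def K2_def ln_div field_simps)
      then have "exp (ln \<delta>) < \<delta>'" unfolding \<delta>'_def by simp
      then have "\<delta> < \<delta>'" using \<delta> by simp
      have \<delta>'1: "0 < \<delta>'" "\<delta>' \<le> 1" using y0 by (simp_all add: \<delta>'_def)
      have "c / \<delta>' ^ (d - 1) \<le> real (card (cell \<delta>' ` ?R))"
        using cells[OF x \<delta>'1, of "n1 * n"] ln' by simp
      also have "\<dots> \<le> real (2 ^ d * card (cell \<delta> ` ?R))"
        unfolding d_def using card_cells_coarser[OF \<delta> less_imp_le[OF \<open>\<delta> < \<delta>'\<close>] finR[unfolded d_def]]
        by (intro of_nat_mono)
      finally have "c / \<delta>' ^ (d - 1) / 2 ^ d \<le> real (card (cell \<delta> ` ?R))"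
        by (subst pos_divide_le_eq) (simp_all add: mult.commute)
      moreover have "c / 2 ^ d / \<delta>' ^ (d - 1) = c / \<delta>' ^ (d - 1) / 2 ^ d" by simp
      ultimately have main: "c / 2 ^ d / \<delta>' ^ (d - 1) \<le> real (card (cell \<delta> ` ?R))"
        by (simp only:)
      have e1: "exp y = exp (real n1 / K2) ^ n"
        by (simp add: y_def flip: exp_of_nat_mult)
      have big: "2 ^ d / c \<ge> 2"
      proof -
        have "(2::real) ^ 1 \<le> 2 ^ d" using d by (intro power_increasing) auto
        also have "\<dots> \<le> 2 ^ d / c" using c by (simp add: le_divide_eq)
        finally show ?thesis by simp
      qed
      have e2: "(1 + c) ^ n \<le> exp y"
        unfolding e1 using n1(2) big c by (intro power_mono) auto
      have e3: "2 ^ d / c \<le> exp y"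
      proof -
        have "exp (real n1 / K2) ^ 1 \<le> exp (real n1 / K2) ^ n"
          using 4(1) K2 by (intro power_increasing) auto
        then show ?thesis using n1(2) unfolding e1 by simp
      qed
      \<comment> \<open>\<open>d - 1 \<ge> 2\<close> gives two factors \<open>exp y\<close>: one
        absorbs \<open>2 ^ d / c\<close>, the other dominates \<open>(1 + c) ^ n\<close>.\<close>
      have "exp y * exp y = exp y ^ 2" by (simp add: power2_eq_square)
      also have "\<dots> \<le> exp y ^ (d - 1)" using y0 d by (intro power_increasing) auto
      also have "\<dots> = 1 / \<delta>' ^ (d - 1)" by (simp add: \<delta>'_def exp_minus power_inverse divide_inverse)
      finally have "c / 2 ^ d * (exp y * exp y) \<le> c / 2 ^ d * (1 / \<delta>' ^ (d - 1))"
        using c by (intro mult_left_mono) auto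
      moreover have "1 * exp y \<le> c / 2 ^ d * exp y * exp y"
        using e3 c by (intro mult_right_mono) (simp_all add: field_simps)
      ultimately have "(1 + c) ^ n \<le> real (card (cell \<delta> ` ?R))"
        using main e2 by (simp add: mult.assoc)
      then show ?thesis unfolding count[OF \<delta>] by linarith
    qed
  qed
  show ?thesis
  proof (intro exI conjI ballI allI impI)
    show "rotation_matrix (g i)" if "i \<in> {1..card G}" for i using rotG g that by blast
    show "c > 0" by (rule c)
    show "real (mesh_count \<delta> (orbit_words g (card G) n x)) \<ge> min ((1 + c) ^ n) (c * \<delta> powr (- real (CARD('n) - 1)))"
      if "norm x = 1" "\<delta> > 0" for x :: "real^'n" and n \<delta>
      using bound[OF that] unfolding d_def .
  qed
qed

end
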